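(* Let $n\ge 2$, let $E\neq\emptyset$ be a closed set in $\mathbb{R}^n$ and let $1\le p\le q< np/(n-p)<\infty$. Then there is a constant $C>0$ such that the inequality $$\biggl(\int_{\mathbb{R}^n} |f|^q \, \delta_E^{(q/p)(n-p)-n}\,dx\biggr)^{1/q}\le C\biggl(\int_{\mathbb{R}^n} |\nabla f|^p\,dx\biggr)^{1/p}$$ holds for every $f\in C^\infty_0(\mathbb{R}^n)$ if and only if $\dim_A(E)<\frac{q}{p}(n-p)$.
   Context: Here $\delta_E(x)=\operatorname{dist}(x,E)$ is the Euclidean distance from $x$ to $E$; negative powers of $\delta_E$ are understood to equal $+\infty$ on $E$, with $0\cdot\infty=0$. The condition $np/(n-p)<\infty$ means in particular that $p<n$. $C_0^\infty(\mathbb{R}^n)$ denotes smooth functions with compact support in $\mathbb{R}^n$. For bounded $A\subset\mathbb{R}^n$ and $r>0$, $N(A,r)$ is the minimal number of open balls of radius $r$ centered at points of $A$ needed to cover $A$. $B(x,R)$ is the open ball and $d(E)$ is the diameter of $E$. The (upper) Assouad dimension is $\dim_A(E)=\inf\{\lambda\ge 0:\ \exists\, C_\lambda>0 \text{ such that } N(E\cap B(x,R),r)\le C_\lambda (r/R)^{-\lambda}\text{ for all } x\in E,\ 0<r<R<d(E)\}$ (so it is $0$ for a one-point set). *)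

theory Defs
  imports "HOL-Analysis.Analysis"
begin

text \<open>
  Real powers of extended nonnegative numbers; negative powers of \<open>0\<close> are \<open>\<infinity>\<close>.
\<close>

definition epowr :: "ennreal \<Rightarrow> real \<Rightarrow> ennreal" where
  "epowr x a =
    (if a = 0 then 1
     else if x = 0 then (if a > 0 then 0 else \<infinity>)
     else if x = \<infinity> then (if a > 0 then \<infinity> else 0)
     else ennreal (enn2real x powr a))"

fun Ck :: "nat \<Rightarrow> ('a::euclidean_space \<Rightarrow> real) \<Rightarrow> bool" where
  "Ck 0 f \<longleftrightarrow> continuous_on UNIV f"
| "Ck (Suc k) f \<longleftrightarrow>
     (\<forall>x. f differentiable (at x)) \<and>
     (\<forall>b\<in>Basis. Ck k (\<lambda>x. frechet_derivative f (at x) b))"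

definition test_function :: "('a::euclidean_space \<Rightarrow> real) \<Rightarrow> bool" where
  "test_function f \<longleftrightarrow> (\<forall>k. Ck k f) \<and> compact (closure {x. f x \<noteq> 0})"

definition grad :: "('a::euclidean_space \<Rightarrow> real) \<Rightarrow> 'a \<Rightarrow> 'a" where
  "grad f x = (\<Sum>b\<in>Basis. frechet_derivative f (at x) b *\<^sub>R b)"

text \<open>The value is \<open>\<infinity>\<close> when \<open>A\<close> has no such finite cover.\<close>

definition covering_number :: "'a::metric_space set \<Rightarrow> real \<Rightarrow> enat" where
  "covering_number A r =
    (INF F \<in> {F. finite F \<and> F \<subseteq> A \<and> A \<subseteq> (\<Union>y\<in>F. ball y r)}. enat (card F))"

text \<open>
  The library's \<^const>\<open>diameter\<close> is \<open>0\<close> for unbounded sets; here the diameter of an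
  unbounded set must be \<open>\<infinity>\<close>.
\<close>

definition ediameter :: "'a::metric_space set \<Rightarrow> ereal" where
  "ediameter E = (SUP (x, y) \<in> E \<times> E. ereal (dist x y))"

definition assouad_dim :: "'a::metric_space set \<Rightarrow> ereal" where
  "assouad_dim E =
    (INF l \<in> {l::real. l \<ge> 0 \<and>
        (\<exists>C>0. \<forall>x\<in>E. \<forall>r R. 0 < r \<and> r < R \<and> ereal R < ediameter E \<longrightarrow>
            ereal_of_enat (covering_number (E \<inter> ball x R) r) \<le> ereal (C * (r / R) powr (- l)))}.
      ereal l)"

end

theory Submission
  imports Defs
begin

text \<open>
  Put \<open>d = (q/p)(n - p)\<close>, so that \<open>0 < d < n\<close>, and let \<open>W\<close> be \<open>\<delta>\<^sub>E\<close> to the power \<open>d - n\<close>.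
  Both directions pass through the growth condition that the integral of \<open>W\<close> over
  \<open>B(x,R)\<close> is at most a constant times \<open>R\<close> to the power \<open>d\<close>, for all \<open>x \<in> E\<close> and \<open>R > 0\<close>.

  If the inequality holds, testing it with a bump function on \<open>B(x,R)\<close> gives the growth condition
  (\<open>weight_growth_of_inequality\<close>). Since \<open>W\<close> is large near \<open>E\<close> at every scale at once, the
  condition bounds a sum over scales \<open>j\<close> of the cardinality of a \<open>2^-jR\<close>-separated set
  times \<open>2^-jd\<close> (\<open>packing_sum_le\<close>), and not only each term. This is the source of the
  strict inequality (\<open>assouad_dim_less\<close>): packing numbers are submultiplicative
  across scales, so if for every \<open>k\<close> some packing at scale \<open>2^-kR\<close> had more than
  \<open>2^kd/2\<close> points, all the intermediate scales \<open>j < k\<close> would be almost extremal as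
  well and the sum would grow linearly in \<open>k\<close>. Hence some \<open>k\<close> gains a factor \<open>1/2\<close>
  uniformly in the ball, and iterating this gain over scales gives the exponent \<open>d - 1/k\<close>.

  Conversely, if the Assouad dimension is smaller than \<open>d\<close>, then covering \<open>E\<close> at each dyadic scale
  gives the growth condition as a convergent geometric series
  (\<open>weight_growth_of_assouad_dim\<close>). All exponents \<open>p \<ge> 1\<close> are then treated through one
  weighted inequality whose right-hand side is linear in the gradient. With \<open>a = 1 - 1/p\<close>,
  \<open>\<gamma> = 1 + qa\<close>, \<open>Q = q/\<gamma> \<ge> 1\<close> and
  \<open>w\<close> equal to \<open>\<delta>\<^sub>E\<close> to the power \<open>(d - n)a\<close>, it says that the \<open>1/Q\<close>-th power of the integral of
  \<open>|f|^q W\<close> is at most a constant times the integral of \<open>|grad f| |f|^(\<gamma>-1) w\<close>. By Hoelder's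
  inequality the latter is at most the \<open>L^p\<close> norm of the gradient times the \<open>a\<close>-th power of the
  same integral of \<open>|f|^q W\<close>, which is finite and can be divided out: \<open>1/Q - a = 1/q\<close>.

  The weighted inequality is proved level by level, in the spirit of Gustin's boxing inequality
  (\<open>boxing_inequality\<close>). Around each point of \<open>{|f| > t}\<close> there is a ball that this set
  fills to a fixed proportion, neither too little nor too much; by a relative isoperimetric
  inequality such a ball carries a definite amount of the gradient in the thin strip
  \<open>t < |f| < t + h\<close>. A Vitali subfamily and the growth of \<open>W\<close> on balls (\<open>weighted_ball_bound\<close>)
  then bound the \<open>W\<close>-mass of \<open>{|f| > t}\<close> by strip integrals. Using strips and Fatou's lemma
  instead of perimeters and the coarea formula keeps everything at the level of
  \<open>C\<^sup>1\<close> functions. Integration over \<open>t\<close> (\<open>level_sets_to_norm\<close>) finishes the argument.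
\<close>

section \<open>Extended real powers\<close>

lemma epowr_ennreal:
  assumes "x > 0 \<or> (x = 0 \<and> a > 0)"
  shows "epowr (ennreal x) a = ennreal (x powr a)"
  using assms by (auto simp: epowr_def)

lemma epowr_mono: "a > 0 \<Longrightarrow> x \<le> y \<Longrightarrow> epowr x a \<le> epowr y a"
  by (cases x; cases y) (auto simp: epowr_def top_unique powr_mono2)

lemma measurable_epowr [measurable]: "(\<lambda>x. epowr x a) \<in> borel_measurable borel"
  unfolding epowr_def by measurable

lemma measurable_infdist [measurable]: "(\<lambda>x. infdist x E) \<in> borel_measurable borel"
  by (intro borel_measurable_continuous_onI continuous_intros)

text \<open>
  This inverts the outer exponent in the inequality without knowing beforehand that the
  integral on the left is finite.
\<close>

lemma epowr_inverse_le:
  assumes "a > 0" "y \<ge> 0" "epowr x (1 / a) \<le> ennreal y"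
  shows "x \<le> ennreal (y powr a)"
proof (cases x)
  case (real r)
  show ?thesis
  proof (cases "r = 0")
    case False
    then have "r powr (1 / a) \<le> y" using real assms by (simp add: epowr_ennreal)
    then have "(r powr (1 / a)) powr a \<le> y powr a" using assms by (intro powr_mono2) auto
    then show ?thesis using real assms by (simp add: powr_powr)
  qed (use real in simp)
qed (use assms in \<open>simp add: epowr_def top_unique\<close>)

section \<open>A smooth bump function\<close>

lemma frechet_derivative_eqI: "(f has_derivative f') (at x) \<Longrightarrow> frechet_derivative f (at x) = f'"
  using frechet_derivative_at by metis

lemma Ck_Suc_imp_Ck: "Ck (Suc k) f \<Longrightarrow> Ck k f"
proof (induction k arbitrary: f)
  case 0
  then show ?case
    by (auto intro!: differentiable_imp_continuous_on simp: differentiable_on_def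
        intro: differentiable_at_withinI)
next
  case (Suc k)
  then show ?case by (metis Ck.simps(2))
qed

lemma Ck_const: "Ck k (\<lambda>x. c)"
  by (induction k arbitrary: c) (auto simp: frechet_derivative_const)

lemma Ck_add:
  assumes "Ck k f" "Ck k g"
  shows "Ck k (\<lambda>x. f x + g x)"
  using assms
proof (induction k arbitrary: f g)
  case 0
  then show ?case by (auto intro!: continuous_intros)
next
  case (Suc k)
  have "frechet_derivative (\<lambda>x. f x + g x) (at x)
      = (\<lambda>b. frechet_derivative f (at x) b + frechet_derivative g (at x) b)" for x
    using Suc.prems frechet_derivative_works
    by (intro frechet_derivative_eqI has_derivative_add) auto
  then show ?case using Suc by auto
qed

lemma frechet_derivative_times_real:
  fixes f g :: "'a::real_normed_vector \<Rightarrow> real"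
  assumes "f differentiable (at x)" "g differentiable (at x)"
  shows "frechet_derivative (\<lambda>x. f x * g x) (at x) =
    (\<lambda>h. f x * frechet_derivative g (at x) h + frechet_derivative f (at x) h * g x)"
  using assms unfolding frechet_derivative_works
  by (intro frechet_derivative_eqI has_derivative_mult)

lemma Ck_mult:
  assumes "Ck k f" "Ck k g"
  shows "Ck k (\<lambda>x. f x * g x)"
  using assms
proof (induction k arbitrary: f g)
  case 0
  then show ?case by (auto intro!: continuous_intros)
next
  case (Suc k)
  have "frechet_derivative (\<lambda>x. f x * g x) (at x)
      = (\<lambda>h. f x * frechet_derivative g (at x) h + frechet_derivative f (at x) h * g x)" for x
    using Suc.prems by (intro frechet_derivative_times_real) auto
  moreover have "Ck k f" "Ck k g" using Suc.prems Ck_Suc_imp_Ck by blast+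
  ultimately show ?case using Suc by (auto intro!: Ck_add)
qed

lemma Ck_inner_shift: "Ck k (\<lambda>x. c * ((x - a) \<bullet> b))"
proof (cases k)
  case 0
  then show ?thesis by (auto intro!: continuous_intros)
next
  case (Suc j)
  have D: "((\<lambda>x. c * ((x - a) \<bullet> b)) has_derivative (\<lambda>h. c * (h \<bullet> b))) (at x)" for x
    by (auto intro!: derivative_eq_intros)
  have "frechet_derivative (\<lambda>x. c * ((x - a) \<bullet> b)) (at x) = (\<lambda>h. c * (h \<bullet> b))" for x
    using D frechet_derivative_eqI by blast
  then show ?thesis using Suc D by (auto simp: Ck_const differentiable_def)
qed

text \<open>
  The functions \<open>exp(-1/t) / t^m\<close>, extended by zero to \<open>t \<le> 0\<close>. Their span is closed under
  differentiation, so one induction over the differentiability order handles all of them; the case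
  \<open>m = 0\<close> is the standard smooth function that is flat at the origin.
\<close>

definition flat :: "nat \<Rightarrow> real \<Rightarrow> real" where
  "flat m t = (if t > 0 then exp (- (1 / t)) / t ^ m else 0)"

lemma flat_eq: "flat m t = t * flat (Suc m) t"
  by (auto simp: flat_def)

text \<open>
  The \<open>m\<close>-th term of the exponential series at \<open>1/t\<close> is at most its sum.
\<close>

lemma flat_bound: assumes "t > 0" shows "flat m t \<le> fact m"
proof -
  have "(1/t) ^ m / fact m \<le> exp (1/t)"
  proof -
    have "(\<Sum>k\<in>{m}. (1/t) ^ k /\<^sub>R fact k) \<le> suminf (\<lambda>k. (1/t) ^ k /\<^sub>R fact k)"
      using assms by (intro sum_le_suminf summable_exp_generic) auto
    then show ?thesis by (simp add: exp_def field_simps)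
  qed
  then show ?thesis using assms
    by (simp add: flat_def exp_minus field_simps power_divide)
qed

lemma flat_nonneg: "flat m t \<ge> 0"
  by (auto simp: flat_def)

lemma flat_tendsto_0: "(flat m \<longlongrightarrow> 0) (at 0)"
proof (rule Lim_null_comparison)
  show "eventually (\<lambda>t. norm (flat m t) \<le> \<bar>t\<bar> * fact (Suc m)) (at 0)"
  proof (rule always_eventually, rule allI)
    fix t show "norm (flat m t) \<le> \<bar>t\<bar> * fact (Suc m)"
    proof (cases "t > 0")
      case True
      then show ?thesis using flat_bound[OF True, of "Suc m"] flat_eq[of m t] flat_nonneg[of m t]
        by (simp add: mult_left_mono del: fact_Suc)
    next
      case False
      then show ?thesis by (auto simp: flat_def simp del: fact_Suc intro!: mult_nonpos_nonneg)
    qed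
  qed
  show "((\<lambda>t. \<bar>t\<bar> * fact (Suc m)) \<longlongrightarrow> 0) (at (0::real))"
    by (auto intro!: tendsto_eq_intros)
qed

text \<open>
  At the origin the difference quotient of \<open>flat m\<close> is \<open>flat (m + 1)\<close>, which tends to zero.
\<close>

lemma flat_has_derivative:
  "(flat m has_real_derivative (flat (m + 2) t - m * flat (Suc m) t)) (at t)"
proof -
  consider "t > 0" | "t < 0" | "t = 0" by linarith
  then show ?thesis
  proof cases
    case 1
    have "((\<lambda>t. exp (- (1 / t)) / t ^ m) has_real_derivative (flat (m + 2) t - m * flat (Suc m) t)) (at t)"
    proof -
      have "((\<lambda>t. t ^ m) has_real_derivative m * t ^ m / t) (at t)"
        using DERIV_pow[of m t] 1 by (cases m) auto
      moreover have "((\<lambda>t. exp (- (1 / t))) has_real_derivative exp (- (1 / t)) / t\<^sup>2) (at t)"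
        using 1 by (auto intro!: derivative_eq_intros simp: power2_eq_square)
      ultimately have "((\<lambda>t. exp (- (1 / t)) / t ^ m) has_real_derivative
          (exp (- (1 / t)) / t\<^sup>2 * t ^ m - exp (- (1 / t)) * (m * t ^ m / t)) / (t ^ m * t ^ m)) (at t)"
        using 1 by (intro DERIV_divide) auto
      then show ?thesis
        by (rule DERIV_cong) (use 1 in \<open>simp add: flat_def field_simps power2_eq_square\<close>)
    qed
    then show ?thesis
      by (rule has_field_derivative_transform_within_open[where S="{0<..}"])
         (use 1 in \<open>auto simp: flat_def\<close>)
  next
    case 2
    have "((\<lambda>t. 0) has_real_derivative 0) (at t)" by simp
    then have "(flat m has_real_derivative 0) (at t)"
      by (rule has_field_derivative_transform_within_open[where S="{..<0}"])
         (use 2 in \<open>auto simp: flat_def\<close>)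
    then show ?thesis using 2 by (simp add: flat_def)
  next
    case 3
    have "((\<lambda>y. (flat m y - flat m 0) / (y - 0)) \<longlongrightarrow> 0) (at 0)"
      by (rule Lim_transform_eventually[OF flat_tendsto_0[of "Suc m"]])
         (auto simp: eventually_at_filter flat_eq[of m] flat_def[of _ 0])
    then show ?thesis using 3 by (simp add: has_field_derivative_iff flat_def[of _ 0])
  qed
qed

lemma flat_quadratic_has_derivative:
  fixes a :: "'a::euclidean_space" and c :: real
  defines "s \<equiv> \<lambda>x. 4 - c * ((x - a) \<bullet> (x - a))"
  shows "((\<lambda>x. flat m (s x)) has_derivative
     (\<lambda>h. (flat (m + 2) (s x) - m * flat (Suc m) (s x)) * (- 2 * c * ((x - a) \<bullet> h)))) (at x)"
proof -
  have "(s has_derivative (\<lambda>h. - 2 * c * ((x - a) \<bullet> h))) (at x)"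
    unfolding s_def by (auto intro!: derivative_eq_intros simp: inner_commute algebra_simps)
  from has_derivative_compose[OF this flat_has_derivative[of m "s x", unfolded has_field_derivative_def]]
  show ?thesis by simp
qed

text \<open>
  Generalizing over \<open>m\<close> makes the induction work: every partial derivative is a combination of
  two functions of the same family, multiplied by an affine function.
\<close>

lemma Ck_flat_quadratic:
  fixes a :: "'a::euclidean_space"
  shows "Ck k (\<lambda>x. flat m (4 - c * ((x - a) \<bullet> (x - a))))"
proof (induction k arbitrary: m)
  case 0
  have "(\<lambda>x. flat m (4 - c * ((x - a) \<bullet> (x - a)))) differentiable (at x)" for x
    using flat_quadratic_has_derivative differentiable_def by blast
  then have "\<forall>x. isCont (\<lambda>x. flat m (4 - c * ((x - a) \<bullet> (x - a)))) x"
    using differentiable_imp_continuous_within by blast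
  then show ?case by (simp add: continuous_at_imp_continuous_on)
next
  case (Suc k)
  let ?s = "\<lambda>x. 4 - c * ((x - a) \<bullet> (x - a))"
  have "frechet_derivative (\<lambda>x. flat m (?s x)) (at x) =
     (\<lambda>h. (flat (m + 2) (?s x) - m * flat (Suc m) (?s x)) * (- 2 * c * ((x - a) \<bullet> h)))" for x
    using frechet_derivative_eqI[OF flat_quadratic_has_derivative] by blast
  moreover have "Ck k (\<lambda>x. (flat (m + 2) (?s x) + (- m) * flat (Suc m) (?s x)) * ((- 2 * c) * ((x - a) \<bullet> b)))" for b
    by (intro Ck_mult Ck_add Ck_const Suc Ck_inner_shift)
  ultimately show ?case using flat_quadratic_has_derivative[of m c a]
    by (auto simp: differentiable_def)
qed

lemma grad_eqI:
  fixes f :: "'a::euclidean_space \<Rightarrow> real"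
  assumes "(f has_derivative (\<lambda>h. v \<bullet> h)) (at x)"
  shows "grad f x = v"
proof -
  have "frechet_derivative f (at x) = (\<lambda>h. v \<bullet> h)"
    using assms frechet_derivative_eqI by blast
  then show ?thesis by (simp add: grad_def euclidean_representation)
qed

text \<open>
  The function \<open>exp(-1/s)\<close> of \<open>s = 4 - |x - a|^2/R^2\<close>: it is supported where
  \<open>|x - a| \<le> 2R\<close>, and \<open>s \<ge> 1\<close> on the ball of radius \<open>R\<close>. The gradient has size \<open>1/R\<close>
  because the derivative of \<open>exp(-1/s)\<close> is bounded by \<open>2\<close>.
\<close>

lemma bump_function:
  fixes a :: "'a::euclidean_space"
  assumes "R > 0"
  obtains f :: "'a \<Rightarrow> real" where
    "test_function f" "\<And>x. x \<in> cball a R \<Longrightarrow> f x \<ge> exp (- 1)"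
    "\<And>x. norm (grad f x) \<le> 8 / R" "\<And>x. x \<notin> cball a (2 * R) \<Longrightarrow> grad f x = 0"
proof -
  define s where "s = (\<lambda>x. 4 - (1 / R\<^sup>2) * ((x - a) \<bullet> (x - a)))"
  define f where "f = (\<lambda>x. flat 0 (s x))"
  have s: "s x = 4 - (dist a x / R)\<^sup>2" for x
    by (simp add: s_def dist_norm norm_minus_commute power_divide dot_square_norm)
  have out: "s x \<le> 0" if "x \<notin> cball a (2 * R)" for x
  proof -
    have "2 \<le> dist a x / R" using that assms by (simp add: field_simps)
    then have "2\<^sup>2 \<le> (dist a x / R)\<^sup>2" by (intro power_mono) auto
    then show ?thesis by (simp add: s)
  qed
  have g: "grad f x = (flat 2 (s x) * (- 2 / R\<^sup>2)) *\<^sub>R (x - a)" for x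
  proof (rule grad_eqI)
    have "(f has_derivative (\<lambda>h. flat 2 (s x) * (- 2 * (1 / R\<^sup>2) * ((x - a) \<bullet> h)))) (at x)"
      using flat_quadratic_has_derivative[of 0 "1 / R\<^sup>2" a x] by (simp add: f_def s_def numeral_2_eq_2)
    then show "(f has_derivative (\<lambda>h. ((flat 2 (s x) * (- 2 / R\<^sup>2)) *\<^sub>R (x - a)) \<bullet> h)) (at x)"
      by (rule has_derivative_eq_rhs) auto
  qed
  show thesis
  proof
    have "{x. f x \<noteq> 0} \<subseteq> cball a (2 * R)"
      using out by (force simp: f_def flat_def)
    then have "compact (closure {x. f x \<noteq> 0})"
      by (meson bounded_cball bounded_subset compact_closure)
    then show "test_function f"
      unfolding test_function_def f_def s_def using Ck_flat_quadratic by blast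
    show "f x \<ge> exp (- 1)" if "x \<in> cball a R" for x
    proof -
      have "dist a x / R \<le> 1" using that assms by simp
      then have "(dist a x / R)\<^sup>2 \<le> 1" using assms by (simp add: power_le_one)
      then have "s x \<ge> 1" by (simp add: s)
      then show ?thesis by (simp add: f_def flat_def)
    qed
    show "norm (grad f x) \<le> 8 / R" for x
    proof (cases "x \<in> cball a (2 * R) \<and> s x > 0")
      case True
      have "norm (grad f x) = flat 2 (s x) * (2 / R\<^sup>2) * dist a x"
        using flat_nonneg[of 2 "s x"] by (simp add: g dist_norm norm_minus_commute abs_mult)
      also have "\<dots> \<le> 2 * (2 / R\<^sup>2) * (2 * R)"
        using True flat_bound[of "s x" 2] flat_nonneg[of 2 "s x"] assms
        by (intro mult_mono) (auto simp: fact_numeral)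
      also have "\<dots> = 8 / R" using assms by (simp add: field_simps power2_eq_square)
      finally show ?thesis .
    next
      case False
      then have "s x \<le> 0" using out by force
      then show ?thesis using assms by (simp add: g flat_def)
    qed
    show "grad f x = 0" if "x \<notin> cball a (2 * R)" for x
      using out[OF that] by (simp add: g flat_def)
  qed
qed

section \<open>Packings and the Assouad dimension\<close>

text \<open>
  Separated sets are used beside the coverings in the definition of the Assouad dimension because
  balls around separated points are disjoint, which turns volume bounds into cardinality bounds.
\<close>

definition packing :: "'a::metric_space set \<Rightarrow> 'a \<Rightarrow> real \<Rightarrow> real \<Rightarrow> 'a set \<Rightarrow> bool" where
  "packing E x R r F \<longleftrightarrow> finite F \<and> F \<subseteq> E \<inter> ball x R \<and> pairwise (\<lambda>y z. r \<le> dist y z) F"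

text \<open>
  A packing of maximal cardinality cannot be enlarged, so no point is at distance \<open>\<ge> r\<close> from it.
\<close>

lemma maximal_packing_covers:
  assumes bound: "\<And>F. packing E x R r F \<Longrightarrow> real (card F) \<le> N" and "r > 0"
  obtains F where "packing E x R r F" "E \<inter> ball x R \<subseteq> (\<Union>y\<in>F. ball y r)"
proof -
  have "\<forall>F. packing E x R r F \<longrightarrow> card F < Suc (nat \<lceil>N\<rceil>)"
  proof (intro allI impI)
    fix F assume "packing E x R r F"
    then have "real (card F) \<le> N" by (rule bound)
    then show "card F < Suc (nat \<lceil>N\<rceil>)" by linarith
  qed
  moreover have "packing E x R r {}" by (simp add: packing_def)
  ultimately obtain F where F: "packing E x R r F" and
    max: "\<forall>G. packing E x R r G \<longrightarrow> card G \<le> card F"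
    using ex_has_greatest_nat[of "packing E x R r" "{}" card "Suc (nat \<lceil>N\<rceil>)"] by auto
  have "E \<inter> ball x R \<subseteq> (\<Union>y\<in>F. ball y r)"
  proof (rule ccontr)
    assume "\<not> ?thesis"
    then obtain z where z: "z \<in> E" "z \<in> ball x R" "\<forall>y\<in>F. r \<le> dist y z"
      by force
    then have "z \<notin> F" using \<open>r > 0\<close> by force
    have "packing E x R r (insert z F)"
      using F z by (auto simp: packing_def pairwise_insert dist_commute)
    then have "card (insert z F) \<le> card F" using max by blast
    then show False using F \<open>z \<notin> F\<close> by (simp add: packing_def)
  qed
  then show thesis using F that by blast
qed

text \<open>
  Submultiplicativity of packing numbers across scales: a fine packing is distributed over the
  balls of a coarser cover, and each ball receives a packing of its own.
\<close>

lemma packing_refine: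
  assumes F: "packing E x R r' F" and "finite G" and cov: "E \<inter> ball x R \<subseteq> (\<Union>y\<in>G. ball y r)"
    and bound: "\<And>y F'. y \<in> G \<Longrightarrow> packing E y r r' F' \<Longrightarrow> real (card F') \<le> c"
  shows "real (card F) \<le> real (card G) * c"
proof -
  have "F = (\<Union>y\<in>G. F \<inter> ball y r)" using F cov by (auto simp: packing_def)
  then have "card F \<le> (\<Sum>y\<in>G. card (F \<inter> ball y r))"
    using card_UN_le[OF \<open>finite G\<close>] by metis
  then have "real (card F) \<le> (\<Sum>y\<in>G. real (card (F \<inter> ball y r)))"
    by (metis of_nat_le_iff of_nat_sum)
  also have "\<dots> \<le> (\<Sum>y\<in>G. c)"
    using F by (intro sum_mono bound) (auto simp: packing_def pairwise_def)
  finally show ?thesis by simp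
qed

lemma covering_number_le_card:
  assumes "finite F" "F \<subseteq> A" "A \<subseteq> (\<Union>y\<in>F. ball y r)"
  shows "covering_number A r \<le> enat (card F)"
  unfolding covering_number_def using assms by (intro INF_lower) auto

lemma assouad_dim_le:
  assumes "l \<ge> 0" "C > 0"
    and cov: "\<And>x r R. x \<in> E \<Longrightarrow> 0 < r \<Longrightarrow> r < R \<Longrightarrow>
      \<exists>F. finite F \<and> F \<subseteq> E \<inter> ball x R \<and> E \<inter> ball x R \<subseteq> (\<Union>y\<in>F. ball y r)
        \<and> real (card F) \<le> C * (R / r) powr l"
  shows "assouad_dim E \<le> ereal l"
proof -
  have "ereal_of_enat (covering_number (E \<inter> ball x R) r) \<le> ereal (C * (r / R) powr - l)"
    if x: "x \<in> E" "0 < r" "r < R" for x r R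
  proof -
    obtain F where F: "finite F" "F \<subseteq> E \<inter> ball x R" "E \<inter> ball x R \<subseteq> (\<Union>y\<in>F. ball y r)"
      "real (card F) \<le> C * (R / r) powr l" using cov[OF x] by metis
    have "(R / r) powr l = (r / R) powr - l"
      using x by (simp add: powr_divide powr_minus_divide)
    moreover have "ereal_of_enat (covering_number (E \<inter> ball x R) r) \<le> ereal (real (card F))"
      using covering_number_le_card[OF F(1-3)] by (metis ereal_of_enat_le_iff ereal_of_enat_simps(1))
    ultimately show ?thesis using F(4) by (auto intro: order_trans)
  qed
  then show ?thesis unfolding assouad_dim_def using assms by (intro INF_lower) auto
qed

text \<open>
  The self-improvement behind the strict inequality. The hypothesis controls the sum over all scales,
  which is more than a bound \<open>C 2^dj\<close> on each packing number: the latter alone would be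
  compatible with the Assouad dimension being equal to \<open>d\<close>.
\<close>

lemma assouad_dim_less:
  fixes E :: "'a::metric_space set"
  assumes "E \<noteq> {}" "C > 0"
    and sum: "\<And>x R k F. x \<in> E \<Longrightarrow> R > 0 \<Longrightarrow> (\<And>j. j < k \<Longrightarrow> packing E x R (R / 2 ^ j) (F j)) \<Longrightarrow>
       (\<Sum>j<k. real (card (F j)) * 2 powr (- (d * real j))) \<le> C"
  shows "assouad_dim E < ereal d"
proof -
  have one: "real (card F) \<le> C * 2 powr (d * real j)" if "x \<in> E" "R > 0" "packing E x R (R / 2 ^ j) F" for x R j F
  proof -
    define G where "G = (\<lambda>i. if i = j then F else {})"
    have "(\<Sum>i<Suc j. real (card (G i)) * 2 powr (- (d * real i))) \<le> C"
      using that by (intro sum) (auto simp: G_def packing_def)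
    moreover have "(\<Sum>i<Suc j. real (card (G i)) * 2 powr (- (d * real i))) = real (card F) * 2 powr (- (d * real j))"
      by (simp add: G_def)
    ultimately show ?thesis by (simp add: powr_minus field_simps)
  qed
  have covers: "\<exists>G. packing E x R (R / 2 ^ j) G \<and> E \<inter> ball x R \<subseteq> (\<Union>y\<in>G. ball y (R / 2 ^ j))"
    if "x \<in> E" "R > 0" for x R j
    using maximal_packing_covers[of E x R "R / 2 ^ j"] one that by (metis divide_pos_pos zero_less_numeral zero_less_power)
  have "\<exists>k\<ge>1. \<forall>x\<in>E. \<forall>R>0. \<forall>F. packing E x R (R / 2 ^ k) F \<longrightarrow> real (card F) \<le> 2 powr (d * real k) / 2"
  proof (rule ccontr)
    assume neg: "\<not> ?thesis"
    \<comment> \<open>Each of the \<open>k\<close> terms of the sum will be at least \<open>1/(2C)\<close>, so the sum exceeds \<open>C\<close>.\<close>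
    obtain k :: nat where k: "real k > 2 * C\<^sup>2" using reals_Archimedean2 by blast
    then have "k \<ge> 1" using zero_le_power2[of C] by (cases k) auto
    then obtain x R F where F: "x \<in> E" "R > 0" "packing E x R (R / 2 ^ k) F" "real (card F) > 2 powr (d * real k) / 2"
      using neg by (meson not_le)
    obtain G where G: "\<And>j. packing E x R (R / 2 ^ j) (G j)"
        "\<And>j. E \<inter> ball x R \<subseteq> (\<Union>y\<in>G j. ball y (R / 2 ^ j))"
      using covers[OF F(1,2)] by metis
    have "1 / (2 * C) \<le> real (card (G j)) * 2 powr (- (d * real j))" if "j < k" for j
    proof -
      have eq: "R / 2 ^ k = (R / 2 ^ j) / 2 ^ (k - j)"
        using that by (simp add: power_diff)
      have "real (card F) \<le> real (card (G j)) * (C * 2 powr (d * real (k - j)))"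
      proof (rule packing_refine[OF F(3) _ G(2)])
        show "finite (G j)" using G(1) by (auto simp: packing_def)
        fix y F' assume "y \<in> G j" "packing E y (R / 2 ^ j) (R / 2 ^ k) F'"
        then show "real (card F') \<le> C * 2 powr (d * real (k - j))"
          using G(1)[of j] F(2) eq one[of y "R / 2 ^ j" "k - j" F'] by (auto simp: packing_def)
      qed
      then have "2 powr (d * real k) / 2 \<le> real (card (G j)) * (C * 2 powr (d * real (k - j)))"
        using F(4) by simp
      also have "2 powr (d * real (k - j)) = 2 powr (d * real k) * 2 powr (- (d * real j))"
        using that by (simp add: powr_add[symmetric] of_nat_diff algebra_simps)
      finally show ?thesis using \<open>C > 0\<close> by (simp add: field_simps)
    qed
    then have "(\<Sum>j<k. 1 / (2 * C)) \<le> (\<Sum>j<k. real (card (G j)) * 2 powr (- (d * real j)))"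
      by (intro sum_mono) auto
    also have "\<dots> \<le> C" using F G by (intro sum) auto
    finally show False using k \<open>C > 0\<close> by (simp add: field_simps power2_eq_square)
  qed
  then obtain k where k: "k \<ge> 1" and
    B: "\<And>x R F. x \<in> E \<Longrightarrow> R > 0 \<Longrightarrow> packing E x R (R / 2 ^ k) F \<Longrightarrow> real (card F) \<le> 2 powr (d * real k) / 2"
    by blast
  define l where "l = d - 1 / k"
  have l: "2 powr (d * real k) / 2 = 2 powr (l * real k)"
    using k by (simp add: l_def left_diff_distrib powr_diff)
  \<comment> \<open>A single point is a packing at every scale, so the packing bound is at least \<open>1\<close>.\<close>
  have "l \<ge> 0"
  proof -
    obtain x where "x \<in> E" using \<open>E \<noteq> {}\<close> by blast
    then have "real (card {x}) \<le> 2 powr (l * real k)"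
      unfolding l[symmetric] by (intro B[of x 1]) (auto simp: packing_def)
    then have "1 \<le> 2 powr (l * real k)" by simp
    moreover have "2 powr (l * real k) < 2 powr 0" if "l < 0"
      using that k by (intro powr_less_mono) (auto simp: mult_neg_pos)
    ultimately show ?thesis by force
  qed
  have iter: "real (card F) \<le> C * 2 powr (l * real k * real m)"
    if "x \<in> E" "R > 0" "packing E x R (R / 2 ^ (k * m)) F" for x R m F
    using that
  proof (induction m arbitrary: F)
    case 0
    then show ?case using one[of x R 0 F] by simp
  next
    case (Suc m)
    obtain G where G: "packing E x R (R / 2 ^ (k * m)) G"
        "E \<inter> ball x R \<subseteq> (\<Union>y\<in>G. ball y (R / 2 ^ (k * m)))"
      using covers[OF Suc.prems(1,2)] by metis
    have "real (card F) \<le> real (card G) * 2 powr (l * real k)"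
    proof (rule packing_refine[OF Suc.prems(3) _ G(2)])
      show "finite G" using G(1) by (auto simp: packing_def)
      fix y F' assume "y \<in> G" "packing E y (R / 2 ^ (k * m)) (R / 2 ^ (k * Suc m)) F'"
      then show "real (card F') \<le> 2 powr (l * real k)"
        using B[of y "R / 2 ^ (k * m)" F'] G(1) Suc.prems(2) l
        by (auto simp: packing_def power_add mult.commute)
    qed
    also have "\<dots> \<le> C * 2 powr (l * real k * real m) * 2 powr (l * real k)"
      using Suc G(1) by (intro mult_right_mono) auto
    also have "\<dots> = C * 2 powr (l * real k * real (Suc m))"
      by (simp add: powr_add[symmetric] algebra_simps)
    finally show ?case .
  qed
  have "assouad_dim E \<le> ereal l"
  proof (rule assouad_dim_le[where C = "C * 2 powr (l * real k)"])
    show "l \<ge> 0" "0 < C * 2 powr (l * real k)" using \<open>l \<ge> 0\<close> \<open>C > 0\<close> by auto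
    fix x and r R :: real assume x: "x \<in> E" "0 < r" "r < R"
    define P where "P = (\<lambda>m. R / 2 ^ (k * m) \<le> r)"
    \<comment> \<open>The first scale among the powers of \<open>2^-k\<close> that is at most \<open>r\<close>; it overshoots by at most one step.\<close>
    have "\<exists>m. P m"
    proof -
      obtain m where "R / r < 2 ^ m" using real_arch_pow[of 2 "R / r"] by auto
      also have "(2::real) ^ m \<le> 2 ^ (k * m)" using k by (intro power_increasing) auto
      finally have "P m" using x by (simp add: P_def field_simps)
      then show ?thesis ..
    qed
    then have "P (LEAST m. P m)" by (metis LeastI)
    moreover have "\<not> P 0" using x by (simp add: P_def)
    ultimately obtain m where m: "(LEAST m. P m) = Suc m" by (metis not0_implies_Suc)
    then have "\<not> P m" using not_less_Least[of m P] by simp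
    then have "2 ^ (k * m) < R / r" using x by (simp add: P_def field_simps)
    then have "2 powr (real k * real m) < R / r"
      by (metis of_nat_mult powr_realpow zero_less_numeral)
    then have "(2 powr (real k * real m)) powr l \<le> (R / r) powr l"
      using \<open>l \<ge> 0\<close> by (intro powr_mono2) auto
    then have *: "2 powr (l * real k * real m) \<le> (R / r) powr l"
      by (simp add: powr_powr mult_ac)
    have r: "R / 2 ^ (k * Suc m) \<le> r" using \<open>P (LEAST m. P m)\<close> m by (simp add: P_def)
    obtain G where G: "packing E x R (R / 2 ^ (k * Suc m)) G"
        "E \<inter> ball x R \<subseteq> (\<Union>y\<in>G. ball y (R / 2 ^ (k * Suc m)))"
      using covers[of x R "k * Suc m"] x by auto
    have "real (card G) \<le> C * 2 powr (l * real k * real (Suc m))"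
      using iter[OF _ _ G(1)] x by auto
    also have "\<dots> = C * 2 powr (l * real k) * 2 powr (l * real k * real m)"
      by (simp add: powr_add[symmetric] algebra_simps)
    also have "\<dots> \<le> C * 2 powr (l * real k) * (R / r) powr l"
      using * \<open>C > 0\<close> by (intro mult_left_mono) auto
    finally have "real (card G) \<le> C * 2 powr (l * real k) * (R / r) powr l" .
    moreover have "E \<inter> ball x R \<subseteq> (\<Union>y\<in>G. ball y r)"
      using G(2) UN_mono[OF subset_refl subset_ball[OF r]] by (rule order_trans)
    ultimately show "\<exists>F. finite F \<and> F \<subseteq> E \<inter> ball x R \<and> E \<inter> ball x R \<subseteq> (\<Union>y\<in>F. ball y r)
        \<and> real (card F) \<le> C * 2 powr (l * real k) * (R / r) powr l"
      using G(1) by (auto simp: packing_def)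
  qed
  also have "ereal l < ereal d" using k by (simp add: l_def)
  finally show ?thesis .
qed

section \<open>The inequality bounds the Assouad dimension\<close>

text \<open>
  A geometric sum is comparable to its largest term. The statement with the maximum is what
  survives the induction step, which compares \<open>\<delta>\<close> with the newest scale.
\<close>

lemma power_sum_le_last:
  fixes s b c \<delta> :: real
  assumes "\<delta> > 0" "b > 0" "s > 0"
  shows "(\<Sum>j<k. if \<delta> < b / 2 ^ Suc j then (b / 2 ^ Suc j) powr (- s) else 0)
     \<le> 1 / (1 - 2 powr (- s)) * max \<delta> (b / 2 ^ k) powr (- s)"
proof (induction k)
  case 0
  have "2 powr (- s) < 1" using assms powr_less_mono[of "-s" 0 2] by simp
  then show ?case using assms by (simp add: zero_le_divide_iff)
next
  case (Suc k)
  define G where "G = 1 / (1 - 2 powr (- s))"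
  have lt: "2 powr (- s) < 1" using assms powr_less_mono[of "-s" 0 2] by simp
  then have G: "G > 0" by (simp add: G_def)
  have "G * (1 - 2 powr (- s)) = 1" using lt assms by (simp add: G_def)
  then have G2: "G * 2 powr (- s) + 1 = G" by (simp add: algebra_simps)
  show ?case
  proof (cases "\<delta> < b / 2 ^ Suc k")
    case True
    have "b / 2 ^ Suc k < b / 2 ^ k" using assms by (simp add: field_simps)
    then have m: "max \<delta> (b / 2 ^ k) = 2 * (b / 2 ^ Suc k)" "max \<delta> (b / 2 ^ Suc k) = b / 2 ^ Suc k" using True by auto
    have "(\<Sum>j<Suc k. if \<delta> < b / 2 ^ Suc j then (b / 2 ^ Suc j) powr (- s) else 0)
        \<le> G * (2 * (b / 2 ^ Suc k)) powr (- s) + (b / 2 ^ Suc k) powr (- s)"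
      using Suc True m by (simp add: G_def)
    also have "\<dots> = (G * 2 powr (- s) + 1) * (b / 2 ^ Suc k) powr (- s)"
      using assms by (simp only: powr_mult) (simp add: algebra_simps)
    finally show ?thesis using G2 m(2) by (simp add: G_def)
  next
    case False
    have "b / 2 ^ Suc k \<le> b / 2 ^ k" using assms by (simp add: field_simps)
    then have "max \<delta> (b / 2 ^ k) powr (- s) \<le> max \<delta> (b / 2 ^ Suc k) powr (- s)"
      using assms by (intro powr_mono2') auto
    then have "G * max \<delta> (b / 2 ^ k) powr (- s) \<le> G * max \<delta> (b / 2 ^ Suc k) powr (- s)"
      using G by (intro mult_left_mono) auto
    then show ?thesis using Suc False by (simp add: G_def)
  qed
qed

text \<open>
  Testing with a bump on \<open>B(a,R)\<close>: the gradient has size \<open>1/R\<close> on a set of volume \<open>R^n\<close>, so the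
  right-hand side scales like \<open>R^(n/p - 1)\<close>, whose \<open>q\<close>-th power has exponent \<open>(q/p)(n - p)\<close>.
\<close>

lemma weight_growth_of_inequality:
  fixes W :: "'a::euclidean_space \<Rightarrow> ennreal" and p q C :: real
  assumes W[measurable]: "W \<in> borel_measurable borel" and pq: "1 \<le> p" "p \<le> q" and "C > 0"
    and ineq: "\<And>f. test_function f \<Longrightarrow> epowr (\<integral>\<^sup>+x. epowr (ennreal \<bar>f x\<bar>) q * W x \<partial>lborel) (1 / q)
      \<le> ennreal C * epowr (\<integral>\<^sup>+x. epowr (ennreal (norm (grad f x))) p \<partial>lborel) (1 / p)"
  obtains K where "K > 0" "\<And>a R. R > 0 \<Longrightarrow>
    (\<integral>\<^sup>+x\<in>cball a R. W x \<partial>lborel) \<le> ennreal (K * R powr (q / p * (DIM('a) - p)))"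
proof
  define n where "n = real DIM('a)"
  define \<omega> where "\<omega> = unit_ball_vol n"
  \<comment> \<open>The factor \<open>exp q\<close> compensates the lower bound \<open>exp (-1)\<close> for the bump on the inner ball.\<close>
  define K where "K = exp q * C powr q * (8 powr p * \<omega> * 2 powr n) powr (q / p)"
  have \<omega>: "\<omega> > 0" by (simp add: \<omega>_def n_def)
  show "K > 0" using \<omega> \<open>C > 0\<close> by (simp add: K_def)
  fix a :: 'a and R :: real assume R: "R > 0"
  obtain f :: "'a \<Rightarrow> real" where f: "test_function f" "\<And>x. x \<in> cball a R \<Longrightarrow> f x \<ge> exp (- 1)"
    "\<And>x. norm (grad f x) \<le> 8 / R" "\<And>x. x \<notin> cball a (2 * R) \<Longrightarrow> grad f x = 0"
    using bump_function[OF R] by metis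
  have [measurable]: "cball a R \<in> sets borel" by auto
  define I where "I = (\<integral>\<^sup>+x\<in>cball a R. W x \<partial>lborel)"
  define G where "G = (8 / R) powr p * (\<omega> * (2 * R) powr n)"
  have "G > 0" using R \<omega> by (simp add: G_def)
  have "ennreal (exp (- q)) * I = (\<integral>\<^sup>+x. ennreal (exp (- q)) * (W x * indicator (cball a R) x) \<partial>lborel)"
    unfolding I_def by (intro nn_integral_cmult[symmetric]) measurable
  also have "\<dots> \<le> (\<integral>\<^sup>+x. epowr (ennreal \<bar>f x\<bar>) q * W x \<partial>lborel)"
  proof (intro nn_integral_mono)
    fix x
    show "ennreal (exp (- q)) * (W x * indicator (cball a R) x) \<le> epowr (ennreal \<bar>f x\<bar>) q * W x"
    proof (cases "x \<in> cball a R")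
      case True
      then have fx: "exp (- 1) \<le> \<bar>f x\<bar>" using f(2) by force
      then have "exp (- 1) powr q \<le> \<bar>f x\<bar> powr q" using pq by (intro powr_mono2) auto
      moreover have "\<bar>f x\<bar> > 0" using fx exp_gt_zero[of "-1::real"] by linarith
      ultimately have "ennreal (exp (- q)) \<le> epowr (ennreal \<bar>f x\<bar>) q"
        using pq by (simp add: epowr_ennreal powr_def)
      then show ?thesis using True by (simp add: mult_right_mono)
    qed simp
  qed
  finally have "epowr (ennreal (exp (- q)) * I) (1 / q) \<le> epowr (\<integral>\<^sup>+x. epowr (ennreal \<bar>f x\<bar>) q * W x \<partial>lborel) (1 / q)"
    using pq by (intro epowr_mono) auto
  also note ineq[OF f(1)]
  also have "epowr (\<integral>\<^sup>+x. epowr (ennreal (norm (grad f x))) p \<partial>lborel) (1 / p) \<le> epowr (ennreal G) (1 / p)"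
  proof (intro epowr_mono)
    have "(\<integral>\<^sup>+x. epowr (ennreal (norm (grad f x))) p \<partial>lborel)
        \<le> (\<integral>\<^sup>+x. ennreal ((8 / R) powr p) * indicator (cball a (2 * R)) x \<partial>lborel)"
    proof (intro nn_integral_mono)
      fix x
      show "epowr (ennreal (norm (grad f x))) p \<le> ennreal ((8 / R) powr p) * indicator (cball a (2 * R)) x"
        using f(3)[of x] f(4)[of x] pq
        by (cases "x \<in> cball a (2 * R)") (auto simp: epowr_ennreal[of "norm _"] powr_mono2 epowr_def)
    qed
    also have "\<dots> = ennreal G"
      using R by (simp add: nn_integral_cmult_indicator emeasure_cball G_def \<omega>_def n_def ennreal_mult powr_realpow)
    finally show "(\<integral>\<^sup>+x. epowr (ennreal (norm (grad f x))) p \<partial>lborel) \<le> ennreal G" .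
  qed (use pq in auto)
  also have "epowr (ennreal G) (1 / p) = ennreal (G powr (1 / p))"
    using \<open>G > 0\<close> by (simp add: epowr_ennreal)
  finally have "epowr (ennreal (exp (- q)) * I) (1 / q) \<le> ennreal (C * G powr (1 / p))"
    using \<open>C > 0\<close> by (simp add: ennreal_mult mult_left_mono)
  then have *: "ennreal (exp (- q)) * I \<le> ennreal ((C * G powr (1 / p)) powr q)"
    using pq \<open>C > 0\<close> by (intro epowr_inverse_le) auto
  have "I = ennreal (exp q) * (ennreal (exp (- q)) * I)"
    by (simp add: mult.assoc[symmetric] ennreal_mult[symmetric] exp_minus)
  also have "\<dots> \<le> ennreal (exp q) * ennreal ((C * G powr (1 / p)) powr q)"
    using * by (intro mult_left_mono) auto
  also have "\<dots> = ennreal (exp q * (C * G powr (1 / p)) powr q)"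
    by (simp add: ennreal_mult)
  also have "exp q * (C * G powr (1 / p)) powr q = K * R powr (q / p * (n - p))"
  proof -
    have "G = (8 powr p * \<omega> * 2 powr n) * R powr (n - p)"
      using R by (simp add: G_def powr_divide powr_mult powr_diff)
    then have "(C * G powr (1 / p)) powr q
        = C powr q * ((8 powr p * \<omega> * 2 powr n) powr (q / p) * R powr (q / p * (n - p)))"
      using R \<omega> \<open>C > 0\<close> by (simp add: powr_mult powr_powr mult_ac)
    then show ?thesis by (simp add: K_def)
  qed
  finally show "(\<integral>\<^sup>+x\<in>cball a R. W x \<partial>lborel) \<le> ennreal (K * R powr (q / p * (DIM('a) - p)))"
    by (simp add: I_def n_def)
qed

text \<open>
  The balls of radius \<open>R/2^(j+1)\<close> around a packing at scale \<open>R/2^j\<close> are disjoint and lie where the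
  distance to \<open>E\<close> is below that radius. A point at distance \<open>\<delta>\<close> from \<open>E\<close> is counted only at
  scales coarser than \<open>\<delta>\<close>, and there the factors \<open>(R/2^(j+1))^(d-n)\<close> add up to at most a multiple
  of \<open>\<delta>^(d-n)\<close>. So one integral of the weight controls all scales together.
\<close>

lemma packing_sum_le:
  fixes E :: "'a::euclidean_space set" and d K :: real
  assumes "E \<noteq> {}" "d > 0" "d < DIM('a)" "K > 0"
    and growth: "\<And>x R. x \<in> E \<Longrightarrow> R > 0 \<Longrightarrow>
      (\<integral>\<^sup>+y\<in>cball x R. epowr (ennreal (infdist y E)) (d - DIM('a)) \<partial>lborel) \<le> ennreal (K * R powr d)"
  obtains C where "C > 0" "\<And>x R k F. x \<in> E \<Longrightarrow> R > 0 \<Longrightarrow> (\<And>j. j < k \<Longrightarrow> packing E x R (R / 2 ^ j) (F j)) \<Longrightarrow>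
       (\<Sum>j<k. real (card (F j)) * 2 powr (- (d * real j))) \<le> C"
proof
  define n where "n = real DIM('a)"
  define \<omega> where "\<omega> = unit_ball_vol n"
  define W where "W = (\<lambda>y. epowr (ennreal (infdist y E)) (d - n))"
  define G where "G = 1 / (1 - 2 powr (- (n - d)))"
  define C where "C = G * K * 4 powr d / \<omega>"
  have \<omega>: "\<omega> > 0" by (simp add: \<omega>_def n_def)
  have nd: "n - d > 0" using assms by (simp add: n_def)
  have "2 powr (- (n - d)) < 1" using nd powr_less_mono[of "- (n - d)" 0 2] by simp
  then have "G > 0" by (simp add: G_def)
  then show "C > 0" using \<omega> assms by (simp add: C_def)
  have [measurable]: "W \<in> borel_measurable borel"
    unfolding W_def by measurable
  fix x R k F assume x: "x \<in> E" "R > 0" and F: "\<And>j. j < k \<Longrightarrow> packing E x R (R / 2 ^ j) (F j)"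
  have [measurable]: "cball x (2 * R) \<in> sets borel" by auto
  define \<rho> where "\<rho> = (\<lambda>j. R / 2 ^ Suc j)"
  have \<rho>: "\<rho> j > 0" "\<rho> j \<le> R" for j
    using x divide_left_mono[of 1 "2 ^ Suc j" R] by (auto simp: \<rho>_def two_realpow_ge_one simp del: power_Suc)
  define V where "V = (\<lambda>j. \<Union>y\<in>F j. ball y (\<rho> j))"
  have [measurable]: "V j \<in> sets borel" for j unfolding V_def by (intro borel_open) auto
  have V: "emeasure lborel (V j) = ennreal (card (F j) * (\<omega> * \<rho> j powr n))" if "j < k" for j
  proof -
    have fin: "finite (F j)" and sep: "\<And>y z. y \<in> F j \<Longrightarrow> z \<in> F j \<Longrightarrow> y \<noteq> z \<Longrightarrow> R / 2 ^ j \<le> dist y z"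
      using F[OF that] by (auto simp: packing_def pairwise_def)
    have "disjoint_family_on (\<lambda>y. ball y (\<rho> j)) (F j)"
      unfolding disjoint_family_on_def
    proof (intro ballI impI)
      fix y z assume "y \<in> F j" "z \<in> F j" "y \<noteq> z"
      then have "\<rho> j + \<rho> j \<le> dist y z" using sep by (simp add: \<rho>_def)
      then show "ball y (\<rho> j) \<inter> ball z (\<rho> j) = {}" by (rule disjoint_ballI)
    qed
    then have "emeasure lborel (V j) = (\<Sum>y\<in>F j. emeasure lborel (ball y (\<rho> j)))"
      unfolding V_def using fin by (intro sum_emeasure[symmetric]) auto
    also have "\<dots> = (\<Sum>y\<in>F j. ennreal (\<omega> * \<rho> j powr n))"
      using \<rho>(1)[of j] by (simp add: emeasure_ball \<omega>_def n_def powr_realpow)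
    also have "\<dots> = ennreal (card (F j) * (\<omega> * \<rho> j powr n))"
      using \<omega> by (simp add: ennreal_mult ennreal_of_nat_eq_real_of_nat)
    finally show ?thesis .
  qed
  have near: "y \<in> cball x (2 * R)" "infdist y E < \<rho> j" if jy: "j < k" "y \<in> V j" for j y
  proof -
    obtain z where z: "z \<in> F j" "dist z y < \<rho> j" using jy by (auto simp: V_def)
    then have "z \<in> E" "dist x z < R" using F[OF jy(1)] by (auto simp: packing_def)
    then show "infdist y E < \<rho> j" using infdist_le[of z E y] z by (simp add: dist_commute)
    show "y \<in> cball x (2 * R)"
      using \<open>dist x z < R\<close> z \<rho>(2)[of j] dist_triangle[of x y z] by simp
  qed
  \<comment> \<open>On \<open>E\<close> the right-hand side is infinite; elsewhere the left-hand side is a geometric sum.\<close>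
  have pt: "(\<Sum>j<k. ennreal (\<rho> j powr (d - n)) * indicator (V j) y)
      \<le> ennreal G * (W y * indicator (cball x (2 * R)) y)" for y
  proof (cases "y \<in> cball x (2 * R)")
    case False
    then have "y \<notin> V j" if "j < k" for j using near that by blast
    then show ?thesis by simp
  next
    case True
    show ?thesis
    proof (cases "infdist y E = 0")
      case True
      then have "W y = \<infinity>" using nd by (simp add: W_def epowr_def)
      then show ?thesis using \<open>y \<in> cball x (2 * R)\<close> \<open>G > 0\<close> by (simp add: ennreal_mult_top)
    next
      case False
      then have pos: "infdist y E > 0" using infdist_nonneg[of y E] by linarith
      have "(\<Sum>j<k. ennreal (\<rho> j powr (d - n)) * indicator (V j) y)
          \<le> (\<Sum>j<k. ennreal (if infdist y E < R / 2 ^ Suc j then (R / 2 ^ Suc j) powr (- (n - d)) else 0))"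
        using near(2) by (intro sum_mono) (auto simp: indicator_def \<rho>_def)
      also have "\<dots> = ennreal (\<Sum>j<k. if infdist y E < R / 2 ^ Suc j then (R / 2 ^ Suc j) powr (- (n - d)) else 0)"
        by (intro sum_ennreal) auto
      also have "\<dots> \<le> ennreal (G * max (infdist y E) (R / 2 ^ k) powr (- (n - d)))"
        unfolding G_def using power_sum_le_last[OF pos x(2) nd] by (intro ennreal_leI)
      also have "\<dots> \<le> ennreal (G * infdist y E powr (- (n - d)))"
        using \<open>G > 0\<close> pos nd by (intro ennreal_leI mult_left_mono powr_mono2') auto
      also have "\<dots> = ennreal G * W y"
        using pos \<open>G > 0\<close> by (simp add: W_def epowr_ennreal ennreal_mult)
      finally show ?thesis using \<open>y \<in> cball x (2 * R)\<close> by simp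
    qed
  qed
  have "ennreal (\<Sum>j<k. \<rho> j powr (d - n) * (card (F j) * (\<omega> * \<rho> j powr n)))
      = (\<Sum>j<k. ennreal (\<rho> j powr (d - n)) * emeasure lborel (V j))"
    using V \<omega> by (simp add: sum_ennreal[symmetric] ennreal_mult)
  also have "\<dots> = (\<integral>\<^sup>+y. (\<Sum>j<k. ennreal (\<rho> j powr (d - n)) * indicator (V j) y) \<partial>lborel)"
    by (subst nn_integral_sum) (auto simp: nn_integral_cmult_indicator)
  also have "\<dots> \<le> (\<integral>\<^sup>+y. ennreal G * (W y * indicator (cball x (2 * R)) y) \<partial>lborel)"
    using pt by (intro nn_integral_mono)
  also have "\<dots> = ennreal G * (\<integral>\<^sup>+y\<in>cball x (2 * R). W y \<partial>lborel)"
    by (intro nn_integral_cmult) measurable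
  also have "\<dots> \<le> ennreal G * ennreal (K * (2 * R) powr d)"
    using growth[of x "2 * R"] x by (intro mult_left_mono) (auto simp: W_def n_def)
  also have "\<dots> = ennreal (G * (K * (2 * R) powr d))"
    using \<open>G > 0\<close> \<open>K > 0\<close> by (simp add: ennreal_mult)
  finally have le: "(\<Sum>j<k. \<rho> j powr (d - n) * (card (F j) * (\<omega> * \<rho> j powr n))) \<le> G * (K * (2 * R) powr d)"
    using \<open>G > 0\<close> \<open>K > 0\<close> by (subst (asm) ennreal_le_iff) auto
  have summand: "\<rho> j powr (d - n) * (card (F j) * (\<omega> * \<rho> j powr n))
      = (\<omega> * (R / 2) powr d) * (card (F j) * 2 powr (- (d * real j)))" for j
  proof -
    have "\<rho> j powr (d - n) * \<rho> j powr n = \<rho> j powr d" by (simp add: powr_add[symmetric])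
    moreover have "\<rho> j = R / 2 * 2 powr (- real j)"
      by (simp add: \<rho>_def powr_minus powr_realpow divide_simps)
    then have "\<rho> j powr d = (R / 2) powr d * 2 powr (- (d * real j))"
      using x by (simp only: powr_mult) (simp add: powr_powr mult.commute)
    ultimately show ?thesis by (simp add: mult_ac)
  qed
  have "(\<omega> * (R / 2) powr d) * (\<Sum>j<k. card (F j) * 2 powr (- (d * real j))) \<le> G * (K * (2 * R) powr d)"
    using le by (simp only: summand sum_distrib_left)
  also have "(2 * R) powr d = 4 powr d * (R / 2) powr d"
    using x by (simp add: powr_mult[symmetric])
  finally have "(R / 2) powr d * (\<omega> * (\<Sum>j<k. card (F j) * 2 powr (- (d * real j)))) \<le> (R / 2) powr d * (G * K * 4 powr d)"
    by (simp add: mult_ac)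
  moreover have "(R / 2) powr d > 0" using x by simp
  ultimately have "\<omega> * (\<Sum>j<k. card (F j) * 2 powr (- (d * real j))) \<le> G * K * 4 powr d"
    by (rule mult_left_le_imp_le)
  then show "(\<Sum>j<k. card (F j) * 2 powr (- (d * real j))) \<le> C"
    using \<omega> by (simp add: C_def pos_le_divide_eq mult.commute)
qed

lemma assouad_dim_less_of_inequality:
  fixes E :: "'a::euclidean_space set" and p q n C :: real
  defines "n \<equiv> real DIM('a)"
  assumes "E \<noteq> {}" and pq: "1 \<le> p" "p \<le> q" "p < n" "q < n * p / (n - p)" and "C > 0"
    and ineq: "\<And>f :: 'a \<Rightarrow> real. test_function f \<Longrightarrow>
            epowr (\<integral>\<^sup>+x. epowr (ennreal \<bar>f x\<bar>) q
                      * epowr (ennreal (infdist x E)) (q / p * (n - p) - n) \<partial>lborel) (1 / q)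
            \<le> ennreal C * epowr (\<integral>\<^sup>+x. epowr (ennreal (norm (grad f x))) p \<partial>lborel) (1 / p)"
  shows "assouad_dim E < ereal (q / p * (n - p))"
proof -
  define d where "d = q / p * (n - p)"
  have "d > 0" using pq by (simp add: d_def)
  have "q * (n - p) < n * p" using pq by (simp add: pos_less_divide_eq)
  then have "d < n" using pq by (simp add: d_def pos_divide_less_eq)
  have [measurable]: "(\<lambda>x. epowr (ennreal (infdist x E)) (d - n)) \<in> borel_measurable borel"
    by measurable
  obtain K where K: "K > 0" "\<And>a R. R > 0 \<Longrightarrow>
    (\<integral>\<^sup>+x\<in>cball a R. epowr (ennreal (infdist x E)) (d - n) \<partial>lborel) \<le> ennreal (K * R powr d)"
  proof (rule weight_growth_of_inequality[of "\<lambda>x. epowr (ennreal (infdist x E)) (d - n)" p q C])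
    show "epowr (\<integral>\<^sup>+x. epowr (ennreal \<bar>f x\<bar>) q * epowr (ennreal (infdist x E)) (d - n) \<partial>lborel) (1 / q)
      \<le> ennreal C * epowr (\<integral>\<^sup>+x. epowr (ennreal (norm (grad f x))) p \<partial>lborel) (1 / p)"
      if "test_function f" for f :: "'a \<Rightarrow> real"
      using ineq[OF that] by (simp only: d_def)
  qed (use pq \<open>C > 0\<close> in \<open>auto simp: d_def n_def\<close>)
  have "assouad_dim E < ereal d"
  proof (rule packing_sum_le[OF \<open>E \<noteq> {}\<close> \<open>d > 0\<close> _ \<open>K > 0\<close>, folded n_def])
    fix C'
    assume "C' > 0" and sum: "\<And>x R k F. x \<in> E \<Longrightarrow> R > 0 \<Longrightarrow> (\<And>j. j < k \<Longrightarrow> packing E x R (R / 2 ^ j) (F j)) \<Longrightarrow>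
       (\<Sum>j<k. real (card (F j)) * 2 powr (- (d * real j))) \<le> C'"
    show "assouad_dim E < ereal d"
      using \<open>E \<noteq> {}\<close> \<open>C' > 0\<close> sum by (rule assouad_dim_less)
  qed (use K \<open>d < n\<close> in auto)
  then show ?thesis by (simp add: d_def)
qed

section \<open>A relative isoperimetric inequality on balls\<close>

text \<open>
  The change of variables for homotheties, which is the only one that averaging over segments needs.
\<close>

lemma nn_integral_lborel_affine:
  fixes t :: "'a::euclidean_space"
  assumes [measurable]: "f \<in> borel_measurable borel" and "c > 0"
  shows "(\<integral>\<^sup>+y. f y \<partial>lborel) = ennreal (c ^ DIM('a)) * (\<integral>\<^sup>+y. f (t + c *\<^sub>R y) \<partial>lborel)"
proof -
  have "(\<integral>\<^sup>+y. f y \<partial>lborel) = (\<integral>\<^sup>+y. f y \<partial>density (distr lborel borel (\<lambda>x. t + c *\<^sub>R x)) (\<lambda>_. \<bar>c\<bar>^DIM('a)))"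
    using lborel_affine[of c t] \<open>c > 0\<close> by simp
  also have "\<dots> = ennreal (c ^ DIM('a)) * (\<integral>\<^sup>+y. f (t + c *\<^sub>R y) \<partial>lborel)"
    using \<open>c > 0\<close> by (simp add: nn_integral_density nn_integral_distr nn_integral_cmult)
  finally show ?thesis .
qed

lemma segment_increment_le:
  fixes u :: "'a::euclidean_space \<Rightarrow> real"
  assumes u: "\<And>x. (u has_derivative (\<lambda>h. g x \<bullet> h)) (at x)" and g: "continuous_on UNIV g"
  shows "ennreal \<bar>u y - u x\<bar> \<le> ennreal (norm (y - x)) *
    (\<integral>\<^sup>+s. ennreal (norm (g (x + s *\<^sub>R (y - x)))) * indicator {0..1} s \<partial>lborel)"
proof -
  have cont: "continuous_on {0..1} (\<lambda>s. g (x + s *\<^sub>R (y - x)))"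
    by (intro continuous_on_compose2[OF g] continuous_intros) auto
  have "((\<lambda>s. g (x + s *\<^sub>R (y - x)) \<bullet> (y - x)) has_integral (u (x + 1 *\<^sub>R (y - x)) - u (x + 0 *\<^sub>R (y - x)))) {0..1}"
  proof (rule fundamental_theorem_of_calculus)
    fix s :: real
    have "((\<lambda>s. x + s *\<^sub>R (y - x)) has_derivative (\<lambda>k. k *\<^sub>R (y - x))) (at s within {0..1})"
      by (auto intro!: derivative_eq_intros)
    from has_derivative_compose[OF this u]
    show "((\<lambda>s. u (x + s *\<^sub>R (y - x))) has_vector_derivative g (x + s *\<^sub>R (y - x)) \<bullet> (y - x)) (at s within {0..1})"
      by (simp add: has_vector_derivative_def)
  qed simp
  then have I: "((\<lambda>s. g (x + s *\<^sub>R (y - x)) \<bullet> (y - x)) has_integral (u y - u x)) {0..1}" by simp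
  have int: "(\<lambda>s. norm (g (x + s *\<^sub>R (y - x))) * norm (y - x)) integrable_on {0..1}"
    by (intro integrable_continuous_real continuous_intros cont)
  have "norm (integral {0..1} (\<lambda>s. g (x + s *\<^sub>R (y - x)) \<bullet> (y - x)))
      \<le> integral {0..1} (\<lambda>s. norm (g (x + s *\<^sub>R (y - x))) * norm (y - x))"
    using I int by (intro integral_norm_bound_integral)
      (auto simp: has_integral_integrable Cauchy_Schwarz_ineq2)
  then have "\<bar>u y - u x\<bar> \<le> norm (y - x) * integral {0..1} (\<lambda>s. norm (g (x + s *\<^sub>R (y - x))))"
    using I by (simp add: integral_unique mult.commute)
  then have "ennreal \<bar>u y - u x\<bar> \<le> ennreal (norm (y - x)) * ennreal (integral {0..1} (\<lambda>s. norm (g (x + s *\<^sub>R (y - x)))))"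
    by (simp add: ennreal_mult'[symmetric] ennreal_leI)
  also have "ennreal (integral {0..1} (\<lambda>s. norm (g (x + s *\<^sub>R (y - x)))))
    = (\<integral>\<^sup>+s. ennreal (norm (g (x + s *\<^sub>R (y - x)))) * indicator {0..1} s \<partial>lborel)"
    by (intro nn_integral_has_integral_lebesgue'[symmetric] integrable_integral integrable_continuous_real
        continuous_intros cont) auto
  finally show ?thesis .
qed

text \<open>
  For fixed \<open>x\<close> and \<open>s \<ge> 1/2\<close>, the point at parameter \<open>s\<close> on the segment from \<open>x\<close> to \<open>y\<close> stays in
  the convex ball and depends on \<open>y\<close> through a homothety of ratio at least \<open>1/2\<close>, whose
  Jacobian costs at most \<open>2^n\<close>.
\<close>

lemma far_end_average:
  fixes c x :: "'a::euclidean_space"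
  assumes [measurable]: "h \<in> borel_measurable borel" and "x \<in> cball c r" "1 / 2 \<le> s" "s \<le> 1"
  shows "(\<integral>\<^sup>+y. h (x + s *\<^sub>R (y - x)) * indicator (cball c r) y \<partial>lborel)
    \<le> ennreal (2 ^ DIM('a)) * (\<integral>\<^sup>+y. h y * indicator (cball c r) y \<partial>lborel)"
proof -
  have [measurable]: "cball c r \<in> sets borel" by auto
  define H where "H = (\<lambda>y. h y * indicator (cball c r) y)"
  have [measurable]: "H \<in> borel_measurable borel" unfolding H_def by measurable
  have "(\<integral>\<^sup>+y. h (x + s *\<^sub>R (y - x)) * indicator (cball c r) y \<partial>lborel)
      \<le> (\<integral>\<^sup>+y. H ((1 - s) *\<^sub>R x + s *\<^sub>R y) \<partial>lborel)"
  proof (intro nn_integral_mono)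
    fix y
    have eq: "x + s *\<^sub>R (y - x) = (1 - s) *\<^sub>R x + s *\<^sub>R y" by (simp add: algebra_simps)
    have "(1 - s) *\<^sub>R x + s *\<^sub>R y \<in> cball c r" if "y \<in> cball c r"
      using assms that by (intro convexD[OF convex_cball]) auto
    then show "h (x + s *\<^sub>R (y - x)) * indicator (cball c r) y \<le> H ((1 - s) *\<^sub>R x + s *\<^sub>R y)"
      by (auto simp: H_def eq indicator_def)
  qed
  also have "\<dots> = 1 * \<dots>" by simp
  \<comment> \<open>As \<open>2s \<ge> 1\<close>, this power only increases the value; it turns the Jacobian \<open>s^n\<close> into \<open>2^n\<close>.\<close>
  also have "\<dots> \<le> ennreal ((2 * s) ^ DIM('a)) * (\<integral>\<^sup>+y. H ((1 - s) *\<^sub>R x + s *\<^sub>R y) \<partial>lborel)"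
    using one_le_power[of "2 * s" "DIM('a)"] assms by (intro mult_right_mono) auto
  also have "\<dots> = ennreal (2 ^ DIM('a)) * (ennreal (s ^ DIM('a)) * (\<integral>\<^sup>+y. H ((1 - s) *\<^sub>R x + s *\<^sub>R y) \<partial>lborel))"
    using assms by (simp add: power_mult_distrib ennreal_mult mult.assoc)
  also have "ennreal (s ^ DIM('a)) * (\<integral>\<^sup>+y. H ((1 - s) *\<^sub>R x + s *\<^sub>R y) \<partial>lborel) = (\<integral>\<^sup>+y. H y \<partial>lborel)"
    using assms by (intro nn_integral_lborel_affine[symmetric]) auto
  finally show ?thesis by (simp add: H_def)
qed

text \<open>
  For \<open>s < 1/2\<close> the two ends exchange their roles: the point is at parameter \<open>1 - s \<ge> 1/2\<close> on the
  segment from \<open>y\<close> to \<open>x\<close>.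
\<close>

lemma segment_average:
  fixes c :: "'a::euclidean_space"
  assumes h[measurable]: "h \<in> borel_measurable borel" and "0 \<le> s" "s \<le> 1"
  shows "(\<integral>\<^sup>+x. (\<integral>\<^sup>+y. h (x + s *\<^sub>R (y - x)) * indicator (cball c r) y \<partial>lborel) * indicator (cball c r) x \<partial>lborel)
    \<le> ennreal (2 ^ DIM('a)) * emeasure lborel (cball c r) * (\<integral>\<^sup>+y. h y * indicator (cball c r) y \<partial>lborel)"
proof -
  have [measurable]: "cball c r \<in> sets borel" by auto
  define K where "K = ennreal (2 ^ DIM('a)) * (\<integral>\<^sup>+y. h y * indicator (cball c r) y \<partial>lborel)"
  have fin: "(\<integral>\<^sup>+x. F x * indicator (cball c r) x \<partial>lborel) \<le> K * emeasure lborel (cball c r)"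
    if "\<And>x. x \<in> cball c r \<Longrightarrow> F x \<le> K" for F
  proof -
    have "(\<integral>\<^sup>+x. F x * indicator (cball c r) x \<partial>lborel) \<le> (\<integral>\<^sup>+x. K * indicator (cball c r) x \<partial>lborel)"
      using that by (intro nn_integral_mono) (auto simp: indicator_def)
    then show ?thesis by (simp add: nn_integral_cmult_indicator)
  qed
  have "(\<integral>\<^sup>+x. (\<integral>\<^sup>+y. h (x + s *\<^sub>R (y - x)) * indicator (cball c r) y \<partial>lborel) * indicator (cball c r) x \<partial>lborel)
     \<le> K * emeasure lborel (cball c r)"
  proof (cases "s \<ge> 1 / 2")
    case True
    then show ?thesis using assms by (intro fin) (auto simp: K_def intro!: far_end_average)
  next
    case False
    have "(\<integral>\<^sup>+x. (\<integral>\<^sup>+y. h (x + s *\<^sub>R (y - x)) * indicator (cball c r) y \<partial>lborel) * indicator (cball c r) x \<partial>lborel)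
        = (\<integral>\<^sup>+x. (\<integral>\<^sup>+y. h (x + s *\<^sub>R (y - x)) * indicator (cball c r) y * indicator (cball c r) x \<partial>lborel) \<partial>lborel)"
      by (intro nn_integral_cong nn_integral_multc[symmetric]) measurable
    also have "\<dots> = (\<integral>\<^sup>+y. (\<integral>\<^sup>+x. h (x + s *\<^sub>R (y - x)) * indicator (cball c r) y * indicator (cball c r) x \<partial>lborel) \<partial>lborel)"
      by (intro lborel_pair.Fubini'[symmetric]) measurable
    also have "\<dots> = (\<integral>\<^sup>+y. (\<integral>\<^sup>+x. h (x + s *\<^sub>R (y - x)) * indicator (cball c r) x * indicator (cball c r) y \<partial>lborel) \<partial>lborel)"
      by (simp add: mult_ac)
    also have "\<dots> = (\<integral>\<^sup>+y. (\<integral>\<^sup>+x. h (x + s *\<^sub>R (y - x)) * indicator (cball c r) x \<partial>lborel) * indicator (cball c r) y \<partial>lborel)"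
      by (intro nn_integral_cong nn_integral_multc) measurable
    also have "\<dots> \<le> K * emeasure lborel (cball c r)"
    proof (rule fin)
      fix y assume "y \<in> cball c r"
      have "x + s *\<^sub>R (y - x) = y + (1 - s) *\<^sub>R (x - y)" for x by (simp add: algebra_simps)
      then show "(\<integral>\<^sup>+x. h (x + s *\<^sub>R (y - x)) * indicator (cball c r) x \<partial>lborel) \<le> K"
        using far_end_average[OF h \<open>y \<in> cball c r\<close>, of "1 - s"] False assms by (simp add: K_def)
    qed
    finally show ?thesis .
  qed
  then show ?thesis by (simp add: K_def mult_ac)
qed

text \<open>
  Along every segment from \<open>S0\<close> to \<open>S1\<close> the function grows by \<open>1\<close>, so the gradient has integral at
  least \<open>1/(2r)\<close> over the parameter interval. Integrating over all such pairs of end points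
  spreads the gradient over the ball with density at most a multiple of the volume of the ball, by
  \<open>segment_average\<close>.
\<close>

lemma relative_isoperimetric:
  fixes u :: "'a::euclidean_space \<Rightarrow> real"
  assumes u: "\<And>x. (u has_derivative (\<lambda>h. g x \<bullet> h)) (at x)" and g: "continuous_on UNIV g" and "r > 0"
    and S: "S0 \<in> sets borel" "S1 \<in> sets borel" "S0 \<subseteq> cball c r" "S1 \<subseteq> cball c r"
    and u01: "\<And>x. x \<in> S0 \<Longrightarrow> u x = 0" "\<And>x. x \<in> S1 \<Longrightarrow> u x = 1"
  shows "emeasure lborel S0 * emeasure lborel S1
    \<le> ennreal (2 * r * 2 ^ DIM('a)) * emeasure lborel (cball c r) *
      (\<integral>\<^sup>+y. ennreal (norm (g y)) * indicator (cball c r) y \<partial>lborel)"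
proof -
  note S(1,2)[measurable]
  have [measurable]: "cball c r \<in> sets borel" by auto
  have [measurable]: "g \<in> borel_measurable borel"
    using g by (rule borel_measurable_continuous_onI)
  define B where "B = cball c r"
  have [measurable]: "B \<in> sets borel" by (simp add: B_def)
  define H where "H = (\<lambda>y. ennreal (norm (g y)))"
  have [measurable]: "H \<in> borel_measurable borel" unfolding H_def by measurable
  define D where "D = (\<lambda>x y s. H (x + s *\<^sub>R (y - x)) * indicator {0..1} s * indicator B y * indicator B x)"
  have "emeasure lborel S0 * emeasure lborel S1 = (\<integral>\<^sup>+x. (\<integral>\<^sup>+y. indicator S1 y \<partial>lborel) * indicator S0 x \<partial>lborel)"
    using S(1,2) by (simp add: nn_integral_cmult_indicator) (simp add: mult.commute)
  also have "\<dots> = (\<integral>\<^sup>+x. (\<integral>\<^sup>+y. indicator S1 y * indicator S0 x \<partial>lborel) \<partial>lborel)"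
    by (intro nn_integral_cong nn_integral_multc[symmetric]) measurable
  also have "\<dots> \<le> (\<integral>\<^sup>+x. (\<integral>\<^sup>+y. ennreal (2 * r) * (\<integral>\<^sup>+s. D x y s \<partial>lborel) \<partial>lborel) \<partial>lborel)"
  proof (intro nn_integral_mono)
    fix x y
    show "indicator S1 y * indicator S0 x \<le> ennreal (2 * r) * (\<integral>\<^sup>+s. D x y s \<partial>lborel)"
    proof (cases "x \<in> S0 \<and> y \<in> S1")
      case True
      then have xy: "x \<in> B" "y \<in> B" "\<bar>u y - u x\<bar> = 1" using S u01 by (auto simp: B_def)
      have "dist y x \<le> 2 * r" using xy dist_triangle2[of y x c] by (simp add: B_def dist_commute)
      then have "ennreal (norm (y - x)) \<le> ennreal (2 * r)" by (intro ennreal_leI) (simp add: dist_norm)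
      moreover have "1 \<le> ennreal (norm (y - x)) * (\<integral>\<^sup>+s. D x y s \<partial>lborel)"
        using segment_increment_le[OF u g, of y x] xy by (simp add: D_def H_def)
      ultimately have "1 \<le> ennreal (2 * r) * (\<integral>\<^sup>+s. D x y s \<partial>lborel)"
        by (meson mult_right_mono order_trans zero_le)
      then show ?thesis using True by simp
    qed auto
  qed
  also have "\<dots> = (\<integral>\<^sup>+x. ennreal (2 * r) * (\<integral>\<^sup>+y. (\<integral>\<^sup>+s. D x y s \<partial>lborel) \<partial>lborel) \<partial>lborel)"
    unfolding D_def by (intro nn_integral_cong nn_integral_cmult) measurable
  also have "\<dots> = ennreal (2 * r) * (\<integral>\<^sup>+x. (\<integral>\<^sup>+y. (\<integral>\<^sup>+s. D x y s \<partial>lborel) \<partial>lborel) \<partial>lborel)"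
    unfolding D_def by (intro nn_integral_cmult) measurable
  also have "(\<integral>\<^sup>+x. (\<integral>\<^sup>+y. (\<integral>\<^sup>+s. D x y s \<partial>lborel) \<partial>lborel) \<partial>lborel)
      = (\<integral>\<^sup>+x. (\<integral>\<^sup>+s. (\<integral>\<^sup>+y. D x y s \<partial>lborel) \<partial>lborel) \<partial>lborel)"
    unfolding D_def by (intro nn_integral_cong lborel_pair.Fubini'[symmetric]) measurable
  also have "\<dots> = (\<integral>\<^sup>+s. (\<integral>\<^sup>+x. (\<integral>\<^sup>+y. D x y s \<partial>lborel) \<partial>lborel) \<partial>lborel)"
    unfolding D_def by (intro lborel_pair.Fubini'[symmetric]) measurable
  also have "\<dots> \<le> (\<integral>\<^sup>+s. (ennreal (2 ^ DIM('a)) * emeasure lborel B * (\<integral>\<^sup>+y. H y * indicator B y \<partial>lborel)) * indicator {0..1} s \<partial>(lborel :: real measure))"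
  proof (intro nn_integral_mono)
    fix s :: real
    show "(\<integral>\<^sup>+x. (\<integral>\<^sup>+y. D x y s \<partial>lborel) \<partial>lborel)
      \<le> (ennreal (2 ^ DIM('a)) * emeasure lborel B * (\<integral>\<^sup>+y. H y * indicator B y \<partial>lborel)) * indicator {0..1} s"
    proof (cases "s \<in> {0..1}")
      case True
      have "(\<integral>\<^sup>+x. (\<integral>\<^sup>+y. D x y s \<partial>lborel) \<partial>lborel)
          = (\<integral>\<^sup>+x. (\<integral>\<^sup>+y. H (x + s *\<^sub>R (y - x)) * indicator B y \<partial>lborel) * indicator B x \<partial>lborel)"
        using True unfolding D_def by (simp add: nn_integral_multc)
      then show ?thesis using True segment_average[of H s c r] by (simp add: B_def)
    qed (simp add: D_def)
  qed
  also have "\<dots> = ennreal (2 ^ DIM('a)) * emeasure lborel B * (\<integral>\<^sup>+y. H y * indicator B y \<partial>lborel)"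
    by (simp add: nn_integral_cmult_indicator)
  finally show ?thesis using \<open>r > 0\<close>
    by (simp add: B_def H_def ennreal_mult mult_left_mono mult.assoc)
qed

section \<open>A weighted boxing inequality for level sets\<close>

text \<open>
  The ramp of \<open>|s|\<close> from level \<open>t\<close> to level \<open>t + h\<close>, made continuously differentiable by a
  quadratic spline. Treating positive and negative \<open>s\<close> by two separate ramps avoids the corner of
  the absolute value; since \<open>t > 0\<close> at most one of them is nonzero.
\<close>

lemma smooth_truncation:
  fixes t h :: real
  assumes "t > 0" "h > 0"
  obtains \<phi> \<phi>' :: "real \<Rightarrow> real" where
    "\<And>s. (\<phi> has_real_derivative \<phi>' s) (at s)" "continuous_on UNIV \<phi>'"
    "\<And>s. \<bar>s\<bar> \<le> t \<Longrightarrow> \<phi> s = 0" "\<And>s. \<bar>s\<bar> \<ge> t + h \<Longrightarrow> \<phi> s = 1"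
    "\<And>s. \<bar>\<phi>' s\<bar> \<le> 2 / h" "\<And>s. \<not> (t < \<bar>s\<bar> \<and> \<bar>s\<bar> < t + h) \<Longrightarrow> \<phi>' s = 0"
proof
  define pos where "pos = (\<lambda>z::real. max 0 z)"
  \<comment> \<open>The derivative \<open>\<tau>\<close> of this spline is the tent on \<open>[0,1]\<close> with height \<open>2\<close> at \<open>1/2\<close>.\<close>
  define \<sigma> where "\<sigma> = (\<lambda>z. 2 * ((pos z)\<^sup>2 - 2 * (pos (z - 1/2))\<^sup>2 + (pos (z - 1))\<^sup>2))"
  define \<tau> where "\<tau> = (\<lambda>z. 4 * (pos z - 2 * pos (z - 1/2) + pos (z - 1)))"
  define \<phi> where "\<phi> = (\<lambda>s. \<sigma> ((s - t) / h) + \<sigma> ((- s - t) / h))"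
  define \<phi>' where "\<phi>' = (\<lambda>s. \<tau> ((s - t) / h) / h - \<tau> ((- s - t) / h) / h)"
  have sq: "((\<lambda>z. (pos z)\<^sup>2) has_real_derivative 2 * pos z) (at z)" for z
  proof -
    consider "z > 0" | "z < 0" | "z = 0" by linarith
    then show ?thesis
    proof cases
      case 1
      have "((\<lambda>z. z\<^sup>2) has_real_derivative 2 * z) (at z)" by (auto intro!: derivative_eq_intros)
      then have "((\<lambda>z. (pos z)\<^sup>2) has_real_derivative 2 * z) (at z)"
        by (rule has_field_derivative_transform_within_open[where S = "{0<..}"]) (use 1 in \<open>auto simp: pos_def\<close>)
      then show ?thesis using 1 by (simp add: pos_def)
    next
      case 2
      have "((\<lambda>z. (pos z)\<^sup>2) has_real_derivative 0) (at z)"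
        by (rule has_field_derivative_transform_within_open[where S = "{..<0}" and f = "\<lambda>z. 0"])
           (use 2 in \<open>auto simp: pos_def\<close>)
      then show ?thesis using 2 by (simp add: pos_def)
    next
      case 3
      have "((\<lambda>y. pos y * pos y / y) \<longlongrightarrow> 0) (at 0)"
      proof (rule Lim_null_comparison)
        show "\<forall>\<^sub>F y in at 0. norm (pos y * pos y / y) \<le> \<bar>y\<bar>"
          by (intro always_eventually allI) (auto simp: pos_def max_def)
        show "((\<lambda>y. \<bar>y\<bar>) \<longlongrightarrow> 0) (at (0::real))" by (auto intro!: tendsto_eq_intros)
      qed
      then show ?thesis using 3 by (simp add: has_field_derivative_iff pos_def power2_eq_square)
    qed
  qed
  have sqs: "((\<lambda>s. (pos (l s))\<^sup>2) has_real_derivative 2 * pos (l s) * m) (at s)"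
    if "(l has_real_derivative m) (at s)" for l m s
    using DERIV_chain2[OF sq that] .
  have \<sigma>': "(\<sigma> has_real_derivative \<tau> z) (at z)" for z
  proof -
    have "((\<lambda>z. (pos (z - c))\<^sup>2) has_real_derivative 2 * pos (z - c)) (at z)" for c
    proof -
      have "((\<lambda>z. z - c) has_real_derivative 1) (at z)" by (auto intro!: derivative_eq_intros)
      from sqs[OF this] show ?thesis by simp
    qed
    note d = sq[of z] this[of "1/2"] this[of 1]
    have "(\<sigma> has_real_derivative 2 * (2 * pos z - 2 * (2 * pos (z - 1/2)) + 2 * pos (z - 1))) (at z)"
      unfolding \<sigma>_def by (intro DERIV_cmult DERIV_add DERIV_diff d)
    then show ?thesis by (rule DERIV_cong) (simp add: \<tau>_def)
  qed
  show "(\<phi> has_real_derivative \<phi>' s) (at s)" for s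
  proof -
    have "((\<lambda>s. \<sigma> ((s - t) / h)) has_real_derivative \<tau> ((s - t) / h) * (1 / h)) (at s)"
      by (rule DERIV_chain2[OF \<sigma>']) (use \<open>h > 0\<close> in \<open>auto intro!: derivative_eq_intros\<close>)
    moreover have "((\<lambda>s. \<sigma> ((- s - t) / h)) has_real_derivative \<tau> ((- s - t) / h) * (- 1 / h)) (at s)"
      by (rule DERIV_chain2[OF \<sigma>']) (use \<open>h > 0\<close> in \<open>auto intro!: derivative_eq_intros\<close>)
    ultimately show ?thesis
      unfolding \<phi>_def \<phi>'_def by (auto dest: DERIV_add)
  qed
  show "continuous_on UNIV \<phi>'"
    unfolding \<phi>'_def \<tau>_def pos_def using \<open>h > 0\<close> by (intro continuous_intros) auto
  have \<sigma>0: "\<sigma> z = 0" if "z \<le> 0" for z using that by (simp add: \<sigma>_def pos_def)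
  have \<sigma>1: "\<sigma> z = 1" if "z \<ge> 1" for z
    using that by (simp add: \<sigma>_def pos_def power2_eq_square algebra_simps)
  have \<tau>0: "\<tau> z = 0" if "\<not> (0 < z \<and> z < 1)" for z
    using that by (auto simp: \<tau>_def pos_def max_def)
  have \<tau>2: "0 \<le> \<tau> z" "\<tau> z \<le> 2" for z
    by (auto simp: \<tau>_def pos_def max_def)
  show "\<phi> s = 0" if "\<bar>s\<bar> \<le> t" for s
    using that \<open>h > 0\<close> by (simp add: \<phi>_def \<sigma>0 divide_nonpos_pos)
  show "\<phi> s = 1" if "\<bar>s\<bar> \<ge> t + h" for s
  proof (cases "s > 0")
    case True
    then show ?thesis using that assms by (simp add: \<phi>_def \<sigma>0 \<sigma>1 divide_nonpos_pos)
  next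
    case False
    then show ?thesis using that assms by (simp add: \<phi>_def \<sigma>0 \<sigma>1 divide_nonpos_pos)
  qed
  show "\<bar>\<phi>' s\<bar> \<le> 2 / h" for s
  proof -
    have "\<bar>\<tau> ((s - t) / h) - \<tau> ((- s - t) / h)\<bar> \<le> 2"
      using \<tau>2[of "(s - t) / h"] \<tau>2[of "(- s - t) / h"] by linarith
    then show ?thesis using \<open>h > 0\<close>
      by (simp add: \<phi>'_def diff_divide_distrib[symmetric] divide_right_mono)
  qed
  show "\<phi>' s = 0" if "\<not> (t < \<bar>s\<bar> \<and> \<bar>s\<bar> < t + h)" for s
  proof -
    have "\<not> (0 < (s - t) / h \<and> (s - t) / h < 1)" "\<not> (0 < (- s - t) / h \<and> (- s - t) / h < 1)"
      using that assms by (auto simp: field_simps zero_less_divide_iff)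
    then have "\<tau> ((s - t) / h) = 0" "\<tau> ((- s - t) / h) = 0" using \<tau>0 by blast+
    then show ?thesis by (simp add: \<phi>'_def)
  qed
qed

text \<open>
  The relative isoperimetric inequality for the truncation of \<open>f\<close>, whose gradient vanishes outside
  the strip and is at most \<open>2/h\<close> times the gradient of \<open>f\<close> inside it.
\<close>

lemma strip_gradient_bound:
  fixes f :: "'a::euclidean_space \<Rightarrow> real"
  assumes f: "\<And>x. (f has_derivative (\<lambda>v. g x \<bullet> v)) (at x)" and g: "continuous_on UNIV g"
    and pos: "r > 0" "t > 0" "h > 0" "\<kappa> \<ge> 0"
    and low: "measure lborel {y \<in> cball c r. \<bar>f y\<bar> \<le> t} \<ge> measure lborel (cball c r) / 2"
    and high: "measure lborel {y \<in> cball c r. \<bar>f y\<bar> \<ge> t + h} \<ge> \<kappa> * measure lborel (cball c r)"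
  shows "ennreal (\<kappa> * (measure lborel (cball c r) / r)) \<le> ennreal (2 ^ (DIM('a) + 3)) *
    (\<integral>\<^sup>+y. ennreal (norm (g y) / h) * indicator {y \<in> cball c r. t < \<bar>f y\<bar> \<and> \<bar>f y\<bar> < t + h} y \<partial>lborel)"
proof -
  define B where "B = cball c r"
  define S where "S = {y \<in> B. t < \<bar>f y\<bar> \<and> \<bar>f y\<bar> < t + h}"
  define S0 where "S0 = {y \<in> B. \<bar>f y\<bar> \<le> t}"
  define S1 where "S1 = {y \<in> B. \<bar>f y\<bar> \<ge> t + h}"
  have fc: "continuous_on UNIV f"
    using f has_derivative_continuous by (metis continuous_at_imp_continuous_on)
  have [measurable]: "f \<in> borel_measurable borel" "g \<in> borel_measurable borel" "B \<in> sets borel"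
    using fc g by (auto simp: B_def intro: borel_measurable_continuous_onI)
  have [measurable]: "S \<in> sets borel" unfolding S_def by measurable
  have S01: "S0 \<in> sets borel" "S1 \<in> sets borel" unfolding S0_def S1_def by measurable
  obtain \<phi> \<phi>' :: "real \<Rightarrow> real" where \<phi>:
    "\<And>s. (\<phi> has_real_derivative \<phi>' s) (at s)" "continuous_on UNIV \<phi>'"
    "\<And>s. \<bar>s\<bar> \<le> t \<Longrightarrow> \<phi> s = 0" "\<And>s. \<bar>s\<bar> \<ge> t + h \<Longrightarrow> \<phi> s = 1"
    "\<And>s. \<bar>\<phi>' s\<bar> \<le> 2 / h" "\<And>s. \<not> (t < \<bar>s\<bar> \<and> \<bar>s\<bar> < t + h) \<Longrightarrow> \<phi>' s = 0"
    by (rule smooth_truncation[OF pos(2,3)]) blast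
  have du: "((\<lambda>x. \<phi> (f x)) has_derivative (\<lambda>v. (\<phi>' (f x) *\<^sub>R g x) \<bullet> v)) (at x)" for x
    using has_derivative_compose[OF f \<phi>(1)[unfolded has_field_derivative_def]] by simp
  have cu: "continuous_on UNIV (\<lambda>x. \<phi>' (f x) *\<^sub>R g x)"
    by (intro continuous_intros g continuous_on_compose2[OF \<phi>(2) fc]) auto
  define Z where "Z = (\<integral>\<^sup>+y. ennreal (norm (g y) / h) * indicator S y \<partial>lborel)"
  have fin: "emeasure lborel S0 = ennreal (measure lborel S0)" "emeasure lborel S1 = ennreal (measure lborel S1)"
    "emeasure lborel B = ennreal (measure lborel B)"
  proof -
    have "bounded S0" "bounded S1" "bounded B"
      by (auto simp: S0_def S1_def B_def intro: bounded_subset[OF bounded_cball])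
    then show "emeasure lborel S0 = ennreal (measure lborel S0)" "emeasure lborel S1 = ennreal (measure lborel S1)"
      "emeasure lborel B = ennreal (measure lborel B)"
      using emeasure_bounded_finite by (intro emeasure_eq_ennreal_measure; force)+
  qed
  have b: "measure lborel B > 0" using pos by (simp add: B_def content_cball)
  have "emeasure lborel S0 * emeasure lborel S1 \<le> ennreal (2 * r * 2 ^ DIM('a)) * emeasure lborel B *
      (\<integral>\<^sup>+y. ennreal (norm (\<phi>' (f y) *\<^sub>R g y)) * indicator B y \<partial>lborel)"
    unfolding B_def
    by (rule relative_isoperimetric[OF du cu pos(1) S01])
       (auto simp: S0_def S1_def B_def \<phi>(3,4))
  also have "(\<integral>\<^sup>+y. ennreal (norm (\<phi>' (f y) *\<^sub>R g y)) * indicator B y \<partial>lborel)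
      \<le> (\<integral>\<^sup>+y. 2 * (ennreal (norm (g y) / h) * indicator S y) \<partial>lborel)"
  proof (intro nn_integral_mono)
    fix y
    show "ennreal (norm (\<phi>' (f y) *\<^sub>R g y)) * indicator B y \<le> 2 * (ennreal (norm (g y) / h) * indicator S y)"
    proof (cases "y \<in> B \<and> t < \<bar>f y\<bar> \<and> \<bar>f y\<bar> < t + h")
      case True
      have "norm (\<phi>' (f y) *\<^sub>R g y) \<le> 2 * (norm (g y) / h)"
        using mult_right_mono[OF \<phi>(5)[of "f y"] norm_ge_zero[of "g y"]] by simp
      then have "ennreal (norm (\<phi>' (f y) *\<^sub>R g y)) \<le> 2 * ennreal (norm (g y) / h)"
        using pos by (simp add: ennreal_mult[of 2, simplified, symmetric] ennreal_leI)
      then show ?thesis using True by (simp add: S_def)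
    next
      case False
      then show ?thesis using \<phi>(6)[of "f y"] by (auto simp: indicator_def)
    qed
  qed
  also have "\<dots> = 2 * Z"
    unfolding Z_def by (intro nn_integral_cmult) measurable
  finally have main: "ennreal (measure lborel S0) * ennreal (measure lborel S1)
      \<le> ennreal (2 * r * 2 ^ DIM('a)) * ennreal (measure lborel B) * (2 * Z)"
    by (simp add: fin mult_left_mono)
  show ?thesis
  proof (cases "Z = \<infinity>")
    case True
    then show ?thesis unfolding Z_def S_def B_def by (simp add: ennreal_mult_top)
  next
    case False
    then obtain z where z: "Z = ennreal z" "z \<ge> 0" by (cases Z) auto
    have "(2::ennreal) * ennreal z = ennreal (2 * z)" using z by (simp add: ennreal_mult)
    then have "measure lborel S0 * measure lborel S1 \<le> 2 * r * 2 ^ DIM('a) * measure lborel B * (2 * z)"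
      using main z pos by (simp add: ennreal_mult[symmetric] ennreal_le_iff)
    moreover have "measure lborel B / 2 * (\<kappa> * measure lborel B) \<le> measure lborel S0 * measure lborel S1"
      using low high pos by (intro mult_mono) (auto simp: S0_def S1_def B_def)
    ultimately have "measure lborel B * (\<kappa> * measure lborel B) \<le> measure lborel B * (r * (2 ^ (DIM('a) + 3) * z))"
      by (simp add: power_add algebra_simps)
    then have "\<kappa> * measure lborel B \<le> r * (2 ^ (DIM('a) + 3) * z)"
      using b by (rule mult_left_le_imp_le)
    then have "\<kappa> * (measure lborel B / r) \<le> 2 ^ (DIM('a) + 3) * z"
      using pos by (simp add: pos_divide_le_eq mult.commute)
    then have "ennreal (\<kappa> * (measure lborel B / r)) \<le> ennreal (2 ^ (DIM('a) + 3)) * ennreal z"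
      using z by (simp add: ennreal_mult[symmetric] ennreal_leI)
    then show ?thesis using z unfolding Z_def S_def B_def by simp
  qed
qed

text \<open>
  The sets \<open>{|f| \<ge> t + 1/(k+1)}\<close> increase to \<open>{|f| > t}\<close>, so for large \<open>k\<close> they still fill half of
  the proportion that the limit set fills, while \<open>{|f| \<le> t}\<close>, the zero set of every
  truncation, fills at least half of the ball.
\<close>

lemma eventually_strip_bound:
  fixes f :: "'a::euclidean_space \<Rightarrow> real"
  assumes f: "\<And>x. (f has_derivative (\<lambda>v. g x \<bullet> v)) (at x)" and g: "continuous_on UNIV g"
    and pos: "r > 0" "t > 0"
    and half: "measure lborel ({y. t < \<bar>f y\<bar>} \<inter> cball c r) \<le> measure lborel (cball c r) / 2"
      "measure lborel ({y. t < \<bar>f y\<bar>} \<inter> cball c r) \<ge> measure lborel (cball c r) / 2 ^ (DIM('a) + 1)"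
  shows "eventually (\<lambda>k. ennreal (measure lborel (cball c r) / r) \<le> ennreal (2 ^ (2 * DIM('a) + 5)) *
    (\<integral>\<^sup>+y. ennreal (norm (g y) * real (Suc k)) *
       indicator {y \<in> cball c r. t < \<bar>f y\<bar> \<and> \<bar>f y\<bar> < t + 1 / real (Suc k)} y \<partial>lborel)) sequentially"
proof -
  define B where "B = cball c r"
  have fc: "continuous_on UNIV f"
    using f has_derivative_continuous by (metis continuous_at_imp_continuous_on)
  have [measurable]: "f \<in> borel_measurable borel" "B \<in> sets borel"
    using fc by (auto simp: B_def intro: borel_measurable_continuous_onI)
  define A where "A = {y. t < \<bar>f y\<bar>} \<inter> B"
  define A' where "A' = (\<lambda>k. {y \<in> B. \<bar>f y\<bar> \<ge> t + 1 / real (Suc k)})"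
  have mA: "A \<in> sets borel" "A' k \<in> sets borel" for k unfolding A_def A'_def by measurable
  have finB: "B \<in> fmeasurable lborel" unfolding B_def by (intro fmeasurableI) (use emeasure_bounded_finite[OF bounded_cball[of c r]] in auto)
  have finA: "A \<in> fmeasurable lborel"
    using mA by (intro fmeasurableI2[OF finB]) (auto simp: A_def)
  have UA: "(\<Union>k. A' k) = A"
  proof
    show "(\<Union>k. A' k) \<subseteq> A"
    proof
      fix y assume "y \<in> (\<Union>k. A' k)"
      then obtain k where "y \<in> B" "t + 1 / real (Suc k) \<le> \<bar>f y\<bar>" by (auto simp: A'_def)
      moreover have "1 / real (Suc k) > 0" by simp
      ultimately have "y \<in> B" "t < \<bar>f y\<bar>" by linarith+
      then show "y \<in> A" by (simp add: A_def)
    qed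
    show "A \<subseteq> (\<Union>k. A' k)"
    proof
      fix y assume y: "y \<in> A"
      then have "\<bar>f y\<bar> - t > 0" by (simp add: A_def)
      then obtain k where "1 / real (Suc k) < \<bar>f y\<bar> - t" using nat_approx_posE by blast
      then show "y \<in> (\<Union>k. A' k)" using y by (auto simp: A_def A'_def intro!: exI[of _ k])
    qed
  qed
  have b: "measure lborel B > 0" using pos by (simp add: B_def content_cball)
  have inc: "incseq A'"
  proof (rule incseq_SucI)
    fix k
    have "1 / real (Suc (Suc k)) \<le> 1 / real (Suc k)" by (intro divide_left_mono) auto
    then show "A' k \<subseteq> A' (Suc k)" by (auto simp: A'_def simp del: of_nat_Suc)
  qed
  have "(\<lambda>k. measure lborel (A' k)) \<longlonglongrightarrow> measure lborel (\<Union>k. A' k)"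
    using mA finA inc by (intro Lim_measure_incseq) (auto simp: UA fmeasurable_def)
  then have lim: "(\<lambda>k. measure lborel (A' k)) \<longlonglongrightarrow> measure lborel A" by (simp add: UA)
  have "measure lborel B / 2 ^ (DIM('a) + 2) < measure lborel B / 2 ^ (DIM('a) + 1)"
    using b by (intro divide_strict_left_mono) auto
  also have "\<dots> \<le> measure lborel A" using half(2) by (simp add: A_def B_def)
  finally have "eventually (\<lambda>k. measure lborel B / 2 ^ (DIM('a) + 2) < measure lborel (A' k)) sequentially"
    by (rule order_tendstoD(1)[OF lim])
  then show ?thesis
  proof eventually_elim
    case (elim k)
    have "{y \<in> B. \<bar>f y\<bar> \<le> t} = B - A" by (auto simp: A_def)
    then have "measure lborel {y \<in> B. \<bar>f y\<bar> \<le> t} = measure lborel B - measure lborel A"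
      using finB finA by (simp add: measurable_measure_Diff A_def)
    then have low: "measure lborel {y \<in> cball c r. \<bar>f y\<bar> \<le> t} \<ge> measure lborel (cball c r) / 2"
      using half(1) by (simp add: A_def B_def)
    have high: "measure lborel {y \<in> cball c r. \<bar>f y\<bar> \<ge> t + 1 / real (Suc k)} \<ge> 1 / 2 ^ (DIM('a) + 2) * measure lborel (cball c r)"
      using elim by (simp add: A'_def B_def)
    have "ennreal (1 / 2 ^ (DIM('a) + 2) * (measure lborel (cball c r) / r)) \<le> ennreal (2 ^ (DIM('a) + 3)) *
      (\<integral>\<^sup>+y. ennreal (norm (g y) / (1 / real (Suc k))) *
        indicator {y \<in> cball c r. t < \<bar>f y\<bar> \<and> \<bar>f y\<bar> < t + 1 / real (Suc k)} y \<partial>lborel)" (is "_ \<le> _ * ?Z")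
      by (rule strip_gradient_bound[OF f g pos _ _ low high]) auto
    then have "ennreal (2 ^ (DIM('a) + 2)) * ennreal (1 / 2 ^ (DIM('a) + 2) * (measure lborel (cball c r) / r))
      \<le> ennreal (2 ^ (DIM('a) + 2)) * (ennreal (2 ^ (DIM('a) + 3)) * ?Z)"
      by (intro mult_left_mono) auto
    also have "\<dots> = ennreal (2 ^ (DIM('a) + 2) * 2 ^ (DIM('a) + 3)) * ?Z"
      by (subst ennreal_mult) (auto simp: mult.assoc)
    also have "(2::real) ^ (DIM('a) + 2) * 2 ^ (DIM('a) + 3) = 2 ^ (2 * DIM('a) + 5)"
      unfolding power_add[symmetric] by (rule arg_cong) simp
    also have "ennreal (2 ^ (DIM('a) + 2)) * ennreal (1 / 2 ^ (DIM('a) + 2) * (measure lborel (cball c r) / r))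
      = ennreal (measure lborel (cball c r) / r)"
      using pos by (subst ennreal_mult[symmetric]) auto
    finally show ?case by simp
  qed
qed

text \<open>
  Doubling the radius of a small ball inside \<open>A\<close>, the density of \<open>A\<close> eventually drops below \<open>1/2\<close>
  since \<open>A\<close> has finite measure. At the first such radius it is still at least \<open>1/2^(n+1)\<close>, because
  one doubling increases the volume of the ball only by the factor \<open>2^n\<close>.
\<close>

lemma half_density_radius:
  fixes A :: "'a::euclidean_space set"
  assumes "open A" "bounded A" "x \<in> A"
  obtains r where "r > 0"
    "measure lborel (A \<inter> cball x r) \<le> measure lborel (cball x r) / 2"
    "measure lborel (A \<inter> cball x r) \<ge> measure lborel (cball x r) / 2 ^ (DIM('a) + 1)"
proof -
  define n where "n = DIM('a)"
  define \<omega> where "\<omega> = unit_ball_vol (real n)"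
  have \<omega>: "\<omega> > 0" by (simp add: \<omega>_def)
  have vol: "measure lborel (cball x r) = \<omega> * r ^ n" if "r \<ge> 0" for r
    using that by (simp add: content_cball \<omega>_def n_def)
  have A: "A \<in> fmeasurable lborel" 
    using assms emeasure_bounded_finite[of A] by (intro fmeasurableI) auto
  have AB: "A \<inter> cball x r \<in> fmeasurable lborel" for r
    using A by (intro fmeasurable_Int_fmeasurable) auto
  obtain r0 where r0: "r0 > 0" "cball x r0 \<subseteq> A"
    using assms open_contains_cball by blast
  \<comment> \<open>The radii are tried in the order \<open>r0\<close>, \<open>2 r0\<close>, \<open>4 r0\<close>, ...\<close>
  define P where "P = (\<lambda>m. measure lborel (A \<inter> cball x (2 ^ m * r0)) < measure lborel (cball x (2 ^ m * r0)) / 2)"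
  have "\<exists>m. P m"
  proof -
    obtain m where m: "2 * measure lborel A / (\<omega> * r0 ^ n) < 2 ^ m"
      using real_arch_pow[of 2] by auto
    have "(2::real) ^ m \<le> (2 ^ m) ^ n"
      by (rule self_le_power) (auto simp: n_def)
    then have "2 * measure lborel A < \<omega> * r0 ^ n * (2 ^ m) ^ n"
      using m \<omega> r0 by (simp add: pos_divide_less_eq mult.commute) (smt (verit) mult_left_mono zero_less_power mult_pos_pos)
    moreover have "measure lborel (A \<inter> cball x (2 ^ m * r0)) \<le> measure lborel A"
      using A by (intro measure_mono_fmeasurable) (auto simp: fmeasurable_def)
    ultimately have "P m" using r0 by (simp add: P_def vol power_mult_distrib mult_ac)
    then show ?thesis ..
  qed
  then have Pm: "P (LEAST m. P m)" by (metis LeastI)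
  have "\<not> P 0"
  proof -
    have "A \<inter> cball x r0 = cball x r0" using r0 by blast
    then show ?thesis using r0 \<omega> by (simp add: P_def vol)
  qed
  then obtain m where m: "(LEAST m. P m) = Suc m" using Pm by (metis not0_implies_Suc)
  then have "\<not> P m" using not_less_Least[of m P] by simp
  define r where "r = 2 ^ m * r0"
  have r: "r > 0" using r0 by (simp add: r_def)
  have "measure lborel (cball x r) / 2 \<le> measure lborel (A \<inter> cball x r)"
    using \<open>\<not> P m\<close> by (simp add: P_def r_def)
  also have "\<dots> \<le> measure lborel (A \<inter> cball x (2 * r))"
    using AB r by (intro measure_mono_fmeasurable) (auto simp: fmeasurable_def)
  finally have "measure lborel (A \<inter> cball x (2 * r)) \<ge> measure lborel (cball x (2 * r)) / 2 ^ (DIM('a) + 1)"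
    using r by (simp add: vol power_mult_distrib n_def)
  moreover have "measure lborel (A \<inter> cball x (2 * r)) \<le> measure lborel (cball x (2 * r)) / 2"
  proof -
    have "P (Suc m)" using Pm m by simp
    then show ?thesis by (simp add: P_def r_def mult.assoc)
  qed
  ultimately show thesis using that[of "2 * r"] r by simp
qed

lemma sum_powr_le_powr_sum:
  fixes a :: "'b \<Rightarrow> real"
  assumes "finite F" "\<And>x. x \<in> F \<Longrightarrow> a x \<ge> 0" "Q \<ge> 1"
  shows "(\<Sum>x\<in>F. a x powr Q) \<le> (\<Sum>x\<in>F. a x) powr Q"
proof -
  define S where "S = (\<Sum>x\<in>F. a x)"
  have S: "S \<ge> 0" "\<And>x. x \<in> F \<Longrightarrow> a x \<le> S"
    using assms by (auto simp: S_def intro!: sum_nonneg member_le_sum)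
  show ?thesis
  proof (cases "S = 0")
    case True
    then have "a x = 0" if "x \<in> F" for x using assms S that by force
    then show ?thesis by simp
  next
    case False
    then have "S > 0" using S by simp
    have split: "y powr Q = y * y powr (Q - 1)" if "y \<ge> 0" for y
      using that by (cases "y = 0") (auto simp: powr_diff)
    have "(\<Sum>x\<in>F. a x powr Q) = (\<Sum>x\<in>F. a x * a x powr (Q - 1))"
      using assms split by simp
    also have "\<dots> \<le> (\<Sum>x\<in>F. a x * S powr (Q - 1))"
      using assms S by (intro sum_mono mult_left_mono powr_mono2) auto
    also have "\<dots> = S powr Q" using split[of S] S by (simp add: S_def sum_distrib_right)
    finally show ?thesis by (simp add: S_def)
  qed
qed

text \<open>
  The balls of intermediate density cover \<open>{|f| > t}\<close>, and their radii are bounded because the set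
  has finite measure, so Vitali's lemma gives disjoint balls whose fivefold enlargements still
  cover. The hypothesis \<open>ball\<close> compares the mass of an enlarged ball with the isoperimetric lower
  bound for the weighted strip integral in the ball; \<open>\<Omega>\<close> is a lower bound for the weight there.
  The disjoint balls share one strip integral, and \<open>Q \<ge> 1\<close> allows summing inside the power.
\<close>

lemma boxing_inequality:
  fixes f w :: "'a::euclidean_space \<Rightarrow> real"
  assumes f: "\<And>x. (f has_derivative (\<lambda>v. g x \<bullet> v)) (at x)" and g: "continuous_on UNIV g"
    and supp: "bounded {x. f x \<noteq> 0}" and "t > 0" "K > 0" "Q \<ge> 1" "l \<ge> 0"
    and w: "w \<in> borel_measurable borel" and M: "sets M = sets borel"
    and \<Omega>: "\<And>x r. r > 0 \<Longrightarrow> \<Omega> x r \<ge> 0" "\<And>x r. r > 0 \<Longrightarrow> AE y in lborel. y \<in> cball x r \<longrightarrow> \<Omega> x r \<le> w y"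
    and ball: "\<And>x r. r > 0 \<Longrightarrow>
      emeasure M (cball x (5 * r)) \<le> ennreal ((K * (measure lborel (cball x r) / r * \<Omega> x r)) powr Q)"
    and L: "liminf (\<lambda>k. \<integral>\<^sup>+y. ennreal (norm (g y) * w y * real (Suc k)) *
       indicator {y. t < \<bar>f y\<bar> \<and> \<bar>f y\<bar> < t + 1 / real (Suc k)} y \<partial>lborel) \<le> ennreal l"
      (is "liminf ?J \<le> _")
  shows "emeasure M {x. t < \<bar>f x\<bar>} \<le> ennreal ((K * (2 ^ (2 * DIM('a) + 5) * l)) powr Q)"
proof -
  define n where "n = DIM('a)"
  define \<omega> where "\<omega> = unit_ball_vol (real n)"
  have \<omega>: "\<omega> > 0" by (simp add: \<omega>_def)
  define S where "S = (\<lambda>k. {y. t < \<bar>f y\<bar> \<and> \<bar>f y\<bar> < t + 1 / real (Suc k)})"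
  define A where "A = {x. t < \<bar>f x\<bar>}"
  have fc: "continuous_on UNIV f"
    using f has_derivative_continuous by (metis continuous_at_imp_continuous_on)
  note w[measurable]
  have [measurable]: "f \<in> borel_measurable borel" "g \<in> borel_measurable borel"
    using fc g by (auto intro: borel_measurable_continuous_onI)
  have [measurable]: "S k \<in> sets borel" for k unfolding S_def by measurable
  have [measurable]: "cball c r \<in> sets borel" for c :: 'a and r by auto
  have "open A" unfolding A_def
    using fc by (intro open_Collect_less continuous_intros) auto
  have "bounded A" unfolding A_def using \<open>t > 0\<close> by (intro bounded_subset[OF supp]) auto
  have finA: "A \<in> fmeasurable lborel"
    using \<open>open A\<close> \<open>bounded A\<close> emeasure_bounded_finite[of A] by (intro fmeasurableI) auto
  have "\<exists>r>0. measure lborel (A \<inter> cball x r) \<le> measure lborel (cball x r) / 2 \<and>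
      measure lborel (A \<inter> cball x r) \<ge> measure lborel (cball x r) / 2 ^ (n + 1)" if "x \<in> A" for x
    using half_density_radius[OF \<open>open A\<close> \<open>bounded A\<close> that] unfolding n_def by metis
  then obtain \<rho> where \<rho>: "\<And>x. x \<in> A \<Longrightarrow> \<rho> x > 0"
    "\<And>x. x \<in> A \<Longrightarrow> measure lborel (A \<inter> cball x (\<rho> x)) \<le> measure lborel (cball x (\<rho> x)) / 2"
    "\<And>x. x \<in> A \<Longrightarrow> measure lborel (A \<inter> cball x (\<rho> x)) \<ge> measure lborel (cball x (\<rho> x)) / 2 ^ (n + 1)"
    by metis
  \<comment> \<open>A bound for all radii: the volume of the ball is at most \<open>2^(n+1)\<close> times the measure of \<open>A\<close>.\<close>
  define X where "X = 1 + measure lborel A * 2 ^ (n + 1) / \<omega>"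
  have \<rho>X: "\<rho> x \<le> X" if "x \<in> A" for x
  proof (rule ccontr)
    assume "\<not> ?thesis"
    then have big: "\<rho> x > X" by simp
    have "X \<ge> 1" using \<omega> by (simp add: X_def)
    then have "\<rho> x \<le> \<rho> x ^ n" using big by (intro self_le_power) (auto simp: n_def)
    also have "\<omega> * \<rho> x ^ n / 2 ^ (n + 1) \<le> measure lborel A"
    proof -
      have "\<omega> * \<rho> x ^ n / 2 ^ (n + 1) \<le> measure lborel (A \<inter> cball x (\<rho> x))"
        using \<rho>[OF that] by (simp add: content_cball \<omega>_def n_def)
      also have "\<dots> \<le> measure lborel A"
        using finA by (intro measure_mono_fmeasurable) auto
      finally show ?thesis .
    qed
    then have "\<rho> x ^ n \<le> measure lborel A * 2 ^ (n + 1) / \<omega>"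
      using \<omega> by (simp add: field_simps)
    finally show False using big by (simp add: X_def)
  qed
  obtain C where C: "countable C" "C \<subseteq> A"
    "pairwise (\<lambda>i j. disjnt (cball i (\<rho> i)) (cball j (\<rho> j))) C"
    "A \<subseteq> (\<Union>i\<in>C. cball i (5 * \<rho> i))"
  proof (rule Vitali_covering_lemma_cballs[where S = A and K = A and a = "\<lambda>x. x" and r = \<rho> and B = X])
    show "A \<subseteq> (\<Union>i\<in>A. cball i (\<rho> i))"
    proof
      fix x assume "x \<in> A"
      then have "x \<in> cball x (\<rho> x)" using \<rho>(1) by (simp add: less_imp_le)
      then show "x \<in> (\<Union>i\<in>A. cball i (\<rho> i))" using \<open>x \<in> A\<close> by blast
    qed
  qed (use \<rho>(1) \<rho>X in auto)
  define a where "a = (\<lambda>x. measure lborel (cball x (\<rho> x)) / \<rho> x * \<Omega> x (\<rho> x))"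
  have a0: "a x \<ge> 0" if "x \<in> A" for x
    using \<rho>(1)[OF that] \<Omega>(1) by (simp add: a_def)
  define c where "c = (2::real) ^ (2 * n + 5)"
  \<comment> \<open>Countably many balls may be needed; finite subfamilies suffice because all bounds are uniform.\<close>
  have sum_le: "(\<Sum>x\<in>F. a x) \<le> c * l" if F: "finite F" "F \<subseteq> C" for F
  proof -
    have FA: "F \<subseteq> A" using F C by auto
    have disj: "disjoint_family_on (\<lambda>x. cball x (\<rho> x)) F"
      using C(3) F(2) unfolding disjoint_family_on_def pairwise_def disjnt_def by blast
    have "eventually (\<lambda>k. \<forall>x\<in>F. ennreal (measure lborel (cball x (\<rho> x)) / \<rho> x) \<le> ennreal c *
        (\<integral>\<^sup>+y. ennreal (norm (g y) * real (Suc k)) *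
          indicator {y \<in> cball x (\<rho> x). t < \<bar>f y\<bar> \<and> \<bar>f y\<bar> < t + 1 / real (Suc k)} y \<partial>lborel)) sequentially"
      unfolding c_def n_def using \<rho> FA \<open>t > 0\<close> unfolding A_def n_def
      by (intro eventually_ball_finite F(1) ballI eventually_strip_bound f g) auto
    then have "eventually (\<lambda>k. ennreal (\<Sum>x\<in>F. a x) \<le> ennreal c * ?J k) sequentially"
    proof eventually_elim
      case (elim k)
      have one: "ennreal (a x) \<le> ennreal c * (\<integral>\<^sup>+y. ennreal (norm (g y) * w y * real (Suc k)) * indicator (S k) y * indicator (cball x (\<rho> x)) y \<partial>lborel)"
        if "x \<in> F" for x
      proof -
        have x: "\<rho> x > 0" using that FA \<rho> by blast
        have "ennreal (a x) = ennreal (measure lborel (cball x (\<rho> x)) / \<rho> x) * ennreal (\<Omega> x (\<rho> x))"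
          unfolding a_def using x \<Omega>(1)[OF x] by (intro ennreal_mult) auto
        also have "\<dots> \<le> ennreal c * (\<integral>\<^sup>+y. ennreal (norm (g y) * real (Suc k)) *
          indicator {y \<in> cball x (\<rho> x). t < \<bar>f y\<bar> \<and> \<bar>f y\<bar> < t + 1 / real (Suc k)} y \<partial>lborel) * ennreal (\<Omega> x (\<rho> x))"
          using elim that by (intro mult_right_mono) auto
        also have "\<dots> = ennreal c * (\<integral>\<^sup>+y. ennreal (norm (g y) * real (Suc k)) *
          indicator {y \<in> cball x (\<rho> x). t < \<bar>f y\<bar> \<and> \<bar>f y\<bar> < t + 1 / real (Suc k)} y * ennreal (\<Omega> x (\<rho> x)) \<partial>lborel)"
          by (subst nn_integral_multc) (auto simp: mult.assoc)
        also have "\<dots> \<le> ennreal c * (\<integral>\<^sup>+y. ennreal (norm (g y) * w y * real (Suc k)) * indicator (S k) y * indicator (cball x (\<rho> x)) y \<partial>lborel)"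
        proof (intro mult_left_mono nn_integral_mono_AE)
          show "AE y in lborel. ennreal (norm (g y) * real (Suc k)) *
             indicator {y \<in> cball x (\<rho> x). t < \<bar>f y\<bar> \<and> \<bar>f y\<bar> < t + 1 / real (Suc k)} y * ennreal (\<Omega> x (\<rho> x))
            \<le> ennreal (norm (g y) * w y * real (Suc k)) * indicator (S k) y * indicator (cball x (\<rho> x)) y"
            using \<Omega>(2)[OF x, of x]
          proof eventually_elim
            case (elim y)
            show ?case
            proof (cases "y \<in> cball x (\<rho> x) \<and> y \<in> S k")
              case True
              then have "\<Omega> x (\<rho> x) \<le> w y" using elim by blast
              then have "norm (g y) * real (Suc k) * \<Omega> x (\<rho> x) \<le> norm (g y) * real (Suc k) * w y"
                by (intro mult_left_mono) auto
              then have "ennreal (norm (g y) * real (Suc k)) * ennreal (\<Omega> x (\<rho> x)) \<le> ennreal (norm (g y) * w y * real (Suc k))"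
                using \<Omega>(1)[OF x] by (simp add: ennreal_mult[symmetric] mult_ac ennreal_leI del: of_nat_Suc)
              then show ?thesis using True by (simp add: S_def)
            qed (auto simp: S_def)
          qed
        qed auto
        finally show ?thesis .
      qed
      have "ennreal (\<Sum>x\<in>F. a x) = (\<Sum>x\<in>F. ennreal (a x))"
        using a0 FA by (intro sum_ennreal[symmetric]) auto
      also have "\<dots> \<le> (\<Sum>x\<in>F. ennreal c * (\<integral>\<^sup>+y. ennreal (norm (g y) * w y * real (Suc k)) * indicator (S k) y * indicator (cball x (\<rho> x)) y \<partial>lborel))"
        by (intro sum_mono one)
      also have "\<dots> = ennreal c * (\<integral>\<^sup>+y. (\<Sum>x\<in>F. ennreal (norm (g y) * w y * real (Suc k)) * indicator (S k) y * indicator (cball x (\<rho> x)) y) \<partial>lborel)"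
        by (subst nn_integral_sum) (auto simp: sum_distrib_left)
      also have "\<dots> \<le> ennreal c * ?J k"
      proof (intro mult_left_mono nn_integral_mono)
        fix y
        have "(\<Sum>x\<in>F. indicator (cball x (\<rho> x)) y :: ennreal) = indicator (\<Union>x\<in>F. cball x (\<rho> x)) y"
          using F disj by (simp add: indicator_UN_disjoint)
        also have "\<dots> \<le> 1" by (simp add: indicator_def)
        finally have le1: "(\<Sum>x\<in>F. indicator (cball x (\<rho> x)) y :: ennreal) \<le> 1" .
        have "(\<Sum>x\<in>F. ennreal (norm (g y) * w y * real (Suc k)) * indicator (S k) y * indicator (cball x (\<rho> x)) y)
          = ennreal (norm (g y) * w y * real (Suc k)) * indicator (S k) y * (\<Sum>x\<in>F. indicator (cball x (\<rho> x)) y)"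
          by (simp add: sum_distrib_left)
        also have "\<dots> \<le> ennreal (norm (g y) * w y * real (Suc k)) * indicator (S k) y * 1"
          using le1 by (intro mult_left_mono) auto
        finally show "(\<Sum>x\<in>F. ennreal (norm (g y) * w y * real (Suc k)) * indicator (S k) y * indicator (cball x (\<rho> x)) y)
          \<le> ennreal (norm (g y) * w y * real (Suc k)) * indicator {y. t < \<bar>f y\<bar> \<and> \<bar>f y\<bar> < t + 1 / real (Suc k)} y"
          by (simp add: S_def)
      qed auto
      finally show ?case .
    qed
    then have "eventually (\<lambda>k. ennreal ((\<Sum>x\<in>F. a x) / c) \<le> ?J k) sequentially"
    proof eventually_elim
      case (elim k)
      have c0: "c > 0" by (simp add: c_def)
      have "ennreal ((\<Sum>x\<in>F. a x) / c) = ennreal (1 / c) * ennreal (\<Sum>x\<in>F. a x)"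
        using c0 by (subst ennreal_mult'[symmetric]) auto
      also have "\<dots> \<le> ennreal (1 / c) * (ennreal c * ?J k)" using elim by (intro mult_left_mono) auto
      also have "\<dots> = ?J k" using c0 by (simp add: mult.assoc[symmetric] ennreal_mult[symmetric])
      finally show ?case .
    qed
    then have "ennreal ((\<Sum>x\<in>F. a x) / c) \<le> liminf ?J" by (rule Liminf_bounded)
    also note L
    finally have "(\<Sum>x\<in>F. a x) / c \<le> l" using \<open>l \<ge> 0\<close> by (simp add: ennreal_le_iff)
    then show ?thesis by (simp add: c_def field_simps)
  qed
  have fin_le: "emeasure M (\<Union>x\<in>F. cball x (5 * \<rho> x)) \<le> ennreal ((K * (c * l)) powr Q)"
    if F: "finite F" "F \<subseteq> C" for F
  proof -
    have FA: "F \<subseteq> A" using F C by auto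
    have "emeasure M (\<Union>x\<in>F. cball x (5 * \<rho> x)) \<le> (\<Sum>x\<in>F. emeasure M (cball x (5 * \<rho> x)))"
      using F M by (intro emeasure_subadditive_finite) auto
    also have "\<dots> \<le> (\<Sum>x\<in>F. ennreal ((K * a x) powr Q))"
      unfolding a_def using FA \<rho>(1) by (intro sum_mono ball) auto
    also have "\<dots> = ennreal (\<Sum>x\<in>F. (K * a x) powr Q)" by (intro sum_ennreal) auto
    also have "\<dots> \<le> ennreal ((\<Sum>x\<in>F. K * a x) powr Q)"
      using F FA a0 \<open>K > 0\<close> \<open>Q \<ge> 1\<close> by (intro ennreal_leI sum_powr_le_powr_sum) auto
    also have "\<dots> \<le> ennreal ((K * (c * l)) powr Q)"
      using sum_le[OF F] \<open>K > 0\<close> \<open>Q \<ge> 1\<close> a0 FA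
      by (intro ennreal_leI powr_mono2) (auto simp: sum_distrib_left[symmetric] intro!: sum_nonneg mult_nonneg_nonneg)
    finally show ?thesis .
  qed
  have "emeasure M A \<le> ennreal ((K * (c * l)) powr Q)"
  proof (cases "C = {}")
    case True
    then show ?thesis using C by simp
  next
    case False
    define e where "e = from_nat_into C"
    have e: "range e = C" using C(1) False by (simp add: e_def range_from_nat_into)
    define U where "U = (\<lambda>m. \<Union>x\<in>e ` {..<m}. cball x (5 * \<rho> x))"
    have "A \<subseteq> (\<Union>m. U m)"
    proof
      fix x assume "x \<in> A"
      then obtain i where "x \<in> cball (e i) (5 * \<rho> (e i))" using C(4) e by blast
      then have "x \<in> U (Suc i)" by (auto simp: U_def)
      then show "x \<in> (\<Union>m. U m)" by blast
    qed
    then have "emeasure M A \<le> emeasure M (\<Union>m. U m)"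
      using M by (intro emeasure_mono) (auto simp: U_def)
    also have "\<dots> = (SUP m. emeasure M (U m))"
    proof (rule SUP_emeasure_incseq[symmetric])
      show "incseq U" unfolding incseq_def U_def by (intro allI impI UN_mono image_mono) auto
      have "U m \<in> sets borel" for m unfolding U_def by (intro sets.finite_UN) auto
      then show "range U \<subseteq> sets M" unfolding M by blast
    qed
    also have "\<dots> \<le> ennreal ((K * (c * l)) powr Q)"
      unfolding U_def using e by (intro SUP_least fin_le) auto
    finally show ?thesis .
  qed
  then show ?thesis by (simp add: A_def c_def n_def)
qed

section \<open>Growth of the weight from the Assouad dimension\<close>

lemma covering_number_attained:
  assumes "covering_number A r \<noteq> \<infinity>"
  obtains F where "finite F" "F \<subseteq> A" "A \<subseteq> (\<Union>y\<in>F. ball y r)" "covering_number A r = enat (card F)"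
proof -
  define S where "S = {F. finite F \<and> F \<subseteq> A \<and> A \<subseteq> (\<Union>y\<in>F. ball y r)}"
  have "S \<noteq> {}"
  proof
    assume "S = {}"
    then have "covering_number A r = \<infinity>"
      unfolding covering_number_def S_def[symmetric] by (simp add: top_enat_def)
    then show False using assms by simp
  qed
  define T where "T = (\<lambda>F. enat (card F)) ` S"
  have "T \<noteq> {}" using \<open>S \<noteq> {}\<close> by (simp add: T_def)
  have "(LEAST x. x \<in> T) \<in> T"
    by (rule LeastI_ex) (use \<open>T \<noteq> {}\<close> in blast)
  moreover have "covering_number A r = Inf T"
    unfolding covering_number_def S_def[symmetric] T_def ..
  ultimately have "covering_number A r \<in> T"
    using \<open>T \<noteq> {}\<close> by (simp add: Inf_enat_def)
  then obtain F where F: "F \<in> S" "covering_number A r = enat (card F)"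
    unfolding T_def by blast
  show thesis
    by (rule that[of F]) (use F in \<open>auto simp: S_def\<close>)
qed

text \<open>
  The definition of the Assouad dimension only speaks of radii below the diameter. For bounded \<open>E\<close>
  a larger ball is first covered by finitely many balls of one fixed admissible radius, which
  exist by compactness; if the diameter is not positive, there is at most one point.
\<close>

lemma covers_at_all_scales:
  fixes E :: "'a::euclidean_space set"
  assumes "closed E" and dim: "assouad_dim E < ereal d"
  obtains l C where "0 \<le> l" "l < d" "C > 0"
    "\<And>x r R. x \<in> E \<Longrightarrow> 0 < r \<Longrightarrow> r < R \<Longrightarrow>
      \<exists>F. finite F \<and> E \<inter> ball x R \<subseteq> (\<Union>y\<in>F. ball y r) \<and> real (card F) \<le> C * (R / r) powr l"
proof -
  obtain l C where l: "0 \<le> l" "l < d" and "C > 0" and C: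
    "\<And>x r R. x \<in> E \<Longrightarrow> 0 < r \<Longrightarrow> r < R \<Longrightarrow> ereal R < ediameter E \<Longrightarrow>
       ereal_of_enat (covering_number (E \<inter> ball x R) r) \<le> ereal (C * (r / R) powr (- l))"
    using dim unfolding assouad_dim_def INF_less_iff by auto
  have small: "\<exists>F. finite F \<and> E \<inter> ball x R \<subseteq> (\<Union>y\<in>F. ball y r) \<and> real (card F) \<le> C * (R / r) powr l"
    if x: "x \<in> E" "0 < r" "r < R" "ereal R < ediameter E" for x r R
  proof -
    have le: "ereal_of_enat (covering_number (E \<inter> ball x R) r) \<le> ereal (C * (r / R) powr (- l))"
      using C[OF x] .
    have "covering_number (E \<inter> ball x R) r \<noteq> \<infinity>"
    proof
      assume "covering_number (E \<inter> ball x R) r = \<infinity>"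
      then show False using le by simp
    qed
    then obtain F where F: "finite F" "E \<inter> ball x R \<subseteq> (\<Union>y\<in>F. ball y r)"
        "covering_number (E \<inter> ball x R) r = enat (card F)"
      by (rule covering_number_attained)
    have "(r / R) powr (- l) = (R / r) powr l"
      using x by (simp add: powr_divide powr_minus_divide)
    then show ?thesis using F le by auto
  qed
  show thesis
  proof (cases "\<exists>R>0. ereal R < ediameter E \<and> ediameter E \<noteq> \<infinity>")
    case False
    consider "ediameter E = \<infinity>" | "\<And>R. R > 0 \<Longrightarrow> ediameter E \<le> ereal R"
      using False by (meson not_le)
    then show thesis
    proof cases
      case 1
      then show thesis using that[OF l \<open>C > 0\<close>] small by simp
    next
      case 2
      have eq: "y = x" if "x \<in> E" "y \<in> E" for x y
      proof (rule ccontr)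
        assume "y \<noteq> x"
        then have "ediameter E \<le> ereal (dist x y / 2)" by (intro 2) simp
        moreover have "ereal (dist x y) \<le> ediameter E"
          unfolding ediameter_def using that by (intro SUP_upper2[of "(x, y)"]) auto
        ultimately have "dist x y \<le> dist x y / 2" by (meson ereal_less_eq(3) order_trans)
        then show False using \<open>y \<noteq> x\<close> by simp
      qed
      show thesis
      proof (rule that[OF l zero_less_one])
        fix x r R assume x: "x \<in> E" "0 < (r::real)" "r < R"
        have "1 \<le> (R / r) powr l" using x l by (intro ge_one_powr_ge_zero) auto
        moreover have "E \<inter> ball x R \<subseteq> ball x r"
        proof
          fix y assume "y \<in> E \<inter> ball x R"
          then have "y = x" using eq[OF x(1)] by blast
          then show "y \<in> ball x r" using x by simp
        qed
        ultimately show "\<exists>F. finite F \<and> E \<inter> ball x R \<subseteq> (\<Union>y\<in>F. ball y r) \<and> real (card F) \<le> 1 * (R / r) powr l"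
          by (intro exI[of _ "{x}"]) auto
      qed
    qed
  next
    case True
    \<comment> \<open>One admissible radius \<open>\<rho>\<close> serves as the pivot between the definition and larger balls.\<close>
    then obtain \<rho> where \<rho>: "\<rho> > 0" "ereal \<rho> < ediameter E" "ediameter E \<noteq> \<infinity>" by blast
    then obtain D where D: "ediameter E = ereal D" by (cases "ediameter E") auto
    have bd: "dist x y \<le> D" if "x \<in> E" "y \<in> E" for x y
    proof -
      have "ereal (dist x y) \<le> ediameter E"
        unfolding ediameter_def using that by (intro SUP_upper2[of "(x, y)"]) auto
      then show ?thesis by (simp add: D)
    qed
    then have "bounded E" unfolding bounded_any_center bounded_def by (cases "E = {}") blast+
    then have "compact E" using \<open>closed E\<close> compact_eq_bounded_closed by blast
    then obtain Z where Z: "finite Z" "Z \<subseteq> E" "E \<subseteq> (\<Union>z\<in>Z. ball z \<rho>)"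
    proof (rule compactE_image[of E E "\<lambda>z. ball z \<rho>"])
      show "E \<subseteq> (\<Union>z\<in>E. ball z \<rho>)" using \<rho>(1) by auto
    qed auto
    define C' where "C' = (1 + C) * (1 + real (card Z))"
    have C': "C' > 0" "C \<le> C'" "real (card Z) \<le> C'" "real (card Z) * C \<le> C'"
    proof -
      have "C' = 1 + C + real (card Z) + real (card Z) * C" by (simp add: C'_def algebra_simps)
      moreover have "real (card Z) * C \<ge> 0" using \<open>C > 0\<close> by simp
      moreover have "real (card Z) \<ge> 0" by simp
      ultimately show "C' > 0" "C \<le> C'" "real (card Z) \<le> C'" "real (card Z) * C \<le> C'"
        using \<open>C > 0\<close> by linarith+
    qed
    show thesis
    proof (rule that[OF l C'(1)])
      fix x and r R :: real assume x: "x \<in> E" "0 < r" "r < R"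
      have one: "1 \<le> (R / r) powr l" using x l by (intro ge_one_powr_ge_zero) auto
      consider "R \<le> \<rho>" | "\<rho> \<le> r" | "r < \<rho>" "\<rho> < R" using x by linarith
      then show "\<exists>F. finite F \<and> E \<inter> ball x R \<subseteq> (\<Union>y\<in>F. ball y r) \<and> real (card F) \<le> C' * (R / r) powr l"
      proof cases
        case 1
        then have "ereal R < ediameter E" using \<rho> by (meson ereal_less_eq(3) order_le_less_trans)
        then obtain F where F: "finite F" "E \<inter> ball x R \<subseteq> (\<Union>y\<in>F. ball y r)" "real (card F) \<le> C * (R / r) powr l"
          using small[OF x] by blast
        moreover have "C * (R / r) powr l \<le> C' * (R / r) powr l" using C' by (intro mult_right_mono) auto
        ultimately have "real (card F) \<le> C' * (R / r) powr l" by linarith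
        then show ?thesis using F(1,2) by blast
      next
        case 2
        have "E \<inter> ball x R \<subseteq> (\<Union>y\<in>Z. ball y r)"
        proof
          fix y assume "y \<in> E \<inter> ball x R"
          then obtain z where "z \<in> Z" "dist z y < \<rho>" using Z(3) by auto
          then have "dist z y < r" using 2 by simp
          then show "y \<in> (\<Union>y\<in>Z. ball y r)" using \<open>z \<in> Z\<close> by auto
        qed
        moreover have "real (card Z) \<le> C' * (R / r) powr l"
          using C' one mult_mono[of "real (card Z)" C' 1 "(R / r) powr l"] by simp
        ultimately show ?thesis using Z(1) by blast
      next
        case 3
        have "\<exists>F. finite F \<and> E \<inter> ball z \<rho> \<subseteq> (\<Union>y\<in>F. ball y r) \<and> real (card F) \<le> C * (\<rho> / r) powr l" if "z \<in> Z" for z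
        proof -
          have "z \<in> E" using that Z(2) by auto
          then show ?thesis using small[of z r \<rho>] x(2) 3(1) \<rho>(2) by simp
        qed
        then obtain F where F: "\<And>z. z \<in> Z \<Longrightarrow> finite (F z)" "\<And>z. z \<in> Z \<Longrightarrow> E \<inter> ball z \<rho> \<subseteq> (\<Union>y\<in>F z. ball y r)"
            "\<And>z. z \<in> Z \<Longrightarrow> real (card (F z)) \<le> C * (\<rho> / r) powr l"
          by metis
        have cov: "E \<inter> ball x R \<subseteq> (\<Union>y\<in>(\<Union>z\<in>Z. F z). ball y r)"
        proof
          fix y assume y: "y \<in> E \<inter> ball x R"
          then obtain z where z: "z \<in> Z" "y \<in> ball z \<rho>" using Z(3) by auto
          then have "y \<in> (\<Union>w\<in>F z. ball w r)" using F(2)[OF z(1)] y by (meson IntD1 IntI subsetD)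
          then show "y \<in> (\<Union>y\<in>(\<Union>z\<in>Z. F z). ball y r)" using z(1) by auto
        qed
        have "real (card (\<Union>z\<in>Z. F z)) \<le> real (\<Sum>z\<in>Z. card (F z))"
          by (intro of_nat_mono card_UN_le Z(1))
        also have "\<dots> = (\<Sum>z\<in>Z. real (card (F z)))" by simp
        also have "\<dots> \<le> (\<Sum>z\<in>Z. C * (R / r) powr l)"
        proof (intro sum_mono)
          fix z assume "z \<in> Z"
          have "(\<rho> / r) powr l \<le> (R / r) powr l"
            using 3 x l \<rho> by (intro powr_mono2) (auto simp: divide_right_mono)
          then show "real (card (F z)) \<le> C * (R / r) powr l"
            using F(3)[OF \<open>z \<in> Z\<close>] \<open>C > 0\<close> by (meson mult_left_mono order_trans less_imp_le)
        qed
        also have "\<dots> = (real (card Z) * C) * (R / r) powr l" by simp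
        also have "\<dots> \<le> C' * (R / r) powr l" using C' by (intro mult_right_mono) auto
        finally have "real (card (\<Union>z\<in>Z. F z)) \<le> C' * (R / r) powr l" .
        moreover have "finite (\<Union>z\<in>Z. F z)" using Z(1) F(1) by blast
        ultimately show ?thesis using cov by blast
      qed
    qed
  qed
qed

lemma exists_near_point:
  assumes "E \<noteq> {}" "infdist y E < r"
  shows "\<exists>z\<in>E. dist y z < r"
  using assms by (auto simp: infdist_def cINF_less_iff)

text \<open>
  A point at distance less than \<open>r\<close> from \<open>E\<close> is within \<open>2r\<close> of the centre of some covering ball.
\<close>

lemma tube_volume:
  fixes E :: "'a::euclidean_space set"
  assumes "E \<noteq> {}" "0 < r" "r \<le> R" "finite F" and cov: "E \<inter> ball x (2 * R) \<subseteq> (\<Union>y\<in>F. ball y r)"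
  shows "emeasure lborel {y \<in> cball x R. infdist y E < r}
    \<le> ennreal (real (card F) * (unit_ball_vol (real DIM('a)) * (2 * r) powr DIM('a)))"
proof -
  have "{y \<in> cball x R. infdist y E < r} \<subseteq> (\<Union>z\<in>F. ball z (2 * r))"
  proof
    fix y assume y: "y \<in> {y \<in> cball x R. infdist y E < r}"
    then obtain w where w: "w \<in> E" "dist y w < r" using exists_near_point[OF assms(1)] by blast
    then have "w \<in> ball x (2 * R)" using y assms(3) dist_triangle[of x w y] by simp
    then obtain z where z: "z \<in> F" "dist z w < r" using cov w by auto
    then have "dist z y < 2 * r" using w dist_triangle[of z y w] by (simp add: dist_commute)
    then show "y \<in> (\<Union>z\<in>F. ball z (2 * r))" using z by auto
  qed
  then have "emeasure lborel {y \<in> cball x R. infdist y E < r} \<le> emeasure lborel (\<Union>z\<in>F. ball z (2 * r))"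
    by (intro emeasure_mono) (auto intro!: borel_open)
  also have "\<dots> \<le> (\<Sum>z\<in>F. emeasure lborel (ball z (2 * r)))"
    using assms by (intro emeasure_subadditive_finite) auto
  also have "\<dots> = ennreal (real (card F) * (unit_ball_vol (real DIM('a)) * (2 * r) powr DIM('a)))"
    using assms(2) by (simp add: emeasure_ball powr_realpow ennreal_mult ennreal_of_nat_eq_real_of_nat)
  finally show ?thesis .
qed

text \<open>
  The tube of width \<open>r\<close> inside a ball of radius \<open>R\<close> has volume at most a multiple of
  \<open>(R/r)^l r^n\<close> with \<open>l < d\<close>, so its contribution \<open>(R/r)^l r^d\<close> decays geometrically along
  \<open>r = 2R/2^j\<close>. On \<open>E\<close> itself the weight is infinite, but there all terms of the series are
  bounded below, so the series diverges and dominates the weight there as well.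
\<close>

lemma weight_growth_of_assouad_dim:
  fixes E :: "'a::euclidean_space set"
  assumes "closed E" "E \<noteq> {}" and dim: "assouad_dim E < ereal d" and d: "d < DIM('a)"
  obtains K where "K > 0" "\<And>x R. x \<in> E \<Longrightarrow> R > 0 \<Longrightarrow>
    (\<integral>\<^sup>+y\<in>cball x R. epowr (ennreal (infdist y E)) (d - DIM('a)) \<partial>lborel) \<le> ennreal (K * R powr d)"
proof -
  define n where "n = real DIM('a)"
  define \<omega> where "\<omega> = unit_ball_vol n"
  have \<omega>: "\<omega> > 0" by (simp add: \<omega>_def n_def)
  define W where "W = (\<lambda>y. epowr (ennreal (infdist y E)) (d - n))"
  have dn: "d - n < 0" using d by (simp add: n_def)
  obtain l C where l: "0 \<le> l" "l < d" and "C > 0" and C: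
    "\<And>x r R. x \<in> E \<Longrightarrow> 0 < r \<Longrightarrow> r < R \<Longrightarrow>
      \<exists>F. finite F \<and> E \<inter> ball x R \<subseteq> (\<Union>y\<in>F. ball y r) \<and> real (card F) \<le> C * (R / r) powr l"
    using covers_at_all_scales[OF \<open>closed E\<close> dim] by metis
  define \<theta> where "\<theta> = 2 powr (- (d - l))"
  have \<theta>: "0 < \<theta>" "\<theta> < 1" using l powr_less_mono[of "- (d - l)" 0 2] by (auto simp: \<theta>_def)
  define c where "c = 2 powr (n - d) * (C * 2 powr l * (\<omega> * 2 powr n)) * 2 powr d"
  have c: "c > 0" using \<omega> \<open>C > 0\<close> by (simp add: c_def)
  show thesis
  proof (rule that)
    show "c / (1 - \<theta>) > 0" using c \<theta> by simp
    fix x R assume x: "x \<in> E" "(R::real) > 0"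
    \<comment> \<open>Starting at \<open>2R\<close> and not at \<open>R\<close> puts points of the closed ball at distance exactly \<open>R\<close> into the first tube.\<close>
    define r where "r = (\<lambda>j. 2 * R / 2 ^ j)"
    have r: "r j > 0" "r j \<le> 2 * R" "r (Suc j) = r j / 2" for j
      using x divide_left_mono[of 1 "2 ^ j" "2 * R"] by (auto simp: r_def two_realpow_ge_one)
    define V where "V = (\<lambda>j. {y \<in> cball x (2 * R). infdist y E < r j})"
    have [measurable]: "V j \<in> sets borel" for j
      unfolding V_def by measurable
    have Vle: "ennreal (r (Suc j) powr (d - n)) * emeasure lborel (V j) \<le> ennreal (c * R powr d * \<theta> ^ j)" for j
    proof -
      have "r j < 2 * (2 * R)" using r(2)[of j] x by simp
      then obtain F where F: "finite F" "E \<inter> ball x (2 * (2 * R)) \<subseteq> (\<Union>y\<in>F. ball y (r j))"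
          "real (card F) \<le> C * (2 * (2 * R) / r j) powr l"
        using C[OF x(1) r(1)] by blast
      have "emeasure lborel (V j) \<le> ennreal (real (card F) * (\<omega> * (2 * r j) powr n))"
        unfolding V_def \<omega>_def n_def by (rule tube_volume[OF \<open>E \<noteq> {}\<close> r(1,2) F(1,2)])
      also have "\<dots> \<le> ennreal (C * (2 * (2 * R) / r j) powr l * (\<omega> * (2 * r j) powr n))"
        using F(3) \<omega> by (intro ennreal_leI mult_right_mono) auto
      finally have "ennreal (r (Suc j) powr (d - n)) * emeasure lborel (V j)
          \<le> ennreal (r (Suc j) powr (d - n)) * ennreal (C * (2 * (2 * R) / r j) powr l * (\<omega> * (2 * r j) powr n))"
        by (intro mult_left_mono) auto
      also have "\<dots> = ennreal (r (Suc j) powr (d - n) * (C * (2 * (2 * R) / r j) powr l * (\<omega> * (2 * r j) powr n)))"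
        using \<open>C > 0\<close> \<omega> by (intro ennreal_mult[symmetric]) auto
      also have "r (Suc j) powr (d - n) * (C * (2 * (2 * R) / r j) powr l * (\<omega> * (2 * r j) powr n)) = c * R powr d * \<theta> ^ j"
      proof -
        have 1: "r (Suc j) powr (d - n) = r j powr (d - n) * 2 powr (n - d)"
          unfolding r(3) by (simp add: powr_divide powr_diff)
        have "2 * (2 * R) / r j = 2 * 2 powr real j"
          using x by (simp add: r_def powr_realpow)
        then have 2: "(2 * (2 * R) / r j) powr l = 2 powr l * 2 powr (real j * l)"
          by (simp add: powr_mult powr_powr)
        have "r j = 2 * R * 2 powr (- real j)"
          by (simp add: r_def powr_minus powr_realpow divide_inverse)
        then have 3: "r j powr d = 2 powr d * R powr d * 2 powr (- real j * d)"
          using x by (simp add: powr_mult powr_powr)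
        have 4: "r j powr (d - n) * r j powr n = r j powr d" by (simp add: powr_add[symmetric])
        have "\<theta> ^ j = \<theta> powr real j" using \<theta> by (simp add: powr_realpow)
        then have 5: "\<theta> ^ j = 2 powr (- real j * d) * 2 powr (real j * l)"
          by (simp add: \<theta>_def powr_powr powr_add[symmetric] algebra_simps)
        have "r (Suc j) powr (d - n) * (C * (2 * (2 * R) / r j) powr l * (\<omega> * (2 * r j) powr n))
          = 2 powr (n - d) * (C * 2 powr l * (\<omega> * 2 powr n)) * (r j powr (d - n) * r j powr n) * 2 powr (real j * l)"
          unfolding 1 2 using r(1)[of j] by (simp add: powr_mult mult_ac)
        also have "\<dots> = c * R powr d * \<theta> ^ j"
          unfolding 4 3 5 by (simp add: c_def mult_ac)
        finally show ?thesis .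
      qed
      finally show ?thesis .
    qed
    have pt: "W y * indicator (cball x R) y \<le> (\<Sum>j. ennreal (r (Suc j) powr (d - n)) * indicator (V j) y)" for y
    proof (cases "y \<in> cball x R")
      case True
      then have dR: "infdist y E \<le> R" using infdist_le[OF x(1), of y] by (simp add: dist_commute)
      have y2: "y \<in> cball x (2 * R)" using True x by simp
      show ?thesis
      proof (cases "infdist y E = 0")
        case True
        have inV: "y \<in> V j" for j using True y2 r(1)[of j] by (simp add: V_def)
        have "(\<Sum>j. ennreal (r (Suc j) powr (d - n)) * indicator (V j) y) \<ge> (\<Sum>j. ennreal (R powr (d - n)))"
        proof (intro suminf_le)
          fix j
          have "r (Suc j) \<le> R" using r(2)[of j] r(3)[of j] by simp
          then have "R powr (d - n) \<le> r (Suc j) powr (d - n)"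
            using r(1) dn by (intro powr_mono2') auto
          then show "ennreal (R powr (d - n)) \<le> ennreal (r (Suc j) powr (d - n)) * indicator (V j) y"
            using inV by (simp add: ennreal_leI)
        qed auto
        moreover have "(\<Sum>j::nat. ennreal (R powr (d - n))) = \<infinity>"
        proof (rule ccontr)
          assume "\<not> ?thesis"
          then have "summable (\<lambda>j::nat. R powr (d - n))"
            by (intro summable_suminf_not_top) (simp_all add: infinity_ennreal_def)
          then show False using x by (simp only: summable_const_iff) simp
        qed
        ultimately show ?thesis by (simp add: top_unique)
      next
        case False
        then have pos: "infdist y E > 0" using infdist_nonneg[of y E] by linarith
        define P where "P = (\<lambda>j. r j \<le> infdist y E)"
        have "\<exists>j. P j"
        proof -
          obtain j where "2 * R / infdist y E < 2 ^ j" using real_arch_pow[of 2] by auto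
          then have "P j" using pos by (simp add: P_def r_def field_simps)
          then show ?thesis ..
        qed
        then have "P (LEAST j. P j)" by (metis LeastI)
        moreover have "\<not> P 0" using dR x by (simp add: P_def r_def)
        ultimately obtain j where j: "(LEAST j. P j) = Suc j" "P (Suc j)" by (metis not0_implies_Suc)
        then have "\<not> P j" using not_less_Least[of j P] by simp
        then have "y \<in> V j" using y2 by (simp add: V_def P_def)
        have "infdist y E powr (d - n) \<le> r (Suc j) powr (d - n)"
          using j(2) r(1)[of "Suc j"] dn by (intro powr_mono2') (auto simp: P_def)
        then have "W y \<le> ennreal (r (Suc j) powr (d - n)) * indicator (V j) y"
          using \<open>y \<in> V j\<close> pos by (simp add: W_def epowr_ennreal ennreal_leI)
        also have "\<dots> \<le> (\<Sum>j. ennreal (r (Suc j) powr (d - n)) * indicator (V j) y)"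
        proof -
          define h where "h = (\<lambda>j. ennreal (r (Suc j) powr (d - n)) * indicator (V j) y)"
          have "h j \<le> suminf h" using sum_le_suminf[of h "{j}"] by simp
          then show ?thesis by (simp only: h_def)
        qed
        finally show ?thesis using \<open>y \<in> cball x R\<close> by simp
      qed
    qed simp
    have "(\<integral>\<^sup>+y\<in>cball x R. W y \<partial>lborel) \<le> (\<integral>\<^sup>+y. (\<Sum>j. ennreal (r (Suc j) powr (d - n)) * indicator (V j) y) \<partial>lborel)"
      by (intro nn_integral_mono pt)
    also have "\<dots> = (\<Sum>j. ennreal (r (Suc j) powr (d - n)) * emeasure lborel (V j))"
      by (subst nn_integral_suminf) (auto simp: nn_integral_cmult_indicator)
    also have "\<dots> \<le> (\<Sum>j. ennreal (c * R powr d * \<theta> ^ j))"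
      by (intro suminf_le Vle) auto
    also have "\<dots> = ennreal (\<Sum>j. c * R powr d * \<theta> ^ j)"
      using c \<theta> by (intro suminf_ennreal2 summable_mult summable_geometric) auto
    also have "(\<Sum>j. c * R powr d * \<theta> ^ j) = c / (1 - \<theta>) * R powr d"
      using \<theta> by (simp add: suminf_mult summable_geometric suminf_geometric)
    finally show "(\<integral>\<^sup>+y\<in>cball x R. epowr (ennreal (infdist y E)) (d - DIM('a)) \<partial>lborel)
        \<le> ennreal (c / (1 - \<theta>) * R powr d)"
      by (simp add: W_def n_def)
  qed
qed

text \<open>
  In terms of \<open>D = \<delta>\<^sub>E(x)\<close>: if \<open>D < 10r\<close>, the ball lies in a comparable ball centred on \<open>E\<close>, where the
  growth condition applies, and both sides scale like \<open>r^d\<close>. If \<open>D \<ge> 10r\<close>, the weight is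
  comparable to \<open>D^(d-n)\<close> on the ball, and the quotient of the two sides is a power of \<open>r/D\<close>
  whose exponent is nonnegative because \<open>d < n\<close>.
\<close>

lemma weighted_ball_bound:
  fixes E :: "'a::euclidean_space set" and p q n K0 :: real
  defines "n \<equiv> real DIM('a)"
  defines "d \<equiv> q / p * (n - p)"
  defines "Q \<equiv> q / (1 + q * (1 - 1 / p))"
  defines "W \<equiv> \<lambda>y. epowr (ennreal (infdist y E)) (d - n)"
  assumes "E \<noteq> {}" and pq: "1 \<le> p" "p \<le> q" "p < n" and "d < n" "K0 > 0"
    and growth: "\<And>x R. x \<in> E \<Longrightarrow> R > 0 \<Longrightarrow> (\<integral>\<^sup>+y\<in>cball x R. W y \<partial>lborel) \<le> ennreal (K0 * R powr d)"
  obtains K where "K > 0" "\<And>x r. r > 0 \<Longrightarrow> emeasure (density lborel W) (cball x (5 * r))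
      \<le> ennreal ((K * (measure lborel (cball x r) / r * (infdist x E + r) powr (- ((n - d) * (1 - 1 / p))))) powr Q)"
proof -
  define a where "a = 1 - 1 / p"
  define \<alpha> where "\<alpha> = (n - d) * a"
  define e where "e = (n - d) * Q / q"
  define \<omega> where "\<omega> = unit_ball_vol n"
  have \<omega>: "\<omega> > 0" by (simp add: \<omega>_def n_def)
  have a: "a \<ge> 0" using pq by (simp add: a_def)
  have \<alpha>: "\<alpha> \<ge> 0" using a \<open>d < n\<close> by (simp add: \<alpha>_def)
  have q: "q > 0" using pq by simp
  have den: "1 + q * a > 0" using a q by (simp add: add_pos_nonneg)
  have Q: "Q > 0" using den q by (simp add: Q_def a_def[symmetric])
  have e: "e \<ge> 0" using Q q \<open>d < n\<close> by (simp add: e_def)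
  have "d > 0" using pq by (simp add: d_def)
  have dQ: "(1 / q + a) * Q = 1"
  proof -
    have "1 / q + a = (1 + q * a) / q" using q by (simp add: field_simps)
    then show ?thesis using den q by (simp add: Q_def a_def[symmetric])
  qed
  have E1: "(n - 1 - \<alpha>) * Q = d"
  proof -
    have "d / q = n / p - 1" using q pq by (simp add: d_def field_simps)
    moreover have "n - 1 - \<alpha> = n / p - 1 + d * a"
      by (simp add: \<alpha>_def a_def algebra_simps diff_divide_distrib)
    ultimately have "n - 1 - \<alpha> = d * (1 / q + a)" by (simp add: algebra_simps)
    then show ?thesis using dQ by (simp add: mult.assoc)
  qed
  have E2: "\<alpha> * Q = n - d - e"
  proof -
    have "a * Q = 1 - Q / q" using dQ by (simp add: algebra_simps)
    then have "\<alpha> * Q = (n - d) * (1 - Q / q)" by (simp add: \<alpha>_def mult.assoc)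
    then show ?thesis by (simp add: e_def algebra_simps)
  qed
  have E3: "(n - 1) * Q = n - e" using E1 E2 by (simp add: algebra_simps)
  \<comment> \<open>The two summands are the constants of the two cases below.\<close>
  define X where "X = K0 * 15 powr d + \<omega> * 5 powr n * 2 powr (n - d)"
  have X: "X > 0" using \<open>K0 > 0\<close> \<omega> by (simp add: X_def add_pos_pos)
  define K where "K = 11 powr \<alpha> / \<omega> * X powr (1 / Q)"
  have [measurable]: "W \<in> borel_measurable borel" unfolding W_def by measurable
  show thesis
  proof (rule that)
    show "K > 0" using X \<omega> by (simp add: K_def)
    fix x :: 'a and r :: real assume r: "r > 0"
    have [measurable]: "cball x (5 * r) \<in> sets borel" by auto
    define D where "D = infdist x E"
    have "D \<ge> 0" by (simp add: D_def infdist_nonneg)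
    have T: "(K * (measure lborel (cball x r) / r * (D + r) powr (- \<alpha>))) powr Q
        = X * (r powr (n - 1) * (11 powr \<alpha> * (D + r) powr (- \<alpha>))) powr Q"
    proof -
      have "measure lborel (cball x r) / r = \<omega> * r powr (n - 1)"
        using r by (simp add: content_cball \<omega>_def n_def powr_realpow powr_diff)
      then have "K * (measure lborel (cball x r) / r * (D + r) powr (- \<alpha>))
          = X powr (1 / Q) * (r powr (n - 1) * (11 powr \<alpha> * (D + r) powr (- \<alpha>)))"
        using \<omega> by (simp add: K_def)
      then show ?thesis using X Q by (simp only: powr_mult) (simp add: powr_powr)
    qed
    have dens: "emeasure (density lborel W) (cball x (5 * r)) = (\<integral>\<^sup>+y\<in>cball x (5 * r). W y \<partial>lborel)"
      by (simp add: emeasure_density)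
    \<comment> \<open>Used with \<open>s = r\<close> near \<open>E\<close> and with \<open>s = D\<close> far from \<open>E\<close>.\<close>
    have cmp: "s powr (- \<alpha>) \<le> 11 powr \<alpha> * (D + r) powr (- \<alpha>)" if "s > 0" "D + r \<le> 11 * s" for s
    proof -
      have "11 powr \<alpha> * (11 * s) powr (- \<alpha>) \<le> 11 powr \<alpha> * (D + r) powr (- \<alpha>)"
        using that \<alpha> r \<open>D \<ge> 0\<close> by (intro mult_left_mono powr_mono2') auto
      moreover have "11 powr \<alpha> * (11 * s) powr (- \<alpha>) = s powr (- \<alpha>)"
        using that by (simp only: powr_mult) (simp add: powr_minus)
      ultimately show ?thesis by simp
    qed
    have main: "emeasure (density lborel W) (cball x (5 * r))
        \<le> ennreal ((K * (measure lborel (cball x r) / r * (D + r) powr (- \<alpha>))) powr Q)"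
    proof (cases "D < 10 * r")
      case True
      then obtain z where z: "z \<in> E" "dist x z < 10 * r"
        using exists_near_point[OF \<open>E \<noteq> {}\<close>] unfolding D_def by blast
      have sub: "cball x (5 * r) \<subseteq> cball z (15 * r)"
      proof
        fix y assume "y \<in> cball x (5 * r)"
        then show "y \<in> cball z (15 * r)" using z(2) dist_triangle[of z y x] by (simp add: dist_commute)
      qed
      have "emeasure (density lborel W) (cball x (5 * r)) \<le> (\<integral>\<^sup>+y\<in>cball z (15 * r). W y \<partial>lborel)"
        unfolding dens using sub by (intro nn_integral_mono) (auto simp: indicator_def)
      also have "\<dots> \<le> ennreal (K0 * (15 * r) powr d)" using growth[OF z(1)] r by simp
      also have "\<dots> \<le> ennreal (X * r powr d)"
        using r \<omega> by (intro ennreal_leI) (simp add: X_def powr_mult algebra_simps)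
      also have "\<dots> = ennreal (X * (r powr (n - 1) * r powr (- \<alpha>)) powr Q)"
        using E1 by (simp add: powr_add[symmetric] powr_powr)
      also have "\<dots> \<le> ennreal (X * (r powr (n - 1) * (11 powr \<alpha> * (D + r) powr (- \<alpha>))) powr Q)"
        using X Q r True cmp[of r] by (intro ennreal_leI mult_left_mono powr_mono2) auto
      finally show ?thesis by (simp only: T)
    next
      case False
      then have D: "D > 0" "10 * r \<le> D" using r by auto
      have Wle: "W y \<le> ennreal ((D / 2) powr (d - n))" if "y \<in> cball x (5 * r)" for y
      proof -
        have "D \<le> infdist y E + dist x y"
          unfolding D_def by (rule infdist_triangle)
        then have "D / 2 \<le> infdist y E" using that D by simp
        then have "infdist y E powr (d - n) \<le> (D / 2) powr (d - n)" "infdist y E > 0"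
          using D \<open>d < n\<close> by (auto intro!: powr_mono2')
        then show ?thesis by (simp add: W_def epowr_ennreal ennreal_leI)
      qed
      have "emeasure (density lborel W) (cball x (5 * r))
        \<le> (\<integral>\<^sup>+y. ennreal ((D / 2) powr (d - n)) * indicator (cball x (5 * r)) y \<partial>lborel)"
        unfolding dens using Wle by (intro nn_integral_mono) (auto simp: indicator_def)
      also have "\<dots> = ennreal ((D / 2) powr (d - n) * (\<omega> * (5 * r) powr n))"
        using r \<omega> by (simp add: nn_integral_cmult_indicator emeasure_cball \<omega>_def n_def powr_realpow ennreal_mult)
      also have "(D / 2) powr (d - n) * (\<omega> * (5 * r) powr n) = (\<omega> * 5 powr n * 2 powr (n - d)) * (r powr n * D powr (d - n))"
        using r D by (simp only: powr_divide powr_mult powr_diff) (simp add: field_simps)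
      also have "ennreal \<dots> \<le> ennreal (X * (r powr n * D powr (d - n)))"
        using \<open>K0 > 0\<close> by (intro ennreal_leI mult_right_mono) (auto simp: X_def)
      also have "\<dots> \<le> ennreal (X * (r powr (n - 1) * D powr (- \<alpha>)) powr Q)"
      proof (intro ennreal_leI mult_left_mono)
        have "1 \<le> (D / r) powr e" using D r e by (intro ge_one_powr_ge_zero) auto
        then have "r powr n * D powr (d - n) * 1 \<le> r powr n * D powr (d - n) * (D / r) powr e"
          by (intro mult_left_mono) auto
        also have "\<dots> = r powr (n - e) * D powr (d - n + e)"
          using D r by (simp add: powr_divide powr_add powr_diff mult_ac)
        also have "\<dots> = (r powr (n - 1) * D powr (- \<alpha>)) powr Q"
        proof -
          have "d - n + e = - \<alpha> * Q" using E2 by simp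
          then show ?thesis using E3 by (simp add: powr_mult powr_powr)
        qed
        finally show "r powr n * D powr (d - n) \<le> (r powr (n - 1) * D powr (- \<alpha>)) powr Q" by simp
      qed (use X in auto)
      also have "\<dots> \<le> ennreal (X * (r powr (n - 1) * (11 powr \<alpha> * (D + r) powr (- \<alpha>))) powr Q)"
        using X Q D cmp[of D] by (intro ennreal_leI mult_left_mono powr_mono2) auto
      finally show ?thesis by (simp only: T)
    qed
    then show "emeasure (density lborel W) (cball x (5 * r))
      \<le> ennreal ((K * (measure lborel (cball x r) / r * (infdist x E + r) powr (- ((n - d) * (1 - 1 / p))))) powr Q)"
      unfolding D_def \<alpha>_def a_def .
  qed
qed

section \<open>From level sets to norms\<close>

lemma mult_liminf_ennreal:
  fixes X :: "nat \<Rightarrow> ennreal"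
  shows "ennreal c * liminf X = liminf (\<lambda>k. ennreal c * X k)"
  by (rule Liminf_compose_continuous_mono[symmetric])
     (auto intro!: ennreal_continuous_on_cmult continuous_on_id monoI mult_left_mono)

text \<open>
  This replaces the coarea formula: a point \<open>y\<close> lies in the strip of level \<open>t\<close> and width \<open>h\<close> only
  for \<open>t\<close> in an interval of length \<open>h\<close> below \<open>|f y|\<close>, and the strip integral carries the factor \<open>1/h\<close>.
\<close>

lemma strip_integrals_Fatou:
  fixes f w :: "'a::euclidean_space \<Rightarrow> real" and g :: "'a \<Rightarrow> 'a" and \<gamma> :: real
  assumes [measurable]: "f \<in> borel_measurable borel" "g \<in> borel_measurable borel" "w \<in> borel_measurable borel"
    and w: "\<And>y. w y \<ge> 0" and "\<gamma> \<ge> 1"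
  defines "J \<equiv> \<lambda>k t. \<integral>\<^sup>+y. ennreal (norm (g y) * w y * real (Suc k)) *
       indicator {y. t < \<bar>f y\<bar> \<and> \<bar>f y\<bar> < t + 1 / real (Suc k)} y \<partial>lborel"
  shows "(\<integral>\<^sup>+t. ennreal (t powr (\<gamma> - 1) * indicator {0<..} t) * liminf (\<lambda>k. J k t) \<partial>lborel)
    \<le> (\<integral>\<^sup>+y. ennreal (norm (g y) * \<bar>f y\<bar> powr (\<gamma> - 1) * w y) \<partial>lborel)"
proof -
  define \<theta> where "\<theta> = (\<lambda>t::real. t powr (\<gamma> - 1) * indicator {0<..} t)"
  have [measurable]: "\<theta> \<in> borel_measurable borel" unfolding \<theta>_def by measurable
  have Jm [measurable]: "J k \<in> borel_measurable borel" for k unfolding J_def by measurable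
  have "(\<integral>\<^sup>+t. ennreal (\<theta> t) * liminf (\<lambda>k. J k t) \<partial>lborel) = (\<integral>\<^sup>+t. liminf (\<lambda>k. ennreal (\<theta> t) * J k t) \<partial>lborel)"
    by (simp only: mult_liminf_ennreal)
  also have "\<dots> \<le> liminf (\<lambda>k. \<integral>\<^sup>+t. ennreal (\<theta> t) * J k t \<partial>lborel)"
    by (intro nn_integral_liminf) measurable
  also have "\<dots> \<le> liminf (\<lambda>k. \<integral>\<^sup>+y. ennreal (norm (g y) * \<bar>f y\<bar> powr (\<gamma> - 1) * w y) \<partial>lborel)"
  proof (intro Liminf_mono always_eventually allI)
    fix k
    define h where "h = 1 / real (Suc k)"
    have h: "h > 0" "real (Suc k) * h = 1" by (auto simp: h_def)
    have "(\<integral>\<^sup>+t. ennreal (\<theta> t) * J k t \<partial>lborel)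
      = (\<integral>\<^sup>+t. (\<integral>\<^sup>+y. ennreal (\<theta> t) * (ennreal (norm (g y) * w y * real (Suc k)) *
         indicator {y. t < \<bar>f y\<bar> \<and> \<bar>f y\<bar> < t + h} y) \<partial>lborel) \<partial>lborel)"
      unfolding J_def h_def by (intro nn_integral_cong nn_integral_cmult[symmetric]) measurable
    also have "\<dots> = (\<integral>\<^sup>+y. (\<integral>\<^sup>+t. ennreal (\<theta> t) * (ennreal (norm (g y) * w y * real (Suc k)) *
         indicator {y. t < \<bar>f y\<bar> \<and> \<bar>f y\<bar> < t + h} y) \<partial>lborel) \<partial>lborel)"
      by (intro lborel_pair.Fubini') measurable
    also have "\<dots> \<le> (\<integral>\<^sup>+y. ennreal (norm (g y) * \<bar>f y\<bar> powr (\<gamma> - 1) * w y) \<partial>lborel)"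
    proof (intro nn_integral_mono)
      fix y
      have "(\<integral>\<^sup>+t. ennreal (\<theta> t) * (ennreal (norm (g y) * w y * real (Suc k)) *
           indicator {y. t < \<bar>f y\<bar> \<and> \<bar>f y\<bar> < t + h} y) \<partial>lborel)
        \<le> (\<integral>\<^sup>+t. ennreal (\<bar>f y\<bar> powr (\<gamma> - 1) * (norm (g y) * w y * real (Suc k))) * indicator {\<bar>f y\<bar> - h..\<bar>f y\<bar>} t \<partial>lborel)"
      proof (intro nn_integral_mono)
        fix t
        show "ennreal (\<theta> t) * (ennreal (norm (g y) * w y * real (Suc k)) *
           indicator {y. t < \<bar>f y\<bar> \<and> \<bar>f y\<bar> < t + h} y)
          \<le> ennreal (\<bar>f y\<bar> powr (\<gamma> - 1) * (norm (g y) * w y * real (Suc k))) * indicator {\<bar>f y\<bar> - h..\<bar>f y\<bar>} t"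
        proof (cases "0 < t \<and> t < \<bar>f y\<bar> \<and> \<bar>f y\<bar> < t + h")
          case True
          then have "\<theta> t \<le> \<bar>f y\<bar> powr (\<gamma> - 1)"
            using \<open>\<gamma> \<ge> 1\<close> by (auto simp: \<theta>_def intro!: powr_mono2)
          then have "\<theta> t * (norm (g y) * w y * real (Suc k)) \<le> \<bar>f y\<bar> powr (\<gamma> - 1) * (norm (g y) * w y * real (Suc k))"
            using w by (intro mult_right_mono) auto
          moreover have "t \<in> {\<bar>f y\<bar> - h..\<bar>f y\<bar>}" using True by simp
          moreover have "\<theta> t \<ge> 0" by (simp add: \<theta>_def)
          ultimately show ?thesis using w True
            by (simp add: ennreal_mult[symmetric] ennreal_leI del: of_nat_Suc)
        next
          case False
          then have "ennreal (\<theta> t) * (ennreal (norm (g y) * w y * real (Suc k)) *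
             indicator {y. t < \<bar>f y\<bar> \<and> \<bar>f y\<bar> < t + h} y) = 0"
            by (auto simp: \<theta>_def indicator_def)
          then show ?thesis by (simp only: zero_le)
        qed
      qed
      also have "\<dots> = ennreal (\<bar>f y\<bar> powr (\<gamma> - 1) * (norm (g y) * w y * real (Suc k))) * ennreal h"
        using h by (simp add: nn_integral_cmult_indicator)
      also have "\<dots> = ennreal (\<bar>f y\<bar> powr (\<gamma> - 1) * (norm (g y) * w y) * (real (Suc k) * h))"
        using h(1) w by (simp add: ennreal_mult[symmetric] mult.assoc del: of_nat_Suc)
      also have "\<dots> = ennreal (norm (g y) * \<bar>f y\<bar> powr (\<gamma> - 1) * w y)"
        unfolding h(2) by (simp add: mult_ac)
      finally show "(\<integral>\<^sup>+t. ennreal (\<theta> t) * (ennreal (norm (g y) * w y * real (Suc k)) *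
           indicator {y. t < \<bar>f y\<bar> \<and> \<bar>f y\<bar> < t + h} y) \<partial>lborel)
        \<le> ennreal (norm (g y) * \<bar>f y\<bar> powr (\<gamma> - 1) * w y)" .
    qed
    finally show "(\<integral>\<^sup>+t. ennreal (\<theta> t) * J k t \<partial>lborel)
      \<le> (\<integral>\<^sup>+y. ennreal (norm (g y) * \<bar>f y\<bar> powr (\<gamma> - 1) * w y) \<partial>lborel)" .
  qed
  also have "\<dots> = (\<integral>\<^sup>+y. ennreal (norm (g y) * \<bar>f y\<bar> powr (\<gamma> - 1) * w y) \<partial>lborel)"
    by (simp add: Liminf_const)
  finally show ?thesis by (simp add: \<theta>_def)
qed

text \<open>
  Bounding the integral from below on \<open>(s/2, s)\<close> loses a constant factor but avoids computing an
  antiderivative.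
\<close>

lemma powr_le_integral:
  fixes s q :: real
  assumes "s \<ge> 0" "q \<ge> 1"
  shows "ennreal (s powr q) \<le> ennreal (2 powr q) * (\<integral>\<^sup>+t. ennreal (t powr (q - 1)) * indicator {0<..<s} t \<partial>lborel)"
proof (cases "s = 0")
  case False
  then have s: "s > 0" using assms by simp
  have "ennreal ((s / 2) powr (q - 1) * (s / 2)) = (\<integral>\<^sup>+t. ennreal ((s / 2) powr (q - 1)) * indicator {s / 2<..<s} t \<partial>lborel)"
    using s by (simp add: nn_integral_cmult_indicator ennreal_mult[symmetric])
  also have "\<dots> \<le> (\<integral>\<^sup>+t. ennreal (t powr (q - 1)) * indicator {0<..<s} t \<partial>lborel)"
    using s assms by (intro nn_integral_mono) (auto simp: indicator_def intro!: ennreal_leI powr_mono2)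
  finally have "ennreal (2 powr q) * ennreal ((s / 2) powr (q - 1) * (s / 2))
      \<le> ennreal (2 powr q) * (\<integral>\<^sup>+t. ennreal (t powr (q - 1)) * indicator {0<..<s} t \<partial>lborel)"
    by (intro mult_left_mono) auto
  moreover have "2 powr q * ((s / 2) powr (q - 1) * (s / 2)) = s powr q"
  proof -
    have "(s / 2) powr (q - 1) * (s / 2) = (s / 2) powr q" using s by (simp add: powr_diff)
    then show ?thesis using s by (simp add: powr_divide)
  qed
  ultimately show ?thesis using s by (simp add: ennreal_mult[symmetric])
qed simp

lemma layer_cake_bound:
  fixes f :: "'a::euclidean_space \<Rightarrow> real"
  assumes [measurable]: "f \<in> borel_measurable borel" "W \<in> borel_measurable borel" and "q \<ge> 1"
  shows "(\<integral>\<^sup>+y. ennreal (\<bar>f y\<bar> powr q) * W y \<partial>lborel) \<le> ennreal (2 powr q) *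
    (\<integral>\<^sup>+t. ennreal (t powr (q - 1) * indicator {0<..} t) * emeasure (density lborel W) {y. t < \<bar>f y\<bar>} \<partial>lborel)"
proof -
  have "(\<integral>\<^sup>+y. ennreal (\<bar>f y\<bar> powr q) * W y \<partial>lborel)
    \<le> (\<integral>\<^sup>+y. ennreal (2 powr q) * ((\<integral>\<^sup>+t. ennreal (t powr (q - 1)) * indicator {0<..<\<bar>f y\<bar>} t \<partial>lborel) * W y) \<partial>lborel)"
    using powr_le_integral[OF abs_ge_zero \<open>q \<ge> 1\<close>] by (intro nn_integral_mono) (simp add: mult.assoc[symmetric] mult_right_mono)
  also have "\<dots> = ennreal (2 powr q) * (\<integral>\<^sup>+y. (\<integral>\<^sup>+t. ennreal (t powr (q - 1)) * indicator {0<..<\<bar>f y\<bar>} t \<partial>lborel) * W y \<partial>lborel)"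
    by (intro nn_integral_cmult) (simp add: indicator_def, measurable)
  also have "(\<integral>\<^sup>+y. (\<integral>\<^sup>+t. ennreal (t powr (q - 1)) * indicator {0<..<\<bar>f y\<bar>} t \<partial>lborel) * W y \<partial>lborel)
      = (\<integral>\<^sup>+y. (\<integral>\<^sup>+t. ennreal (t powr (q - 1) * indicator {0<..} t) * (W y * indicator {y. t < \<bar>f y\<bar>} y) \<partial>lborel) \<partial>lborel)"
  proof (intro nn_integral_cong)
    fix y
    have "(\<integral>\<^sup>+t. ennreal (t powr (q - 1)) * indicator {0<..<\<bar>f y\<bar>} t \<partial>lborel) * W y
      = (\<integral>\<^sup>+t. ennreal (t powr (q - 1)) * indicator {0<..<\<bar>f y\<bar>} t * W y \<partial>lborel)"
      by (intro nn_integral_multc[symmetric]) measurable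
    also have "\<dots> = (\<integral>\<^sup>+t. ennreal (t powr (q - 1) * indicator {0<..} t) * (W y * indicator {y. t < \<bar>f y\<bar>} y) \<partial>lborel)"
      by (intro nn_integral_cong) (auto simp: indicator_def)
    finally show "(\<integral>\<^sup>+t. ennreal (t powr (q - 1)) * indicator {0<..<\<bar>f y\<bar>} t \<partial>lborel) * W y
      = (\<integral>\<^sup>+t. ennreal (t powr (q - 1) * indicator {0<..} t) * (W y * indicator {y. t < \<bar>f y\<bar>} y) \<partial>lborel)" .
  qed
  also have "\<dots> = (\<integral>\<^sup>+t. (\<integral>\<^sup>+y. ennreal (t powr (q - 1) * indicator {0<..} t) * (W y * indicator {y. t < \<bar>f y\<bar>} y) \<partial>lborel) \<partial>lborel)"
    by (intro lborel_pair.Fubini'[symmetric]) measurable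
  also have "\<dots> = (\<integral>\<^sup>+t. ennreal (t powr (q - 1) * indicator {0<..} t) * emeasure (density lborel W) {y. t < \<bar>f y\<bar>} \<partial>lborel)"
    by (intro nn_integral_cong) (simp add: nn_integral_cmult emeasure_density)
  finally show ?thesis .
qed

text \<open>
  Since \<open>b\<close> is decreasing, \<open>t^\<gamma> b(t)\<close> is bounded by a multiple of the integral of
  \<open>s^(\<gamma>-1) b(s)\<close> over \<open>(0,t)\<close>, hence by a multiple of \<open>k\<close>. The integrand on the left is
  \<open>(t^\<gamma> b(t))^(Q-1)\<close> times the one in the hypothesis.
\<close>

lemma decreasing_powr_integral:
  fixes b :: "real \<Rightarrow> real"
  assumes [measurable]: "b \<in> borel_measurable borel" and b: "\<And>t. b t \<ge> 0" "\<And>s t. 0 < s \<Longrightarrow> s \<le> t \<Longrightarrow> b t \<le> b s"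
    and "\<gamma> \<ge> 1" "Q \<ge> 1" "k > 0"
    and int: "(\<integral>\<^sup>+t. ennreal (t powr (\<gamma> - 1) * indicator {0<..} t) * ennreal (b t) \<partial>lborel) \<le> ennreal k"
  shows "(\<integral>\<^sup>+t. ennreal (t powr (\<gamma> * Q - 1) * indicator {0<..} t) * ennreal (b t powr Q) \<partial>lborel)
    \<le> ennreal ((2 powr \<gamma> * k) powr (Q - 1) * k)"
proof -
  have key: "t powr \<gamma> * b t \<le> 2 powr \<gamma> * k" if "t > 0" for t
  proof -
    have "ennreal (t powr \<gamma>) * ennreal (b t) \<le> ennreal (2 powr \<gamma>) * (\<integral>\<^sup>+s. ennreal (s powr (\<gamma> - 1)) * indicator {0<..<t} s \<partial>lborel) * ennreal (b t)"
      using powr_le_integral[of t \<gamma>] that \<open>\<gamma> \<ge> 1\<close> by (intro mult_right_mono) auto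
    also have "\<dots> = ennreal (2 powr \<gamma>) * (\<integral>\<^sup>+s. ennreal (s powr (\<gamma> - 1)) * indicator {0<..<t} s * ennreal (b t) \<partial>lborel)"
      by (subst nn_integral_multc) (auto simp: mult.assoc)
    also have "\<dots> \<le> ennreal (2 powr \<gamma>) * (\<integral>\<^sup>+t. ennreal (t powr (\<gamma> - 1) * indicator {0<..} t) * ennreal (b t) \<partial>lborel)"
      using b(2) by (intro mult_left_mono nn_integral_mono) (auto simp: indicator_def intro!: mult_left_mono ennreal_leI)
    also have "\<dots> \<le> ennreal (2 powr \<gamma>) * ennreal k" by (intro mult_left_mono int) auto
    finally show ?thesis using \<open>k > 0\<close> b(1) by (simp add: ennreal_mult[symmetric] ennreal_le_iff)
  qed
  have pt: "t powr (\<gamma> * Q - 1) * b t powr Q \<le> (2 powr \<gamma> * k) powr (Q - 1) * (t powr (\<gamma> - 1) * b t)" if "t > 0" for t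
  proof (cases "b t = 0")
    case False
    then have bt: "b t > 0" using b(1)[of t] by simp
    have "t powr (\<gamma> * Q - 1) * b t powr Q = (t powr \<gamma> * b t) powr (Q - 1) * (t powr (\<gamma> - 1) * b t)"
    proof -
      have "(t powr \<gamma> * b t) powr (Q - 1) = t powr (\<gamma> * (Q - 1)) * b t powr (Q - 1)"
        using bt by (simp add: powr_mult powr_powr)
      moreover have "t powr (\<gamma> * Q - 1) = t powr (\<gamma> * (Q - 1)) * t powr (\<gamma> - 1)"
        by (simp add: powr_add[symmetric] algebra_simps)
      moreover have "b t powr Q = b t powr (Q - 1) * b t" using bt by (simp add: powr_diff)
      ultimately show ?thesis by simp
    qed
    also have "\<dots> \<le> (2 powr \<gamma> * k) powr (Q - 1) * (t powr (\<gamma> - 1) * b t)"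
      using key[OF that] bt \<open>Q \<ge> 1\<close> by (intro mult_right_mono powr_mono2) auto
    finally show ?thesis .
  qed (use \<open>Q \<ge> 1\<close> in simp)
  have "(\<integral>\<^sup>+t. ennreal (t powr (\<gamma> * Q - 1) * indicator {0<..} t) * ennreal (b t powr Q) \<partial>lborel)
    \<le> (\<integral>\<^sup>+t. ennreal ((2 powr \<gamma> * k) powr (Q - 1)) * (ennreal (t powr (\<gamma> - 1) * indicator {0<..} t) * ennreal (b t)) \<partial>lborel)"
    using pt b(1) by (intro nn_integral_mono) (auto simp: indicator_def ennreal_mult[symmetric] intro!: ennreal_leI)
  also have "\<dots> = ennreal ((2 powr \<gamma> * k) powr (Q - 1)) * (\<integral>\<^sup>+t. ennreal (t powr (\<gamma> - 1) * indicator {0<..} t) * ennreal (b t) \<partial>lborel)"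
    by (intro nn_integral_cmult) measurable
  also have "\<dots> \<le> ennreal ((2 powr \<gamma> * k) powr (Q - 1)) * ennreal k"
    by (intro mult_left_mono int) auto
  also have "\<dots> = ennreal ((2 powr \<gamma> * k) powr (Q - 1) * k)"
    using \<open>k > 0\<close> by (simp add: ennreal_mult)
  finally show ?thesis .
qed

text \<open>
  Here \<open>b(t)\<close> is the \<open>1/Q\<close>-th power of the mass of \<open>{|f| > t}\<close>. The boxing inequality bounds it by
  the lower limit of the strip integrals, and integration over \<open>t\<close> against \<open>t^(\<gamma>-1)\<close>, where strips
  become the integral \<open>j\<close>, leaves an estimate for a decreasing function of one variable.
\<close>

lemma level_sets_to_norm:
  fixes f w :: "'a::euclidean_space \<Rightarrow> real"
  assumes f: "\<And>x. (f has_derivative (\<lambda>v. g x \<bullet> v)) (at x)" and g: "continuous_on UNIV g"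
    and supp: "bounded {x. f x \<noteq> 0}" and "K > 0" "Q \<ge> 1" "\<gamma> \<ge> 1" "j > 0"
    and w [measurable]: "w \<in> borel_measurable borel" "W \<in> borel_measurable borel" and w0: "\<And>y. w y \<ge> 0"
    and \<Omega>: "\<And>x r. r > 0 \<Longrightarrow> \<Omega> x r \<ge> 0" "\<And>x r. r > 0 \<Longrightarrow> AE y in lborel. y \<in> cball x r \<longrightarrow> \<Omega> x r \<le> w y"
    and ball: "\<And>x r. r > 0 \<Longrightarrow> emeasure (density lborel W) (cball x (5 * r))
      \<le> ennreal ((K * (measure lborel (cball x r) / r * \<Omega> x r)) powr Q)"
    and fin: "\<And>t. t > 0 \<Longrightarrow> emeasure (density lborel W) {y. t < \<bar>f y\<bar>} < \<infinity>"
    and J: "(\<integral>\<^sup>+y. ennreal (norm (g y) * \<bar>f y\<bar> powr (\<gamma> - 1) * w y) \<partial>lborel) \<le> ennreal j"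
  shows "(\<integral>\<^sup>+y. ennreal (\<bar>f y\<bar> powr (\<gamma> * Q)) * W y \<partial>lborel)
    \<le> ennreal (4 powr (\<gamma> * Q) * (K * 2 ^ (2 * DIM('a) + 5) * j) powr Q)"
proof -
  define M where "M = density lborel W"
  define c where "c = K * 2 ^ (2 * DIM('a) + 5)"
  have c: "c > 0" using \<open>K > 0\<close> by (simp add: c_def)
  have fc: "continuous_on UNIV f"
    using f has_derivative_continuous by (metis continuous_at_imp_continuous_on)
  have [measurable]: "f \<in> borel_measurable borel" "g \<in> borel_measurable borel"
    using fc g by (auto intro: borel_measurable_continuous_onI)
  have setsM: "sets M = sets borel" by (simp add: M_def)
  define L where "L = (\<lambda>t. liminf (\<lambda>k. \<integral>\<^sup>+y. ennreal (norm (g y) * w y * real (Suc k)) *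
       indicator {y. t < \<bar>f y\<bar> \<and> \<bar>f y\<bar> < t + 1 / real (Suc k)} y \<partial>lborel))"
  have [measurable]: "L \<in> borel_measurable borel" unfolding L_def by measurable
  define b where "b = (\<lambda>t. if t > 0 then measure M {y. t < \<bar>f y\<bar>} powr (1 / Q) else 0)"
  have Mfin: "emeasure M {y. t < \<bar>f y\<bar>} = ennreal (measure M {y. t < \<bar>f y\<bar>})" if "t > 0" for t
    using fin[OF that] by (intro emeasure_eq_ennreal_measure) (auto simp: M_def)
  have bQ: "ennreal (b t powr Q) = emeasure M {y. t < \<bar>f y\<bar>}" if "t > 0" for t
    using that Mfin[OF that] \<open>Q \<ge> 1\<close> by (simp add: b_def powr_powr)
  have b0: "b t \<ge> 0" for t by (simp add: b_def)
  have bdec: "b t \<le> b s" if "0 < s" "s \<le> t" for s t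
  proof -
    have "{y. s < \<bar>f y\<bar>} \<in> sets M" unfolding setsM by measurable
    then have "measure M {y. t < \<bar>f y\<bar>} \<le> measure M {y. s < \<bar>f y\<bar>}"
      using that fin[OF that(1)] by (intro measure_mono_fmeasurable) (auto simp: fmeasurable_def M_def)
    then show ?thesis using that \<open>Q \<ge> 1\<close> by (auto simp: b_def intro!: powr_mono2)
  qed
  have [measurable]: "b \<in> borel_measurable borel"
  proof -
    have "b = (\<lambda>t. if t > 0 then enn2real (\<integral>\<^sup>+y. W y * indicator {y. t < \<bar>f y\<bar>} y \<partial>lborel) powr (1 / Q) else 0)"
      by (auto simp: b_def measure_def M_def emeasure_density)
    moreover have "(\<lambda>t. if t > 0 then enn2real (\<integral>\<^sup>+y. W y * indicator {y. t < \<bar>f y\<bar>} y \<partial>lborel) powr (1 / Q) else 0)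
        \<in> borel_measurable borel"
      by measurable
    ultimately show ?thesis by simp
  qed
  \<comment> \<open>Where \<open>L t\<close> is infinite there is nothing to prove, since \<open>c > 0\<close>.\<close>
  have bL: "ennreal (b t) \<le> ennreal c * L t" if "t > 0" for t
  proof (cases "L t")
    case (real l)
    have "emeasure M {x. t < \<bar>f x\<bar>} \<le> ennreal ((K * (2 ^ (2 * DIM('a) + 5) * l)) powr Q)"
      by (rule boxing_inequality[OF f g supp that \<open>K > 0\<close> \<open>Q \<ge> 1\<close> _ w(1) setsM \<Omega>])
         (use ball real in \<open>auto simp: M_def L_def\<close>)
    then have "measure M {x. t < \<bar>f x\<bar>} \<le> (c * l) powr Q"
      using Mfin[OF that] by (simp add: c_def mult.assoc)
    then have "b t \<le> ((c * l) powr Q) powr (1 / Q)"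
      using that \<open>Q \<ge> 1\<close> by (auto simp: b_def intro!: powr_mono2)
    also have "\<dots> = c * l" using c real \<open>Q \<ge> 1\<close> by (simp add: powr_powr)
    finally show ?thesis using c real by (simp add: ennreal_mult[symmetric] ennreal_leI)
  qed (use c in \<open>simp add: ennreal_mult_top\<close>)
  have "(\<integral>\<^sup>+t. ennreal (t powr (\<gamma> - 1) * indicator {0<..} t) * ennreal (b t) \<partial>lborel)
      \<le> (\<integral>\<^sup>+t. ennreal c * (ennreal (t powr (\<gamma> - 1) * indicator {0<..} t) * L t) \<partial>lborel)"
  proof (intro nn_integral_mono)
    fix t
    show "ennreal (t powr (\<gamma> - 1) * indicator {0<..} t) * ennreal (b t)
        \<le> ennreal c * (ennreal (t powr (\<gamma> - 1) * indicator {0<..} t) * L t)"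
      using mult_left_mono[OF bL, of t "ennreal (t powr (\<gamma> - 1))"]
      by (cases "t > 0") (auto simp: mult_ac)
  qed
  also have "\<dots> = ennreal c * (\<integral>\<^sup>+t. ennreal (t powr (\<gamma> - 1) * indicator {0<..} t) * L t \<partial>lborel)"
    by (intro nn_integral_cmult) measurable
  also have "\<dots> \<le> ennreal c * ennreal j"
    unfolding L_def using strip_integrals_Fatou[of f g w \<gamma>] w0 \<open>\<gamma> \<ge> 1\<close> J
    by (intro mult_left_mono order_trans[OF _ J]) auto
  also have "\<dots> = ennreal (c * j)" using c \<open>j > 0\<close> by (simp add: ennreal_mult)
  finally have int: "(\<integral>\<^sup>+t. ennreal (t powr (\<gamma> - 1) * indicator {0<..} t) * ennreal (b t) \<partial>lborel) \<le> ennreal (c * j)" .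
  have "1 * 1 \<le> \<gamma> * Q" using \<open>\<gamma> \<ge> 1\<close> \<open>Q \<ge> 1\<close> by (intro mult_mono) auto
  then have "(\<integral>\<^sup>+y. ennreal (\<bar>f y\<bar> powr (\<gamma> * Q)) * W y \<partial>lborel)
    \<le> ennreal (2 powr (\<gamma> * Q)) * (\<integral>\<^sup>+t. ennreal (t powr (\<gamma> * Q - 1) * indicator {0<..} t) * emeasure M {y. t < \<bar>f y\<bar>} \<partial>lborel)"
    unfolding M_def by (intro layer_cake_bound) auto
  also have "(\<integral>\<^sup>+t. ennreal (t powr (\<gamma> * Q - 1) * indicator {0<..} t) * emeasure M {y. t < \<bar>f y\<bar>} \<partial>lborel)
    = (\<integral>\<^sup>+t. ennreal (t powr (\<gamma> * Q - 1) * indicator {0<..} t) * ennreal (b t powr Q) \<partial>lborel)"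
    using bQ by (intro nn_integral_cong) (auto simp: indicator_def)
  also have "\<dots> \<le> ennreal ((2 powr \<gamma> * (c * j)) powr (Q - 1) * (c * j))"
    using c \<open>j > 0\<close> by (intro decreasing_powr_integral b0 bdec \<open>\<gamma> \<ge> 1\<close> \<open>Q \<ge> 1\<close> int) auto
  finally have "(\<integral>\<^sup>+y. ennreal (\<bar>f y\<bar> powr (\<gamma> * Q)) * W y \<partial>lborel)
    \<le> ennreal (2 powr (\<gamma> * Q)) * ennreal ((2 powr \<gamma> * (c * j)) powr (Q - 1) * (c * j))"
    by (simp add: mult_left_mono)
  also have "\<dots> = ennreal (2 powr (\<gamma> * Q) * ((2 powr \<gamma> * (c * j)) powr (Q - 1) * (c * j)))"
    using c \<open>j > 0\<close> by (intro ennreal_mult[symmetric]) auto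
  also have "\<dots> \<le> ennreal (4 powr (\<gamma> * Q) * (c * j) powr Q)"
  proof (intro ennreal_leI)
    have cj: "c * j > 0" using c \<open>j > 0\<close> by simp
    have "(2 powr \<gamma> * m) powr (Q - 1) * m = 2 powr (\<gamma> * (Q - 1)) * m powr Q" if "m > 0" for m
    proof -
      have "m powr Q = m powr (Q - 1) * m" using that by (simp add: powr_diff)
      moreover have "(2 powr \<gamma> * m) powr (Q - 1) = 2 powr (\<gamma> * (Q - 1)) * m powr (Q - 1)"
        using that by (simp add: powr_mult powr_powr)
      ultimately show ?thesis by simp
    qed
    from this[OF cj] have "(2 powr \<gamma> * (c * j)) powr (Q - 1) * (c * j) = 2 powr (\<gamma> * (Q - 1)) * (c * j) powr Q" .
    also have "\<dots> \<le> 2 powr (\<gamma> * Q) * (c * j) powr Q"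
      using \<open>\<gamma> \<ge> 1\<close> by (intro mult_right_mono powr_mono) (auto simp: algebra_simps)
    finally have "2 powr (\<gamma> * Q) * ((2 powr \<gamma> * (c * j)) powr (Q - 1) * (c * j))
        \<le> 2 powr (\<gamma> * Q) * (2 powr (\<gamma> * Q) * (c * j) powr Q)"
      by (intro mult_left_mono) auto
    also have "\<dots> = 4 powr (\<gamma> * Q) * (c * j) powr Q"
      by (simp add: powr_mult[symmetric] mult.assoc[symmetric])
    finally show "2 powr (\<gamma> * Q) * ((2 powr \<gamma> * (c * j)) powr (Q - 1) * (c * j)) \<le> 4 powr (\<gamma> * Q) * (c * j) powr Q" .
  qed
  finally show ?thesis by (simp add: c_def mult.assoc)
qed

section \<open>The Hardy--Sobolev inequality\<close>

text \<open>
  Hoelder's inequality with exponents \<open>p\<close> and \<open>1/(1 - 1/p)\<close>, in the form that also covers \<open>p = 1\<close>,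
  where the second exponent is infinite and the power of \<open>v\<close> is at most \<open>1\<close>. It follows from Young's
  inequality for \<open>(u/D)^p\<close> and \<open>v/i\<close>.
\<close>

lemma Hoelder_bound:
  fixes u v :: "'a::euclidean_space \<Rightarrow> real"
  assumes [measurable]: "u \<in> borel_measurable borel" "v \<in> borel_measurable borel"
    and uv: "\<And>y. u y \<ge> 0" "\<And>y. v y \<ge> 0" and "p \<ge> 1" "D > 0" "i > 0"
    and u: "(\<integral>\<^sup>+y. ennreal (u y powr p) \<partial>lborel) \<le> ennreal (D powr p)"
    and v: "(\<integral>\<^sup>+y. ennreal (v y) \<partial>lborel) \<le> ennreal i"
  shows "(\<integral>\<^sup>+y. ennreal (u y * v y powr (1 - 1 / p)) \<partial>lborel) \<le> ennreal (D * i powr (1 - 1 / p))"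
proof -
  define a where "a = 1 - 1 / p"
  have a: "a \<ge> 0" "1 / p + a = 1" using \<open>p \<ge> 1\<close> by (auto simp: a_def)
  have pt: "u y * v y powr a \<le> D * i powr a * (1 / p * (1 / D powr p) * u y powr p + a * (1 / i) * v y)" for y
  proof (cases "u y = 0 \<or> v y = 0")
    case True
    have "u y * v y powr a = 0" using True by auto
    moreover have "0 \<le> D * i powr a * (1 / p * (1 / D powr p) * u y powr p + a * (1 / i) * v y)"
      using uv[of y] a \<open>p \<ge> 1\<close> \<open>D > 0\<close> \<open>i > 0\<close> by (intro mult_nonneg_nonneg add_nonneg_nonneg) auto
    ultimately show ?thesis by linarith
  next
    case False
    then have pos: "u y > 0" "v y > 0" using uv[of y] by auto
    have "((u y / D) powr p) powr (1 / p) * (v y / i) powr a \<le> 1 / p * (u y / D) powr p + a * (v y / i)"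
      using a pos \<open>p \<ge> 1\<close> \<open>D > 0\<close> \<open>i > 0\<close> by (intro Youngs_inequality_0) auto
    also have "((u y / D) powr p) powr (1 / p) = u y / D"
      using \<open>p \<ge> 1\<close> pos \<open>D > 0\<close> by (simp add: powr_powr)
    finally have "u y / D * (v y / i) powr a \<le> 1 / p * (u y / D) powr p + a * (v y / i)" .
    then have "D * i powr a * (u y / D * (v y / i) powr a) \<le> D * i powr a * (1 / p * (u y / D) powr p + a * (v y / i))"
      using \<open>D > 0\<close> by (intro mult_left_mono) auto
    then show ?thesis using \<open>D > 0\<close> \<open>i > 0\<close> pos by (simp add: powr_divide)
  qed
  have "(\<integral>\<^sup>+y. ennreal (u y * v y powr a) \<partial>lborel)
    \<le> (\<integral>\<^sup>+y. ennreal (D * i powr a) * (ennreal (1 / p * (1 / D powr p)) * ennreal (u y powr p) + ennreal (a * (1 / i)) * ennreal (v y)) \<partial>lborel)"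
  proof (intro nn_integral_mono)
    fix y
    have "ennreal (D * i powr a) * (ennreal (1 / p * (1 / D powr p)) * ennreal (u y powr p) + ennreal (a * (1 / i)) * ennreal (v y))
      = ennreal (D * i powr a * (1 / p * (1 / D powr p) * u y powr p + a * (1 / i) * v y))"
      using uv[of y] a \<open>p \<ge> 1\<close> \<open>D > 0\<close> \<open>i > 0\<close>
      by (simp add: ennreal_mult[symmetric] ennreal_plus[symmetric] del: ennreal_plus)
    then show "ennreal (u y * v y powr a) \<le> ennreal (D * i powr a) * (ennreal (1 / p * (1 / D powr p)) * ennreal (u y powr p) + ennreal (a * (1 / i)) * ennreal (v y))"
      using pt[of y] by (simp add: ennreal_leI)
  qed
  also have "\<dots> = ennreal (D * i powr a) * (ennreal (1 / p * (1 / D powr p)) * (\<integral>\<^sup>+y. ennreal (u y powr p) \<partial>lborel)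
      + ennreal (a * (1 / i)) * (\<integral>\<^sup>+y. ennreal (v y) \<partial>lborel))"
    by (simp add: nn_integral_cmult nn_integral_add)
  also have "\<dots> \<le> ennreal (D * i powr a) * (ennreal (1 / p * (1 / D powr p)) * ennreal (D powr p) + ennreal (a * (1 / i)) * ennreal i)"
    by (intro mult_left_mono add_mono u v) auto
  also have "\<dots> = ennreal (D * i powr a * (1 / p * (1 / D powr p) * D powr p + a * (1 / i) * i))"
    using a \<open>p \<ge> 1\<close> \<open>D > 0\<close> \<open>i > 0\<close>
    by (simp add: ennreal_mult[symmetric] ennreal_plus[symmetric] del: ennreal_plus)
  also have "1 / p * (1 / D powr p) * D powr p + a * (1 / i) * i = 1"
    using a \<open>D > 0\<close> \<open>i > 0\<close> by simp
  finally show ?thesis by (simp add: a_def)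
qed

lemma C1_gradient:
  fixes f :: "'a::euclidean_space \<Rightarrow> real"
  assumes "Ck (Suc 0) f"
  shows "(f has_derivative (\<lambda>v. grad f x \<bullet> v)) (at x)" "continuous_on UNIV (grad f)"
proof -
  have D: "(f has_derivative frechet_derivative f (at x)) (at x)" for x
    using assms by (simp add: frechet_derivative_works)
  have "frechet_derivative f (at x) = (\<lambda>v. grad f x \<bullet> v)"
  proof
    fix v
    interpret linear "frechet_derivative f (at x)"
      using D has_derivative_linear by blast
    have "frechet_derivative f (at x) v = frechet_derivative f (at x) (\<Sum>b\<in>Basis. (v \<bullet> b) *\<^sub>R b)"
      by (simp add: euclidean_representation)
    also have "\<dots> = (\<Sum>b\<in>Basis. (v \<bullet> b) * frechet_derivative f (at x) b)"
      by (simp add: sum scale)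
    also have "\<dots> = grad f x \<bullet> v"
      by (simp add: grad_def inner_sum_right inner_commute[of _ v] mult.commute)
    finally show "frechet_derivative f (at x) v = grad f x \<bullet> v" .
  qed
  then show "(f has_derivative (\<lambda>v. grad f x \<bullet> v)) (at x)" using D[of x] by simp
  show "continuous_on UNIV (grad f)"
    unfolding grad_def[abs_def] using assms by (intro continuous_intros) auto
qed

text \<open>
  The exponents \<open>a\<close>, \<open>\<gamma>\<close>, \<open>Q\<close> and the weight \<open>w\<close> are chosen so that \<open>\<gamma>Q = q\<close> and the product
  \<open>|f|^(\<gamma>-1) w\<close> is exactly the \<open>a\<close>-th power of \<open>|f|^q W\<close>. Hoelder's inequality then bounds the
  linear gradient term by the quantity to be estimated, to the power \<open>a\<close>.
\<close>

lemma inequality_of_assouad_dim_less: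
  fixes E :: "'a::euclidean_space set" and p q n :: real
  defines "n \<equiv> real DIM('a)"
  assumes E: "E \<noteq> {}" "closed E" and pq: "1 \<le> p" "p \<le> q" "p < n" "q < n * p / (n - p)"
    and dim: "assouad_dim E < ereal (q / p * (n - p))"
  obtains C where "C > 0" "\<And>f :: 'a \<Rightarrow> real. test_function f \<Longrightarrow>
            epowr (\<integral>\<^sup>+x. epowr (ennreal \<bar>f x\<bar>) q
                      * epowr (ennreal (infdist x E)) (q / p * (n - p) - n) \<partial>lborel) (1 / q)
            \<le> ennreal C * epowr (\<integral>\<^sup>+x. epowr (ennreal (norm (grad f x))) p \<partial>lborel) (1 / p)"
proof -
  define d where "d = q / p * (n - p)"
  define a where "a = 1 - 1 / p"
  define \<gamma> where "\<gamma> = 1 + q * a"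
  define Q where "Q = q / \<gamma>"
  define \<alpha> where "\<alpha> = (n - d) * a"
  define W where "W = (\<lambda>y. epowr (ennreal (infdist y E)) (d - n))"
  define w where "w = (\<lambda>y. infdist y E powr (- \<alpha>))"
  define \<Omega> where "\<Omega> = (\<lambda>x r. (infdist x E + r) powr (- \<alpha>))"
  have q: "q > 0" "q \<ge> 1" using pq by auto
  have "q * (n - p) < n * p" using pq by (simp add: pos_less_divide_eq)
  then have "d < n" using pq by (simp add: d_def pos_divide_less_eq)
  have a: "0 \<le> a" using pq by (simp add: a_def)
  have "\<alpha> \<ge> 0" using a \<open>d < n\<close> by (simp add: \<alpha>_def)
  have "\<gamma> \<ge> 1" using a q by (simp add: \<gamma>_def)
  have "q / p \<ge> 1" using pq by simp
  then have "\<gamma> \<le> q" by (simp add: \<gamma>_def a_def algebra_simps)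
  then have "Q \<ge> 1" using \<open>\<gamma> \<ge> 1\<close> by (simp add: Q_def)
  have \<gamma>Q: "\<gamma> * Q = q" using \<open>\<gamma> \<ge> 1\<close> by (simp add: Q_def)
  have aQ: "a * Q = 1 - Q / q"
  proof -
    have "a * Q = (\<gamma> - 1) / \<gamma>" by (simp add: Q_def \<gamma>_def mult.commute)
    moreover have "Q / q = 1 / \<gamma>" using q by (simp add: Q_def)
    ultimately show ?thesis using \<open>\<gamma> \<ge> 1\<close> by (simp add: diff_divide_distrib)
  qed
  have [measurable]: "W \<in> borel_measurable borel" "w \<in> borel_measurable borel"
    unfolding W_def w_def by measurable
  have [measurable]: "cball c r \<in> sets borel" for c :: 'a and r by auto
  obtain K0 where K0: "K0 > 0" "\<And>x R. x \<in> E \<Longrightarrow> R > 0 \<Longrightarrow> (\<integral>\<^sup>+y\<in>cball x R. W y \<partial>lborel) \<le> ennreal (K0 * R powr d)"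
    using weight_growth_of_assouad_dim[OF E(2,1) dim[folded d_def]] \<open>d < n\<close>
    unfolding W_def n_def by metis
  obtain K where "K > 0" and K: "\<And>x r. r > 0 \<Longrightarrow> emeasure (density lborel W) (cball x (5 * r))
      \<le> ennreal ((K * (measure lborel (cball x r) / r * \<Omega> x r)) powr Q)"
  proof (rule weighted_ball_bound[of E p q K0])
    show "x \<in> E \<Longrightarrow> R > 0 \<Longrightarrow> (\<integral>\<^sup>+y\<in>cball x R. epowr (ennreal (infdist y E)) (q / p * (real DIM('a) - p) - real DIM('a)) \<partial>lborel)
        \<le> ennreal (K0 * R powr (q / p * (real DIM('a) - p)))" for x R
      using K0(2)[of x R] by (simp add: W_def d_def n_def)
  qed (use E pq K0 \<open>d < n\<close> in \<open>auto simp: d_def n_def W_def \<Omega>_def \<alpha>_def Q_def \<gamma>_def a_def\<close>)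
  obtain z where "z \<in> E" using E by blast
  have Wfin: "(\<integral>\<^sup>+y\<in>cball z R. W y \<partial>lborel) < \<infinity>" if "R > 0" for R
    using K0(2)[OF \<open>z \<in> E\<close> that] by (simp add: le_less_trans)
  \<comment> \<open>Local integrability of a weight that is infinite on \<open>E\<close> makes \<open>E\<close> a null set; real powers, which vanish on \<open>E\<close>, may therefore replace extended ones almost everywhere.\<close>
  have off: "AE y in lborel. infdist y E > 0"
  proof -
    have "AE y in lborel. W y * indicator (cball z (real (Suc m))) y \<noteq> \<infinity>" for m
    proof (rule nn_integral_PInf_AE)
      show "(\<integral>\<^sup>+y\<in>cball z (real (Suc m)). W y \<partial>lborel) \<noteq> \<infinity>"
        using Wfin[of "real (Suc m)"] by simp
    qed measurable
    then have "AE y in lborel. \<forall>m. W y * indicator (cball z (real (Suc m))) y \<noteq> \<infinity>"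
      by (simp add: AE_all_countable)
    then show ?thesis
    proof eventually_elim
      case (elim y)
      obtain m :: nat where "dist z y \<le> real m" using real_arch_simple by blast
      then have "y \<in> cball z (real (Suc m))" by simp
      then have "W y \<noteq> \<infinity>" using elim by (metis indicator_simps(1) mult.right_neutral)
      then have "infdist y E \<noteq> 0" using \<open>d < n\<close> by (auto simp: W_def epowr_def)
      then show ?case using infdist_nonneg[of y E] by linarith
    qed
  qed
  have \<Omega>w: "AE y in lborel. y \<in> cball x r \<longrightarrow> \<Omega> x r \<le> w y" for x r
    using off
  proof eventually_elim
    case (elim y)
    show ?case
    proof
      assume "y \<in> cball x r"
      then have "infdist y E \<le> infdist x E + r"
        using infdist_triangle[of y E x] by (simp add: dist_commute)
      then show "\<Omega> x r \<le> w y"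
        unfolding \<Omega>_def w_def using elim \<open>\<alpha> \<ge> 0\<close> by (intro powr_mono2') auto
    qed
  qed
  define A where "A = 4 powr q * (K * 2 ^ (2 * DIM('a) + 5)) powr Q"
  have "A > 0" using \<open>K > 0\<close> by (simp add: A_def)
  define C where "C = A powr (1 / Q)"
  have "C > 0" using \<open>A > 0\<close> by (simp add: C_def)
  show thesis
  proof (rule that[OF \<open>C > 0\<close>])
    fix f :: "'a \<Rightarrow> real" assume f: "test_function f"
    have "Ck (Suc 0) f" using f unfolding test_function_def by blast
    then have fD: "(f has_derivative (\<lambda>v. grad f x \<bullet> v)) (at x)" for x
      by (rule C1_gradient)
    have gc: "continuous_on UNIV (grad f)"
      using \<open>Ck (Suc 0) f\<close> by (rule C1_gradient)
    have fc: "continuous_on UNIV f"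
      using fD has_derivative_continuous by (metis continuous_at_imp_continuous_on)
    have [measurable]: "f \<in> borel_measurable borel" "grad f \<in> borel_measurable borel"
      using fc gc by (auto intro: borel_measurable_continuous_onI)
    have cs: "compact (closure {x. f x \<noteq> 0})" using f by (simp add: test_function_def)
    have supp: "bounded {x. f x \<noteq> 0}"
      using bounded_subset[OF compact_imp_bounded[OF cs] closure_subset] .
    then obtain R where "R > 0" "{x. f x \<noteq> 0} \<subseteq> ball z R"
      using bounded_subset_ballD by blast
    then have R: "R > 0" "{x. f x \<noteq> 0} \<subseteq> cball z R" by auto
    obtain B where B: "\<And>x. \<bar>f x\<bar> \<le> B"
    proof -
      have "bounded (f ` closure {x. f x \<noteq> 0})"
        using cs fc by (intro compact_imp_bounded compact_continuous_image) (auto intro: continuous_on_subset)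
      then obtain B where B: "\<And>x. x \<in> closure {x. f x \<noteq> 0} \<Longrightarrow> \<bar>f x\<bar> \<le> B"
        by (auto simp: bounded_iff)
      have "\<bar>f x\<bar> \<le> max B 0" for x
        using B[of x] closure_subset[of "{x. f x \<noteq> 0}"] by (cases "f x = 0") auto
      then show thesis using that by blast
    qed
    define I where "I = (\<integral>\<^sup>+y. ennreal (\<bar>f y\<bar> powr q) * W y \<partial>lborel)"
    have Ieq: "(\<integral>\<^sup>+x. epowr (ennreal \<bar>f x\<bar>) q * epowr (ennreal (infdist x E)) (q / p * (n - p) - n) \<partial>lborel) = I"
    proof -
      have "epowr (ennreal \<bar>f x\<bar>) q = ennreal (\<bar>f x\<bar> powr q)" for x
        using q by (intro epowr_ennreal) auto
      then show ?thesis by (simp add: I_def W_def d_def)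
    qed
    have "I \<le> (\<integral>\<^sup>+y. ennreal (B powr q) * (W y * indicator (cball z R) y) \<partial>lborel)"
      unfolding I_def
    proof (intro nn_integral_mono)
      fix y
      show "ennreal (\<bar>f y\<bar> powr q) * W y \<le> ennreal (B powr q) * (W y * indicator (cball z R) y)"
      proof (cases "f y = 0")
        case False
        then have "y \<in> cball z R" using R by blast
        moreover have "\<bar>f y\<bar> powr q \<le> B powr q" using B q by (intro powr_mono2) auto
        ultimately show ?thesis by (simp add: mult_right_mono ennreal_leI)
      qed (use q in simp)
    qed
    also have "\<dots> = ennreal (B powr q) * (\<integral>\<^sup>+y\<in>cball z R. W y \<partial>lborel)"
      by (intro nn_integral_cmult) measurable
    also have "\<dots> < \<infinity>" using Wfin[OF R(1)] by (simp add: ennreal_mult_less_top)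
    finally have "I < \<infinity>" .
    then obtain i where i: "I = ennreal i" "i \<ge> 0" by (cases I) auto
    have fin: "emeasure (density lborel W) {y. t < \<bar>f y\<bar>} < \<infinity>" if "t > 0" for t
    proof -
      have "{y. t < \<bar>f y\<bar>} \<subseteq> cball z R" using R that by auto
      then have "emeasure (density lborel W) {y. t < \<bar>f y\<bar>} \<le> emeasure (density lborel W) (cball z R)"
        by (intro emeasure_mono) auto
      also have "\<dots> = (\<integral>\<^sup>+y\<in>cball z R. W y \<partial>lborel)" by (simp add: emeasure_density)
      also have "\<dots> < \<infinity>" by (rule Wfin[OF R(1)])
      finally show ?thesis .
    qed
    define G where "G = (\<integral>\<^sup>+x. ennreal (norm (grad f x) powr p) \<partial>lborel)"
    have Geq: "(\<integral>\<^sup>+x. epowr (ennreal (norm (grad f x))) p \<partial>lborel) = G"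
    proof -
      have "epowr (ennreal (norm (grad f x))) p = ennreal (norm (grad f x) powr p)" for x
        using pq by (intro epowr_ennreal) auto
      then show ?thesis by (simp add: G_def)
    qed
    \<comment> \<open>Any \<open>D > 0\<close> dominating the gradient norm is allowed, so that a vanishing gradient is not a special case.\<close>
    have claim: "i powr (1 / q) \<le> C * D" if D: "D > 0" "G \<le> ennreal (D powr p)" for D
    proof (cases "i = 0")
      case False
      then have "i > 0" using i by simp
      define v where "v = (\<lambda>y. \<bar>f y\<bar> powr q * infdist y E powr (d - n))"
      have [measurable]: "v \<in> borel_measurable borel" unfolding v_def by measurable
      have "(\<integral>\<^sup>+y. ennreal (v y) \<partial>lborel) = I"
        unfolding I_def
      proof (intro nn_integral_cong_AE)
        show "AE y in lborel. ennreal (v y) = ennreal (\<bar>f y\<bar> powr q) * W y"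
          using off by eventually_elim (simp add: v_def W_def epowr_ennreal ennreal_mult)
      qed
      then have "(\<integral>\<^sup>+y. ennreal (norm (grad f y) * v y powr (1 - 1 / p)) \<partial>lborel) \<le> ennreal (D * i powr (1 - 1 / p))"
        using D i pq \<open>i > 0\<close> by (intro Hoelder_bound) (auto simp: v_def G_def)
      moreover have "v y powr (1 - 1 / p) = \<bar>f y\<bar> powr (\<gamma> - 1) * w y" for y
      proof -
        have "v y powr a = \<bar>f y\<bar> powr (q * a) * infdist y E powr ((d - n) * a)"
          by (simp add: v_def powr_mult powr_powr infdist_nonneg)
        also have "(d - n) * a = - \<alpha>" by (simp add: \<alpha>_def algebra_simps)
        finally show ?thesis by (simp add: w_def \<gamma>_def a_def)
      qed
      ultimately have J: "(\<integral>\<^sup>+y. ennreal (norm (grad f y) * \<bar>f y\<bar> powr (\<gamma> - 1) * w y) \<partial>lborel) \<le> ennreal (D * i powr a)"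
        by (simp add: a_def mult.assoc)
      have "D * i powr a > 0" using D \<open>i > 0\<close> by simp
      have "(\<integral>\<^sup>+y. ennreal (\<bar>f y\<bar> powr (\<gamma> * Q)) * W y \<partial>lborel)
        \<le> ennreal (4 powr (\<gamma> * Q) * (K * 2 ^ (2 * DIM('a) + 5) * (D * i powr a)) powr Q)"
        by (rule level_sets_to_norm[OF fD gc supp \<open>K > 0\<close> \<open>Q \<ge> 1\<close> \<open>\<gamma> \<ge> 1\<close> \<open>D * i powr a > 0\<close> _ _ _ _ \<Omega>w K fin J])
           (auto simp: w_def \<Omega>_def)
      then have "i \<le> 4 powr q * (K * 2 ^ (2 * DIM('a) + 5) * (D * i powr a)) powr Q"
        using i unfolding \<gamma>Q I_def[symmetric] by (simp add: ennreal_le_iff)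
      also have "\<dots> = A * D powr Q * i powr (a * Q)"
        using D \<open>K > 0\<close> by (simp add: A_def powr_mult powr_powr)
      also have "i powr (a * Q) = i / i powr (Q / q)"
        unfolding aQ using \<open>i > 0\<close> by (simp add: powr_diff)
      finally have "i powr (Q / q) \<le> A * D powr Q"
        using \<open>i > 0\<close> by (simp add: pos_le_divide_eq)
      then have "(i powr (Q / q)) powr (1 / Q) \<le> (A * D powr Q) powr (1 / Q)"
        using \<open>Q \<ge> 1\<close> by (intro powr_mono2) auto
      then show ?thesis
        using \<open>Q \<ge> 1\<close> D \<open>A > 0\<close> by (simp add: powr_powr powr_mult C_def)
    qed (use D \<open>C > 0\<close> in simp)
    have "epowr I (1 / q) \<le> ennreal C * epowr G (1 / p)"
    proof (cases G)
      case (real G0)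
      define D0 where "D0 = G0 powr (1 / p)"
      \<comment> \<open>Let \<open>D\<close> decrease to the gradient norm.\<close>
      have "i powr (1 / q) / C \<le> D0"
      proof (rule dense_ge)
        fix D assume "D0 < D"
        then have "D > 0" using order_le_less_trans[of 0 D0 D] by (simp add: D0_def)
        have "G0 = D0 powr p" using real pq by (simp add: D0_def powr_powr)
        also have "\<dots> \<le> D powr p" using \<open>D0 < D\<close> pq by (intro powr_mono2) (auto simp: D0_def)
        finally have "i powr (1 / q) \<le> C * D"
          using real \<open>D > 0\<close> by (intro claim) (auto intro: ennreal_leI)
        then show "i powr (1 / q) / C \<le> D" using \<open>C > 0\<close> by (simp add: pos_divide_le_eq mult.commute)
      qed
      then have "i powr (1 / q) \<le> C * D0" using \<open>C > 0\<close> by (simp add: pos_divide_le_eq mult.commute)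
      moreover have "epowr I (1 / q) = ennreal (i powr (1 / q))"
        unfolding i(1) using i q by (intro epowr_ennreal) auto
      moreover have "epowr G (1 / p) = ennreal D0"
        unfolding real(2) D0_def using real pq by (intro epowr_ennreal) auto
      ultimately show ?thesis using \<open>C > 0\<close> by (simp add: ennreal_mult'[symmetric] D0_def ennreal_leI)
    next
      case top
      then have "epowr G (1 / p) = \<infinity>" using pq by (simp add: epowr_def)
      then show ?thesis using \<open>C > 0\<close> by (simp add: ennreal_mult_top)
    qed
    then show "epowr (\<integral>\<^sup>+x. epowr (ennreal \<bar>f x\<bar>) q
                      * epowr (ennreal (infdist x E)) (q / p * (n - p) - n) \<partial>lborel) (1 / q)
            \<le> ennreal C * epowr (\<integral>\<^sup>+x. epowr (ennreal (norm (grad f x))) p \<partial>lborel) (1 / p)"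
      by (simp only: Ieq Geq)
  qed
qed

theorem theorem1p1:
  fixes E :: "(real ^ 'n) set" and p q n :: real
  assumes n_def: "n = real CARD('n)"
    and "CARD('n) \<ge> 2"
    and "E \<noteq> {}" and "closed E"
    and "1 \<le> p" and "p \<le> q" and "p < n" and "q < n * p / (n - p)"
  shows "(\<exists>C>0::real. \<forall>f :: real ^ 'n \<Rightarrow> real. test_function f \<longrightarrow>
            epowr (\<integral>\<^sup>+x. epowr (ennreal \<bar>f x\<bar>) q
                      * epowr (ennreal (infdist x E)) (q / p * (n - p) - n) \<partial>lborel) (1 / q)
            \<le> ennreal C * epowr (\<integral>\<^sup>+x. epowr (ennreal (norm (grad f x))) p \<partial>lborel) (1 / p))
         \<longleftrightarrow> assouad_dim E < ereal (q / p * (n - p))"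
proof -
  have n: "n = real DIM(real ^ 'n)" using n_def by simp
  show ?thesis
  proof
    assume "\<exists>C>0::real. \<forall>f :: real ^ 'n \<Rightarrow> real. test_function f \<longrightarrow>
            epowr (\<integral>\<^sup>+x. epowr (ennreal \<bar>f x\<bar>) q
                      * epowr (ennreal (infdist x E)) (q / p * (n - p) - n) \<partial>lborel) (1 / q)
            \<le> ennreal C * epowr (\<integral>\<^sup>+x. epowr (ennreal (norm (grad f x))) p \<partial>lborel) (1 / p)"
    then obtain C where C: "C > 0" "\<And>f :: real ^ 'n \<Rightarrow> real. test_function f \<Longrightarrow>
            epowr (\<integral>\<^sup>+x. epowr (ennreal \<bar>f x\<bar>) q
                      * epowr (ennreal (infdist x E)) (q / p * (n - p) - n) \<partial>lborel) (1 / q)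
            \<le> ennreal C * epowr (\<integral>\<^sup>+x. epowr (ennreal (norm (grad f x))) p \<partial>lborel) (1 / p)"
      by blast
    show "assouad_dim E < ereal (q / p * (n - p))"
      unfolding n by (rule assouad_dim_less_of_inequality[where C = C]) (use assms C n in simp_all)
  next
    assume dim: "assouad_dim E < ereal (q / p * (n - p))"
    obtain C where "C > 0" "\<And>f :: real ^ 'n \<Rightarrow> real. test_function f \<Longrightarrow>
            epowr (\<integral>\<^sup>+x. epowr (ennreal \<bar>f x\<bar>) q
                      * epowr (ennreal (infdist x E)) (q / p * (n - p) - n) \<partial>lborel) (1 / q)
            \<le> ennreal C * epowr (\<integral>\<^sup>+x. epowr (ennreal (norm (grad f x))) p \<partial>lborel) (1 / p)"
      unfolding n by (rule inequality_of_assouad_dim_less[of E p q]) (use assms dim n in simp_all)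
    then show "\<exists>C>0::real. \<forall>f :: real ^ 'n \<Rightarrow> real. test_function f \<longrightarrow>
            epowr (\<integral>\<^sup>+x. epowr (ennreal \<bar>f x\<bar>) q
                      * epowr (ennreal (infdist x E)) (q / p * (n - p) - n) \<partial>lborel) (1 / q)
            \<le> ennreal C * epowr (\<integral>\<^sup>+x. epowr (ennreal (norm (grad f x))) p \<partial>lborel) (1 / p)"
      by blast
  qed
qed

end
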